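(* Let $A$ be an infinite-dimensional simple unital $C^*$-algebra, let $G$ be a finite group, let $\alpha:G\to\mathrm{Aut}(A)$ be an action, and let $\omega$ be a free ultrafilter on $\mathbb{N}$. Suppose that for every finite subset $F\subset A$, every $\varepsilon>0$ and every $x\in A_+\setminus\{0\}$, there exist a separable $C^*$-subalgebra $B\subset A$ and a positive element $c\in A\cap B'$ with $\|c\|=1$ such that: (1) $\|ca-ac\|<\varepsilon$ for all $a\in F$; (2) for each $a\in F$ there is $b\in B$ with $\|ca-b\|<\varepsilon$; (3) $1-c\precsim x$; (4) the relative commutant $A_\omega\cap B'$ has real rank zero. Then $\alpha$ has the tracial Rokhlin property if and only if $\alpha$ has the weak tracial Rokhlin property.
   Context: For positive elements $a,b$ of a $C^*$-algebra $A$, $a\precsim b$ (Cuntz subequivalence) means there is a sequence $(v_n)$ in $A$ with $\|a-v_nbv_n^*\|\to 0$. $A\cap B'$ denotes the set of elements of $A$ commuting with every element of $B$. The ultrapower is $A_\omega=\ell^\infty(A)/\{(a_n): \lim_{n\to\omega}\|a_n\|=0\}$, with $A$ identified with the classes of constant sequences, and $A_\omega\cap B'$ is the relative commutant of $B$ in $A_\omega$. An action $\alpha$ of a finite group $G$ on a simple unital $C^*$-algebra $A$ has the weak tracial Rokhlin property if for every finite subset $F\subset A$, every $\varepsilon>0$ and every $x\in A_+$ with $\|x\|=1$, there exist mutually orthogonal positive contractions $f_g\in A$ ($g\in G$), with $f=\sum_{g\in G}f_g$, such that: (a) $\|f_ga-af_g\|<\varepsilon$ for all $g\in G$, $a\in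 F$; (b) $\|\alpha_g(f_h)-f_{gh}\|<\varepsilon$ for all $g,h\in G$; (c) $1-f\precsim x$; (d) $\|fxf\|>1-\varepsilon$. It has the tracial Rokhlin property if the $f_g$ can moreover be chosen to be mutually orthogonal projections. *)

theory Defs
  imports "HOL-Analysis.Analysis" "HOL-Algebra.Group"
begin

locale unital_cstar_algebra =
  fixes sc :: "complex \<Rightarrow> 'a::{real_normed_algebra_1, banach} \<Rightarrow> 'a"
    and adj :: "'a \<Rightarrow> 'a"
  assumes sc_add_right: "sc c (a + b) = sc c a + sc c b"
    and sc_add_left: "sc (c + d) a = sc c a + sc d a"
    and sc_sc: "sc c (sc d a) = sc (c * d) a"
    and sc_of_real: "sc (complex_of_real r) a = scaleR r a"
    and sc_norm: "norm (sc c a) = cmod c * norm a"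
    and sc_mult_left: "sc c a * b = sc c (a * b)"
    and sc_mult_right: "a * sc c b = sc c (a * b)"
    and adj_add: "adj (a + b) = adj a + adj b"
    and adj_sc: "adj (sc c a) = sc (cnj c) (adj a)"
    and adj_mult: "adj (a * b) = adj b * adj a"
    and adj_adj: "adj (adj a) = a"
    and cstar_identity: "norm (adj a * a) = (norm a)\<^sup>2"

definition invertible_el :: "'a::ring_1 \<Rightarrow> bool" where
  "invertible_el a \<longleftrightarrow> (\<exists>b. a * b = 1 \<and> b * a = 1)"

definition cspectrum :: "(complex \<Rightarrow> 'a \<Rightarrow> 'a) \<Rightarrow> 'a::ring_1 \<Rightarrow> complex set" where
  "cspectrum sc a = {z. \<not> invertible_el (a - sc z 1)}"

definition positive_el :: "(complex \<Rightarrow> 'a \<Rightarrow> 'a) \<Rightarrow> ('a \<Rightarrow> 'a) \<Rightarrow> 'a::ring_1 \<Rightarrow> bool" where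
  "positive_el sc adj a \<longleftrightarrow> adj a = a \<and> cspectrum sc a \<subseteq> complex_of_real ` {0..}"

definition pos_contraction ::
  "(complex \<Rightarrow> 'a \<Rightarrow> 'a) \<Rightarrow> ('a \<Rightarrow> 'a) \<Rightarrow> 'a::{ring_1,real_normed_vector} \<Rightarrow> bool" where
  "pos_contraction sc adj a \<longleftrightarrow> positive_el sc adj a \<and> norm a \<le> 1"

definition projection_el :: "('a \<Rightarrow> 'a) \<Rightarrow> 'a::ring_1 \<Rightarrow> bool" where
  "projection_el adj p \<longleftrightarrow> adj p = p \<and> p * p = p"

definition cuntz_below :: "('a \<Rightarrow> 'a) \<Rightarrow> 'a::real_normed_algebra \<Rightarrow> 'a \<Rightarrow> bool" where
  "cuntz_below adj a b \<longleftrightarrow> (\<exists>v::nat \<Rightarrow> 'a. (\<lambda>n. norm (a - v n * b * adj (v n))) \<longlonglongrightarrow> 0)"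

definition cstar_subalgebra ::
  "(complex \<Rightarrow> 'a \<Rightarrow> 'a) \<Rightarrow> ('a \<Rightarrow> 'a) \<Rightarrow> 'a::real_normed_algebra set \<Rightarrow> bool" where
  "cstar_subalgebra sc adj B \<longleftrightarrow> 0 \<in> B \<and>
     (\<forall>a\<in>B. \<forall>b\<in>B. a + b \<in> B \<and> a * b \<in> B) \<and>
     (\<forall>c. \<forall>a\<in>B. sc c a \<in> B) \<and> (\<forall>a\<in>B. adj a \<in> B) \<and> closed B"

definition separable_set :: "'a::topological_space set \<Rightarrow> bool" where
  "separable_set B \<longleftrightarrow> (\<exists>D. countable D \<and> D \<subseteq> B \<and> B \<subseteq> closure D)"

definition closed_ideal ::
  "(complex \<Rightarrow> 'a \<Rightarrow> 'a) \<Rightarrow> 'a::real_normed_algebra set \<Rightarrow> bool" where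
  "closed_ideal sc I \<longleftrightarrow> 0 \<in> I \<and> (\<forall>a\<in>I. \<forall>b\<in>I. a + b \<in> I) \<and> (\<forall>c. \<forall>a\<in>I. sc c a \<in> I) \<and>
     (\<forall>a\<in>I. \<forall>x. x * a \<in> I \<and> a * x \<in> I) \<and> closed I"

definition simple_algebra :: "(complex \<Rightarrow> 'a \<Rightarrow> 'a) \<Rightarrow> 'a::real_normed_algebra itself \<Rightarrow> bool" where
  "simple_algebra sc _ \<longleftrightarrow> (\<forall>I::'a set. closed_ideal sc I \<longrightarrow> I = {0} \<or> I = UNIV)"

definition infinite_dimensional :: "(complex \<Rightarrow> 'a \<Rightarrow> 'a) \<Rightarrow> 'a::ab_group_add itself \<Rightarrow> bool" where
  "infinite_dimensional sc _ \<longleftrightarrow>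
     \<not> (\<exists>S::'a set. finite S \<and> (\<forall>a. \<exists>f. a = (\<Sum>s\<in>S. sc (f s) s)))"

definition star_automorphism ::
  "(complex \<Rightarrow> 'a \<Rightarrow> 'a) \<Rightarrow> ('a \<Rightarrow> 'a) \<Rightarrow> ('a::ring_1 \<Rightarrow> 'a) \<Rightarrow> bool" where
  "star_automorphism sc adj \<phi> \<longleftrightarrow> bij \<phi> \<and> (\<forall>a b. \<phi> (a + b) = \<phi> a + \<phi> b \<and> \<phi> (a * b) = \<phi> a * \<phi> b) \<and>
     (\<forall>c a. \<phi> (sc c a) = sc c (\<phi> a)) \<and> (\<forall>a. \<phi> (adj a) = adj (\<phi> a))"

definition group_action ::
  "(complex \<Rightarrow> 'a \<Rightarrow> 'a) \<Rightarrow> ('a \<Rightarrow> 'a) \<Rightarrow> ('g, 'm) monoid_scheme \<Rightarrow> ('g \<Rightarrow> 'a::ring_1 \<Rightarrow> 'a) \<Rightarrow> bool" where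
  "group_action sc adj G \<alpha> \<longleftrightarrow> (\<forall>g\<in>carrier G. star_automorphism sc adj (\<alpha> g)) \<and>
     (\<forall>g\<in>carrier G. \<forall>h\<in>carrier G. \<alpha> (g \<otimes>\<^bsub>G\<^esub> h) = \<alpha> g \<circ> \<alpha> h)"

definition rokhlin_prop ::
  "bool \<Rightarrow> (complex \<Rightarrow> 'a \<Rightarrow> 'a) \<Rightarrow> ('a \<Rightarrow> 'a) \<Rightarrow> ('g, 'm) monoid_scheme \<Rightarrow>
   ('g \<Rightarrow> 'a::{real_normed_algebra_1} \<Rightarrow> 'a) \<Rightarrow> bool" where
  "rokhlin_prop proj sc adj G \<alpha> \<longleftrightarrow>
    (\<forall>F \<epsilon> x. finite F \<and> \<epsilon> > 0 \<and> positive_el sc adj x \<and> norm x = 1 \<longrightarrow>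
      (\<exists>f::'g \<Rightarrow> 'a.
         (\<forall>g\<in>carrier G. pos_contraction sc adj (f g) \<and> (proj \<longrightarrow> projection_el adj (f g))) \<and>
         (\<forall>g\<in>carrier G. \<forall>h\<in>carrier G. g \<noteq> h \<longrightarrow> f g * f h = 0) \<and>
         (\<forall>g\<in>carrier G. \<forall>a\<in>F. norm (f g * a - a * f g) < \<epsilon>) \<and>
         (\<forall>g\<in>carrier G. \<forall>h\<in>carrier G. norm (\<alpha> g (f h) - f (g \<otimes>\<^bsub>G\<^esub> h)) < \<epsilon>) \<and>
         cuntz_below adj (1 - (\<Sum>g\<in>carrier G. f g)) x \<and>
         norm ((\<Sum>g\<in>carrier G. f g) * x * (\<Sum>g\<in>carrier G. f g)) > 1 - \<epsilon>))"

abbreviation "weak_tracial_rokhlin \<equiv> rokhlin_prop False"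
abbreviation "tracial_rokhlin \<equiv> rokhlin_prop True"

definition free_ultrafilter :: "nat filter \<Rightarrow> bool" where
  "free_ultrafilter \<omega> \<longleftrightarrow> \<omega> \<noteq> bot \<and> (\<forall>P. eventually P \<omega> \<or> eventually (\<lambda>n. \<not> P n) \<omega>) \<and>
     (\<forall>m. \<not> eventually (\<lambda>n. n = m) \<omega>)"

text \<open>Elements of \<open>A\<^sub>\<omega>\<close> are represented by bounded sequences; the norm of the class
of \<open>X\<close> is \<open>lim\<^sub>\<omega> \<parallel>X n\<parallel>\<close>.\<close>
definition unorm :: "nat filter \<Rightarrow> (nat \<Rightarrow> 'a::real_normed_vector) \<Rightarrow> real" where
  "unorm \<omega> X = Lim \<omega> (\<lambda>n. norm (X n))"

definition rel_comm_elt ::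
  "nat filter \<Rightarrow> 'a::real_normed_algebra set \<Rightarrow> (nat \<Rightarrow> 'a) \<Rightarrow> bool" where
  "rel_comm_elt \<omega> B X \<longleftrightarrow> bounded (range X) \<and> (\<forall>b\<in>B. unorm \<omega> (\<lambda>n. X n * b - b * X n) = 0)"

definition u_self_adjoint :: "nat filter \<Rightarrow> ('a \<Rightarrow> 'a) \<Rightarrow> (nat \<Rightarrow> 'a::real_normed_vector) \<Rightarrow> bool" where
  "u_self_adjoint \<omega> adj X \<longleftrightarrow> unorm \<omega> (\<lambda>n. adj (X n) - X n) = 0"

definition rel_comm_invertible ::
  "nat filter \<Rightarrow> 'a::real_normed_algebra_1 set \<Rightarrow> (nat \<Rightarrow> 'a) \<Rightarrow> bool" where
  "rel_comm_invertible \<omega> B X \<longleftrightarrow> (\<exists>Y. rel_comm_elt \<omega> B Y \<and>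
     unorm \<omega> (\<lambda>n. X n * Y n - 1) = 0 \<and> unorm \<omega> (\<lambda>n. Y n * X n - 1) = 0)"

definition rel_comm_real_rank_zero ::
  "nat filter \<Rightarrow> ('a \<Rightarrow> 'a) \<Rightarrow> 'a::real_normed_algebra_1 set \<Rightarrow> bool" where
  "rel_comm_real_rank_zero \<omega> adj B \<longleftrightarrow>
    (\<forall>X. rel_comm_elt \<omega> B X \<and> u_self_adjoint \<omega> adj X \<longrightarrow>
      (\<forall>\<epsilon>>0. \<exists>Y. rel_comm_elt \<omega> B Y \<and> u_self_adjoint \<omega> adj Y \<and> rel_comm_invertible \<omega> B Y \<and>
                unorm \<omega> (\<lambda>n. X n - Y n) < \<epsilon>))"

end

theory Submission
  imports Defs "HOL-Computational_Algebra.Fundamental_Theorem_Algebra"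
begin

text \<open>
  Let \<open>f\<^sub>g\<close> be weak Rokhlin towers, almost commuting with \<open>B\<close> and \<open>c\<close>. By real rank zero of
  \<open>A\<^sub>\<omega> \<inter> B'\<close>, the element \<open>f\<^sub>1 c f\<^sub>1 - (1 - \<delta>)\<close> is close to an invertible self-adjoint one, whose
  positive spectral projection \<open>p\<close> almost commutes with \<open>B\<close>. Since \<open>c\<close> and \<open>f\<^sub>1\<close> almost act as
  units on \<open>p\<close>, the projection \<open>p\<close> almost commutes with \<open>F\<close>, and its translates \<open>\<alpha>\<^sub>g(p)\<close> are
  almost orthogonal, hence close to orthogonal projections \<open>q\<^sub>g\<close>. On the complement \<open>e\<close> of their sum,
  \<open>\<Sum> f\<^sub>g \<alpha>\<^sub>g(c) f\<^sub>g\<close> has norm less than one, so \<open>e\<close> is below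
  \<open>1 - \<Sum> f\<^sub>g \<alpha>\<^sub>g(c) f\<^sub>g = (1 - f\<^sup>2) + \<Sum> f\<^sub>g \<alpha>\<^sub>g(1 - c) f\<^sub>g\<close>, whose pieces are made to fit under
  orthogonal elements below \<open>x\<close>; these exist because \<open>A\<close> is simple and infinite-dimensional.
  The weak Rokhlin property is applied to a norm-one element supported where \<open>c\<close> is near \<open>1\<close>, which
  keeps \<open>p\<close> nonzero; simplicity then gives condition (d). The continuous functional calculus for a
  single self-adjoint element is all the spectral theory that is needed.
\<close>

section \<open>Invertibility and spectra\<close>

text \<open>The obstacle is that the inverse supplied by real rank zero comes with a bound
  \<open>M\<close> that is known only after \<open>B\<close>, \<open>c\<close> and the whole
  sequence of towers are fixed, so no constant may depend on it. Only the commutation of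
  \<open>p\<close> with \<open>B\<close> involves \<open>M\<close>; for it the index of the tower is
  chosen last, along the ultrafilter. Everything else uses estimates free of \<open>M\<close>: with
  \<open>d = f c f\<close>, the projection \<open>p\<close> is close to \<open>u * d\<close> for
  some \<open>u\<close> of norm at most \<open>2\<close>, and \<open>norm ((1 - p) * d)\<close> is
  at most about \<open>1 - \<delta>\<close>. The first lets the translates of \<open>p\<close>
  inherit the orthogonality of the towers, the second controls what the projections leave over.
  Since \<open>c\<close> commutes with \<open>B\<close> exactly, a sequence \<open>f c f\<close>
  commutes with \<open>B\<close> in the limit as soon as the towers do, and separability lets one
  sequence of towers do this for all of \<open>B\<close>. The spectral cut is made once, at the unit
  of \<open>G\<close>, and transported by the action. Hence \<open>F\<close> and the elements that
  bound the remainder are first moved back by inverses.\<close>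

lemma invertible_el_near_one:
  fixes x :: "'a::{real_normed_algebra_1, banach}"
  assumes "norm (1 - x) < 1"
  shows "invertible_el x"
proof -
  define y where "y = 1 - x"
  have y: "norm y < 1" "x = 1 - y" using assms by (simp_all add: y_def)
  have sm: "summable (\<lambda>n. y ^ n)" by (rule complete_algebra_summable_geometric[OF y(1)])
  define s where "s = (\<Sum>n. y ^ n)"
  have "y * s = (\<Sum>n. y * y ^ n)" unfolding s_def using suminf_mult[OF sm] by simp
  also have "\<dots> = s - 1" unfolding s_def using suminf_split_head[OF sm] by simp
  finally have 1: "(1 - y) * s = 1" by (simp add: algebra_simps)
  have "s * y = (\<Sum>n. y ^ n * y)" unfolding s_def using suminf_mult2[OF sm] by simp
  also have "\<dots> = s - 1" unfolding s_def using suminf_split_head[OF sm] by (simp add: power_commutes)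
  finally have 2: "s * (1 - y) = 1" by (simp add: algebra_simps)
  show ?thesis unfolding invertible_el_def y(2) using 1 2 by blast
qed

lemma invertible_el_mult:
  "invertible_el (a::'a::ring_1) \<Longrightarrow> invertible_el b \<Longrightarrow> invertible_el (a * b)"
  unfolding invertible_el_def
proof (elim exE)
  fix c d assume "a * c = 1 \<and> c * a = 1" "b * d = 1 \<and> d * b = 1"
  then have "a * b * (d * c) = 1" "d * c * (a * b) = 1"
    by (metis mult.assoc mult_1_left)+
  then show "\<exists>e. a * b * e = 1 \<and> e * (a * b) = 1" by blast
qed

lemma invertible_el_lr:
  fixes a :: "'a::ring_1"
  assumes "b * a = 1" "a * c = 1"
  shows "invertible_el a"
  using assms unfolding invertible_el_def by (metis mult.assoc mult_1_left mult_1_right)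

lemma invertible_el_lr':
  fixes a :: "'a::ring_1"
  assumes "invertible_el (b * a)" "invertible_el (a * c)"
  shows "invertible_el a"
proof -
  obtain d e where "d * (b * a) = 1" "(a * c) * e = 1" using assms unfolding invertible_el_def by blast
  then show ?thesis by (intro invertible_el_lr[of "d * b" a "c * e"]) (simp_all add: mult.assoc)
qed

lemma invertible_el_commute_factor:
  fixes a :: "'a::ring_1"
  assumes "invertible_el (a * b)" "a * b = b * a"
  shows "invertible_el a"
  using assms invertible_el_lr'[of b a b] by simp

text \<open>Jacobson's identity: the inverse \<open>1 + b * u * a\<close> is what the geometric
  series for \<open>1 - b * a\<close> suggests when \<open>u\<close> inverts
  \<open>1 - a * b\<close>. It lets nonzero spectral values pass from \<open>a * b\<close> to
  \<open>b * a\<close>.\<close>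

lemma invertible_el_one_minus_swap:
  fixes a :: "'a::ring_1"
  assumes "invertible_el (1 - a * b)"
  shows "invertible_el (1 - b * a)"
proof -
  obtain u where u: "(1 - a * b) * u = 1" "u * (1 - a * b) = 1"
    using assms unfolding invertible_el_def by blast
  from u(1) have u1: "a * (b * u) = u - 1" by (simp add: algebra_simps)
  from u(2) have u2: "u * (a * b) = u - 1" by (simp add: algebra_simps)
  have "(1 - b * a) * (1 + b * u * a) = 1 - b * a + b * u * a - b * (a * (b * u)) * a"
    by (simp add: algebra_simps)
  also have "\<dots> = 1" unfolding u1 by (simp add: algebra_simps)
  finally have 1: "(1 - b * a) * (1 + b * u * a) = 1" .
  have "(1 + b * u * a) * (1 - b * a) = 1 - b * a + b * u * a - b * (u * (a * b)) * a"
    by (simp add: algebra_simps)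
  also have "\<dots> = 1" unfolding u2 by (simp add: algebra_simps)
  finally show ?thesis using 1 unfolding invertible_el_def by blast
qed

context unital_cstar_algebra
begin

section \<open>Arithmetic of scalars and adjoints\<close>

lemma sc_zero_left [simp]: "sc 0 a = 0"
  using sc_of_real[of 0 a] by simp
lemma sc_one_left [simp]: "sc 1 a = a"
  using sc_of_real[of 1 a] by simp
lemma sc_zero_right [simp]: "sc c 0 = 0"
  using sc_add_right[of c 0 0] by simp
lemma sc_minus_left: "sc (- c) a = - sc c a"
  using sc_add_left[of c "-c" a] by (simp add: eq_neg_iff_add_eq_0 add.commute)
lemma sc_minus_right: "sc c (- a) = - sc c a"
  using sc_add_right[of c a "-a"] by (simp add: eq_neg_iff_add_eq_0 add.commute)
lemma sc_diff_left: "sc (c - d) a = sc c a - sc d a"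
  using sc_add_left[of c "-d" a] by (simp add: sc_minus_left)
lemma sc_diff_right: "sc c (a - b) = sc c a - sc c b"
  using sc_add_right[of c a "-b"] by (simp add: sc_minus_right)

lemma adj_zero [simp]: "adj 0 = 0"
  using adj_add[of 0 0] by simp
lemma adj_one [simp]: "adj 1 = 1"
  using adj_mult[of "adj 1" 1] adj_adj by (metis mult_1_right mult_1_left)
lemma adj_minus: "adj (- a) = - adj a"
  using adj_add[of a "-a"] by (simp add: eq_neg_iff_add_eq_0 add.commute)
lemma adj_diff: "adj (a - b) = adj a - adj b"
  using adj_add[of a "-b"] by (simp add: adj_minus)
lemma adj_scaleR: "adj (r *\<^sub>R a) = r *\<^sub>R adj a"
  using adj_sc[of "of_real r" a] by (simp add: sc_of_real)
lemma adj_power: "adj (a ^ n) = adj a ^ n"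
  by (induction n) (simp_all add: adj_mult power_commutes)
lemma adj_sum: "adj (sum f S) = (\<Sum>s\<in>S. adj (f s))"
  by (induction S rule: infinite_finite_induct) (simp_all add: adj_add)

lemma norm_adj [simp]: "norm (adj a) = norm a"
proof -
  have *: "norm b \<le> norm (adj b)" for b
  proof (cases "b = 0")
    case False
    have "norm b * norm b \<le> norm (adj b) * norm b"
      using norm_mult_ineq[of "adj b" b] cstar_identity[of b] by (simp add: power2_eq_square)
    then show ?thesis using False by simp
  qed simp
  show ?thesis using *[of a] *[of "adj a"] by (simp add: adj_adj)
qed

lemma cstar_identity': "norm (a * adj a) = (norm a)\<^sup>2"
  using cstar_identity[of "adj a"] by (simp add: adj_adj)

lemma bounded_linear_adj: "bounded_linear adj"
  by (rule bounded_linear_intro[of _ 1]) (simp_all add: adj_add adj_scaleR)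

lemma tendsto_adj: "(f \<longlongrightarrow> a) F \<Longrightarrow> ((\<lambda>x. adj (f x)) \<longlongrightarrow> adj a) F"
  by (rule bounded_linear.tendsto[OF bounded_linear_adj])

lemma norm_sa_square: "adj a = a \<Longrightarrow> norm (a * a) = (norm a)\<^sup>2"
  using cstar_identity[of a] by simp

text \<open>Only exponents \<open>2 ^ k\<close> come out of iterating the C*-identity. They replace
  the spectral radius formula and also serve to compare norms of orthogonal sums.\<close>

lemma norm_sa_power2: assumes "adj a = a" shows "norm (a ^ 2 ^ k) = norm a ^ 2 ^ k"
proof (induction k)
  case (Suc k)
  have "a ^ 2 ^ Suc k = a ^ 2 ^ k * a ^ 2 ^ k" by (simp add: power_add[symmetric] mult_2)
  moreover have "adj (a ^ 2 ^ k) = a ^ 2 ^ k" using assms by (simp add: adj_power)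
  ultimately have "norm (a ^ 2 ^ Suc k) = (norm (a ^ 2 ^ k))\<^sup>2" by (simp add: norm_sa_square)
  then show ?case using Suc by (simp add: power_mult[symmetric] mult.commute)
qed simp

lemma re_im_decomp:
  obtains h k where "adj h = h" "adj k = k" "a = h + sc \<i> k" "adj a = h - sc \<i> k"
proof
  let ?h = "(1/2) *\<^sub>R (a + adj a)" and ?k = "sc (- \<i> / 2) (a - adj a)"
  show "adj ?h = ?h" by (simp add: adj_scaleR adj_add adj_adj add.commute)
  have "adj ?k = sc (\<i> / 2) (adj a - a)" by (simp add: adj_sc adj_diff adj_adj)
  also have "\<dots> = - sc (\<i>/2) (a - adj a)" by (simp add: sc_minus_right[symmetric])
  also have "\<dots> = ?k" by (simp add: sc_minus_left[symmetric])
  finally show "adj ?k = ?k" .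
  have ik: "sc \<i> ?k = (1/2) *\<^sub>R (a - adj a)"
  proof -
    have "\<i> * (- \<i> / 2) = complex_of_real (1/2)" by simp
    then show ?thesis by (metis sc_sc sc_of_real)
  qed
  show "a = ?h + sc \<i> ?k" unfolding ik by (simp add: scaleR_add_right[symmetric] flip: scaleR_2)
  show "adj a = ?h - sc \<i> ?k" unfolding ik by (simp add: scaleR_diff_right[symmetric] flip: scaleR_2)
qed

section \<open>Spectra of general and of self-adjoint elements\<close>

abbreviation "spec \<equiv> cspectrum sc"

lemma spec_iff: "z \<in> spec a \<longleftrightarrow> \<not> invertible_el (a - sc z 1)"
  by (simp add: cspectrum_def)

lemma invertible_el_sc: assumes "c \<noteq> 0" shows "invertible_el (sc c a) \<longleftrightarrow> invertible_el a"
proof -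
  have *: "invertible_el (sc c a)" if inv: "invertible_el a" and c: "c \<noteq> 0" for a c
  proof -
    obtain b where b: "a * b = 1" "b * a = 1" using inv unfolding invertible_el_def by blast
    have "sc c a * sc (inverse c) b = 1" "sc (inverse c) b * sc c a = 1"
      using c b by (simp_all add: sc_mult_left sc_mult_right sc_sc)
    then show ?thesis unfolding invertible_el_def by blast
  qed
  have "sc (inverse c) (sc c a) = a" using assms by (simp add: sc_sc)
  then show ?thesis using *[of a c] *[of "sc c a" "inverse c"] assms by auto
qed

lemma spec_sc: "c \<noteq> 0 \<Longrightarrow> z \<in> spec (sc c a) \<longleftrightarrow> z / c \<in> spec a"
proof -
  assume c: "c \<noteq> 0"
  have "sc c (a - sc (z / c) 1) = sc c a - sc z 1" using c by (simp add: sc_diff_right sc_sc)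
  then show ?thesis unfolding spec_iff using invertible_el_sc[OF c, of "a - sc (z/c) 1"] by simp
qed

lemma spec_shift: "z \<in> spec (a + sc c 1) \<longleftrightarrow> z - c \<in> spec a"
  unfolding spec_iff by (simp add: sc_diff_left algebra_simps)

lemma spec_shift_real: "z \<in> spec (a + r *\<^sub>R 1) \<longleftrightarrow> z - complex_of_real r \<in> spec a"
  using spec_shift[of z a "complex_of_real r"] by (simp add: sc_of_real)

lemma spec_uminus: "z \<in> spec (- a) \<longleftrightarrow> - z \<in> spec a"
  using spec_sc[of "-1" z a] by (simp add: sc_minus_left)

lemma spec_norm_le: assumes "z \<in> spec a" shows "cmod z \<le> norm a"
proof (rule ccontr)
  assume "\<not> ?thesis"
  then have z: "norm a < cmod z" "z \<noteq> 0" by auto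
  have "norm (1 - (1 - sc (1/z) a)) < 1"
    using z by (simp add: sc_norm norm_divide divide_simps)
  from invertible_el_near_one[OF this] have "invertible_el (1 - sc (1/z) a)" .
  then have "invertible_el (sc (- z) (1 - sc (1/z) a))" using z by (simp add: invertible_el_sc)
  moreover have "sc (- z) (1 - sc (1/z) a) = a - sc z 1"
    using z by (simp add: sc_diff_right sc_sc sc_minus_left)
  ultimately show False using assms by (simp add: spec_iff)
qed

text \<open>Arens' trick: shift by a large imaginary scalar.\<close>

lemma spec_sa_real: assumes "adj a = a" "z \<in> spec a" shows "Im z = 0"
proof (rule ccontr)
  assume b: "Im z \<noteq> 0"
  have key: "(Im z + t)\<^sup>2 \<le> (norm a)\<^sup>2 + t\<^sup>2" for t
  proof -
    let ?c = "complex_of_real t * \<i>"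
    have "z + ?c \<in> spec (a + sc ?c 1)" using assms(2) by (simp add: spec_shift)
    then have "cmod (z + ?c) \<le> norm (a + sc ?c 1)" by (rule spec_norm_le)
    then have "(cmod (z + ?c))\<^sup>2 \<le> norm (adj (a + sc ?c 1) * (a + sc ?c 1))"
      by (simp add: cstar_identity power_mono)
    also have "adj (a + sc ?c 1) * (a + sc ?c 1) = a * a + (t\<^sup>2) *\<^sub>R 1"
    proof -
      have ad: "adj (a + sc ?c 1) = a - sc ?c 1" 
        using assms(1) by (simp add: adj_add adj_sc sc_minus_left)
      have "adj (a + sc ?c 1) * (a + sc ?c 1) = a * a - sc (?c * ?c) 1"
        unfolding ad by (simp add: algebra_simps sc_mult_left sc_mult_right sc_sc sc_diff_right)
      also have "?c * ?c = - complex_of_real (t\<^sup>2)" by (simp add: power2_eq_square algebra_simps)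
      finally show ?thesis by (simp only: sc_minus_left sc_of_real) simp
    qed
    also have "norm \<dots> \<le> norm (a * a) + t\<^sup>2" by (rule norm_triangle_le) simp
    also have "norm (a * a) = (norm a)\<^sup>2" using norm_sa_square[OF assms(1)] .
    finally have "(cmod (z + ?c))\<^sup>2 \<le> (norm a)\<^sup>2 + t\<^sup>2" .
    moreover have "(Im z + t)\<^sup>2 \<le> (cmod (z + ?c))\<^sup>2" by (simp add: cmod_power2)
    ultimately show ?thesis by linarith
  qed
  from key[of "((norm a)\<^sup>2 + 1) / (2 * Im z)"] have "(Im z)\<^sup>2 + ((norm a)\<^sup>2 + 1) \<le> (norm a)\<^sup>2"
    using b by (simp add: power2_sum)
  then show False by (smt (verit) zero_le_power2)
qed

lemma spec_sa_complex: "adj a = a \<Longrightarrow> z \<in> spec a \<Longrightarrow> z = complex_of_real (Re z)"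
  using spec_sa_real[of a z] by (simp add: complex_eq_iff)

end

lemma norm_mult_le:
  fixes a :: "'a::real_normed_algebra"
  assumes "norm a \<le> r" "norm b \<le> s" shows "norm (a * b) \<le> r * s"
  by (rule order_trans[OF norm_mult_ineq mult_mono]) (use assms order_trans[OF norm_ge_zero assms(1)] in auto)

lemma norm_diff_mono:
  fixes a :: "'a::real_normed_vector"
  shows "norm a \<le> r \<Longrightarrow> norm b \<le> s \<Longrightarrow> norm (a - b) \<le> r + s"
  by (rule order_trans[OF norm_triangle_ineq4 add_mono])

lemma norm_mult_ineq3:
  fixes a :: "'a::real_normed_algebra"
  shows "norm (a * b * c) \<le> norm a * norm b * norm c"
  by (meson mult_right_mono norm_ge_zero norm_mult_ineq order_trans)

text \<open>Partial fractions: the inverse of \<open>1 - x * x\<close> is the mean of those of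
  \<open>1 - x\<close> and \<open>1 + x\<close>. This is the averaging over the two square roots by
  which \<open>norm_in_spec_aux\<close> doubles exponents.\<close>

lemma inverse_one_minus_square:
  fixes x :: "'a::real_algebra_1"
  assumes "(1 - x) * U = 1" "U * (1 - x) = 1" "(1 + x) * W = 1" "W * (1 + x) = 1"
  shows "(1 - x * x) * ((1/2) *\<^sub>R (U + W)) = 1" "((1/2) *\<^sub>R (U + W)) * (1 - x * x) = 1"
proof -
  have a: "1 - x * x = (1 + x) * (1 - x)" "1 - x * x = (1 - x) * (1 + x)" by (simp_all add: algebra_simps)
  have "(1 - x * x) * U = 1 + x" unfolding a(1) using assms(1) by (simp only: mult.assoc mult_1_right)
  moreover have "(1 - x * x) * W = 1 - x" unfolding a(2) using assms(3) by (simp only: mult.assoc mult_1_right)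
  ultimately have "(1 - x * x) * (U + W) = 2 *\<^sub>R 1"
    by (simp add: distrib_left scaleR_2)
  then show "(1 - x * x) * ((1/2) *\<^sub>R (U + W)) = 1" by simp
  have "U * (1 - x * x) = 1 + x" unfolding a(2) using assms(2) by (simp only: mult.assoc[symmetric] mult_1_left)
  moreover have "W * (1 - x * x) = 1 - x" unfolding a(1) using assms(4) by (simp only: mult.assoc[symmetric] mult_1_left)
  ultimately have "(U + W) * (1 - x * x) = 2 *\<^sub>R 1"
    by (simp add: distrib_right scaleR_2)
  then show "((1/2) *\<^sub>R (U + W)) * (1 - x * x) = 1" by simp
qed

context unital_cstar_algebra
begin

text \<open>If the resolvent were defined on the closed disc, it would be uniformly continuous there.
  Averaging over square roots carries the modulus of continuity at radius \<open>r < 1\<close> versus \<open>1\<close> over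
  to \<open>h ^ 2 ^ k\<close>, uniformly in \<open>k\<close>, forcing \<open>h ^ 2 ^ k\<close> to be small although it has norm one.\<close>

lemma norm_in_spec_aux:
  assumes h: "adj h = h" "norm h = 1"
  shows "\<exists>z\<in>spec h. cmod z = 1"
proof (rule ccontr)
  assume no: "\<not> ?thesis"
  have inv: "invertible_el (1 - sc z h)" if "z \<in> cball 0 1" for z
  proof (cases "z = 0")
    case True
    then show ?thesis by (simp add: invertible_el_def)
  next
    case False
    have "1 / z \<notin> spec h"
    proof
      assume s: "1 / z \<in> spec h"
      from spec_norm_le[OF s] have "cmod z \<ge> 1" using h False by (simp add: norm_divide divide_simps)
      then have "cmod z = 1" using that by simp
      then have "cmod (1 / z) = 1" by (simp add: norm_divide)
      then show False using s no by blast
    qed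
    then have "invertible_el (sc (- z) (h - sc (1 / z) 1))" using False by (simp add: spec_iff invertible_el_sc)
    then show ?thesis using False by (simp add: sc_diff_right sc_sc sc_minus_left)
  qed
  define R where "R = (\<lambda>z. SOME b. (1 - sc z h) * b = 1 \<and> b * (1 - sc z h) = 1)"
  have R: "(1 - sc z h) * R z = 1" "R z * (1 - sc z h) = 1" if "z \<in> cball 0 1" for z
    using someI_ex[OF inv[OF that, unfolded invertible_el_def]] unfolding R_def by auto
  have "continuous_on (cball 0 1) R"
    unfolding continuous_on_iff
  proof (intro ballI allI impI)
    fix z :: complex and e :: real assume z: "z \<in> cball 0 1" and e: "0 < e"
    define K where "K = norm (R z) + 1"
    have K: "K \<ge> 1" "norm (R z) \<le> K" by (simp_all add: K_def)
    \<comment> \<open>By the resolvent identity \<open>R z'\<close> occurs on both sides. The first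
      bound makes the coefficient of \<open>norm (R z' - R z)\<close> on the right at most
      \<open>1/2\<close>, so that it can be absorbed; the second makes the rest smaller than
      \<open>e\<close>.\<close>
    define d where "d = min (1 / (2 * K)) (e / (4 * K\<^sup>2))"
    have "d > 0" using K e by (simp add: d_def)
    moreover have "dist (R z') (R z) < e" if z': "z' \<in> cball 0 1" and dz: "dist z' z < d" for z'
    proof -
      let ?D = "R z' - R z"
      have "R z' * (sc (z' - z) h) * R z = R z' * ((1 - sc z h) - (1 - sc z' h)) * R z"
        by (simp add: sc_diff_left)
      also have "\<dots> = R z' * ((1 - sc z h) * R z) - (R z' * (1 - sc z' h)) * R z"
        by (simp only: right_diff_distrib left_diff_distrib mult.assoc)
      also have "\<dots> = ?D" using R z z' by simp
      finally have D: "?D = R z' * (sc (z' - z) h) * R z" ..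
      have t: "cmod (z' - z) * K \<le> 1 / 2" "cmod (z' - z) < e / (4 * K\<^sup>2)"
        using dz K unfolding d_def dist_norm by (auto simp: field_simps)
      have "norm ?D \<le> norm (R z') * cmod (z' - z) * norm (R z)"
        unfolding D using h norm_mult_ineq3[of "R z'" "sc (z' - z) h" "R z"] by (simp add: sc_norm)
      also have "\<dots> \<le> (norm ?D + K) * (cmod (z' - z) * K)"
      proof -
        have "norm (R z') \<le> norm ?D + K" using norm_triangle_ineq[of ?D "R z"] K by simp
        then show ?thesis unfolding mult.assoc using K by (intro mult_mono) auto
      qed
      also have "\<dots> \<le> norm ?D * (1 / 2) + K * (cmod (z' - z) * K)"
        using mult_left_mono[OF t(1), of "norm ?D"] by (simp add: distrib_right)
      finally have "norm ?D \<le> 2 * (K\<^sup>2 * cmod (z' - z))" by (simp add: power2_eq_square algebra_simps)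
      also have "\<dots> < e" using t(2) K e by (simp add: field_simps)
      finally show ?thesis by (simp add: dist_norm)
    qed
    ultimately show "\<exists>d>0. \<forall>x'\<in>cball 0 1. dist x' z < d \<longrightarrow> dist (R x') (R z) < e" by blast
  qed
  then have "uniformly_continuous_on (cball 0 1) R" by (rule compact_uniformly_continuous) simp
  then obtain d where d: "d > 0"
    "\<And>x x'. x \<in> cball 0 1 \<Longrightarrow> x' \<in> cball 0 1 \<Longrightarrow> dist x' x < d \<Longrightarrow> dist (R x') (R x) < 1/8"
    unfolding uniformly_continuous_on_def by (metis zero_less_divide_1_iff zero_less_numeral)
  define r where "r = 1 - min (d / 2) (1 / 2)"
  have r: "0 < r" "r < 1" "1 - r < d" using d(1) by (auto simp: r_def min_def)
  \<comment> \<open>For a unit \<open>w\<close> the two inverses are the averages of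
    \<open>R (r * v)\<close> and of \<open>R v\<close> over the roots \<open>v\<close> of
    \<open>w\<close> of order \<open>2 ^ k\<close>, so the bound \<open>1/8\<close> does not
    deteriorate with \<open>k\<close>.\<close>
  define good where "good k w \<longleftrightarrow> (\<exists>U V.
      (1 - sc (complex_of_real r ^ 2 ^ k * w) (h ^ 2 ^ k)) * U = 1 \<and>
      U * (1 - sc (complex_of_real r ^ 2 ^ k * w) (h ^ 2 ^ k)) = 1 \<and>
      (1 - sc w (h ^ 2 ^ k)) * V = 1 \<and> V * (1 - sc w (h ^ 2 ^ k)) = 1 \<and> norm (U - V) \<le> 1/8)" for k w
  have claim: "\<forall>w. cmod w = 1 \<longrightarrow> good k w" for k
  proof (induction k)
    case 0
    show ?case
    proof (intro allI impI)
      fix w assume w: "cmod w = 1"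
      have in1: "complex_of_real r * w \<in> cball 0 1" "w \<in> cball 0 1" using w r by (simp_all add: norm_mult)
      have "dist (complex_of_real r * w) w = cmod ((complex_of_real r - 1) * w)"
        by (simp add: dist_norm algebra_simps)
      also have "\<dots> = cmod (complex_of_real (r - 1))" using w by (simp add: norm_mult)
      also have "\<dots> = 1 - r" unfolding norm_of_real using r by simp
      finally have "dist (R (r * w)) (R w) < 1/8" using d(2)[OF in1(2,1)] r by simp
      then show "good 0 w" unfolding good_def
        using R[OF in1(1)] R[OF in1(2)]
        by (intro exI[of _ "R (r * w)"] exI[of _ "R w"]) (simp add: dist_norm)
    qed
  next
    case (Suc k)
    let ?H = "h ^ 2 ^ k" and ?r = "complex_of_real r ^ 2 ^ k"
    have HH: "h ^ 2 ^ Suc k = ?H * ?H" by (simp add: power_add[symmetric] mult_2)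
    show ?case
    proof (intro allI impI)
      fix w assume w: "cmod w = 1"
      define v where "v = csqrt w"
      have v: "cmod v = 1" "v * v = w" using w by (simp_all add: v_def norm_csqrt flip: power2_eq_square)
      obtain U V where UV: "(1 - sc (?r * v) ?H) * U = 1" "U * (1 - sc (?r * v) ?H) = 1"
        "(1 - sc v ?H) * V = 1" "V * (1 - sc v ?H) = 1" "norm (U - V) \<le> 1/8"
        using Suc v(1) unfolding good_def by blast
      obtain U' V' where UV': "(1 + sc (?r * v) ?H) * U' = 1" "U' * (1 + sc (?r * v) ?H) = 1"
        "(1 + sc v ?H) * V' = 1" "V' * (1 + sc v ?H) = 1" "norm (U' - V') \<le> 1/8"
        using Suc[rule_format, of "- v"] v(1) unfolding good_def by (auto simp: sc_minus_left)
      have sq: "sc (?r * v) ?H * sc (?r * v) ?H = sc (complex_of_real r ^ 2 ^ Suc k * w) (h ^ 2 ^ Suc k)"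
        unfolding HH by (simp add: sc_mult_left sc_mult_right sc_sc v(2)[symmetric] power_add mult_2 mult_ac)
      have sq': "sc v ?H * sc v ?H = sc w (h ^ 2 ^ Suc k)"
        unfolding HH by (simp add: sc_mult_left sc_mult_right sc_sc v(2))
      let ?U = "(1/2) *\<^sub>R (U + U')" and ?V = "(1/2) *\<^sub>R (V + V')"
      have "?U - ?V = (1/2) *\<^sub>R ((U - V) + (U' - V'))" by (simp add: scaleR_right_distrib scaleR_right_diff_distrib)
      then have "norm (?U - ?V) = norm ((U - V) + (U' - V')) / 2" by simp
      also have "\<dots> \<le> (1/8 + 1/8) / 2"
        using norm_triangle_mono[OF UV(5) UV'(5)] by simp
      finally have "norm (?U - ?V) \<le> 1/8" by simp
      then show "good (Suc k) w"
        using inverse_one_minus_square[OF UV(1,2) UV'(1,2)] inverse_one_minus_square[OF UV(3,4) UV'(3,4)]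
        unfolding sq sq' good_def by blast
    qed
  qed
  have "(\<lambda>k. r ^ k) \<longlonglongrightarrow> 0" using r by (intro LIMSEQ_power_zero) simp
  then obtain N where N: "\<And>k. k \<ge> N \<Longrightarrow> \<bar>r ^ k\<bar> < 1/16" 
    unfolding LIMSEQ_iff by (metis diff_zero real_norm_def zero_less_divide_1_iff zero_less_numeral)
  have rN: "r ^ 2 ^ N < 1/16" using N[of "2 ^ N"] by (simp add: less_imp_le)
  let ?H = "h ^ 2 ^ N"
  have H1: "norm ?H = 1" using norm_sa_power2[OF h(1), of N] h(2) by simp
  \<comment> \<open>Now \<open>r ^ 2 ^ N\<close> is so small that \<open>U\<close> lies within
    \<open>1/15\<close> of \<open>1\<close>, hence \<open>V\<close> within \<open>1/4\<close>. But
    \<open>?H = (V - 1) * (1 - ?H)\<close> has norm \<open>1\<close>, while \<open>1 - ?H\<close>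
    has norm at most \<open>2\<close>.\<close>
  obtain U V where UV: "U * (1 - sc (complex_of_real (r ^ 2 ^ N)) ?H) = 1" "V * (1 - sc 1 ?H) = 1" "norm (U - V) \<le> 1/8"
    using claim[of N, rule_format, of 1] unfolding good_def by auto
  have "U - 1 = U * sc (complex_of_real (r ^ 2 ^ N)) ?H" using UV(1) by (simp add: algebra_simps)
  then have "norm (U - 1) \<le> norm U * (r ^ 2 ^ N)"
    using norm_mult_ineq[of U "sc (complex_of_real (r ^ 2 ^ N)) ?H"] H1 r by (simp add: sc_norm norm_power)
  also have "\<dots> \<le> norm U * (1/16)" using rN by (intro mult_left_mono) auto
  finally have "norm (U - 1) \<le> norm U / 16" by simp
  moreover have "norm U \<le> norm (U - 1) + 1" using norm_triangle_ineq[of "U - 1" 1] by simp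
  ultimately have "norm (U - 1) \<le> 1/15" by simp
  then have V1: "norm (V - 1) \<le> 1/4" using UV(3) norm_triangle_ineq[of "V - U" "U - 1"] by (simp add: norm_minus_commute)
  have "?H = (V - 1) * (1 - ?H)" using UV(2) by (simp add: algebra_simps)
  then have "1 \<le> norm (V - 1) * norm (1 - ?H)" using norm_mult_ineq[of "V - 1" "1 - ?H"] H1 by simp
  also have "\<dots> \<le> 1/4 * 2"
    using V1 norm_triangle_ineq4[of 1 ?H] H1 by (intro mult_mono) auto
  finally show False by simp
qed

lemma norm_in_spec:
  assumes h: "adj h = h"
  shows "\<exists>z\<in>spec h. cmod z = norm h"
proof (cases "h = 0")
  case True
  have "0 \<in> spec h" using True by (simp add: spec_iff invertible_el_def)
  then show ?thesis using True by force
next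
  case False
  let ?k = "(1 / norm h) *\<^sub>R h"
  have "\<exists>z\<in>spec ?k. cmod z = 1"
    by (rule norm_in_spec_aux) (use False h in \<open>simp_all add: adj_scaleR\<close>)
  then obtain z where z: "z \<in> spec ?k" "cmod z = 1" by blast
  have "?k = sc (complex_of_real (1 / norm h)) h" by (rule sc_of_real[symmetric])
  then have "z * complex_of_real (norm h) \<in> spec h"
    using z(1) spec_sc[of "complex_of_real (1 / norm h)" z h] False by simp
  then show ?thesis using z(2) by (intro bexI) (auto simp: norm_mult)
qed

definition rspec :: "'a \<Rightarrow> real set" where
  "rspec a = {t. complex_of_real t \<in> spec a}"

lemma rspec_iff: "t \<in> rspec a \<longleftrightarrow> \<not> invertible_el (a - t *\<^sub>R 1)"
  by (simp add: rspec_def spec_iff sc_of_real)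

lemma norm_in_rspec: "adj h = h \<Longrightarrow> \<exists>t\<in>rspec h. \<bar>t\<bar> = norm h"
  using norm_in_spec[of h] spec_sa_complex[of h] unfolding rspec_def
  by (metis mem_Collect_eq norm_of_real)

lemma rspec_norm_le: "t \<in> rspec a \<Longrightarrow> \<bar>t\<bar> \<le> norm a"
  using spec_norm_le[of "complex_of_real t" a] by (simp add: rspec_def)

lemma norm_le_rspec: "adj a = a \<Longrightarrow> (\<And>t. t \<in> rspec a \<Longrightarrow> \<bar>t\<bar> \<le> K) \<Longrightarrow> norm a \<le> K"
  using norm_in_rspec by metis

section \<open>Functional calculus\<close>

text \<open>Horner evaluation. The complex version is there for the factorization into linear
  factors; the real version \<open>rpe\<close> keeps self-adjoint elements self-adjoint and is the
  one that approximates continuous functions.\<close>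

definition cpe :: "complex poly \<Rightarrow> 'a \<Rightarrow> 'a" where
  "cpe p a = fold_coeffs (\<lambda>c b. sc c 1 + a * b) p 0"

lemma cpe_0 [simp]: "cpe 0 a = 0" by (simp add: cpe_def)
lemma cpe_pCons [simp]: "cpe (pCons c p) a = sc c 1 + a * cpe p a"
  by (cases "p = 0 \<and> c = 0") (auto simp: cpe_def)
lemma cpe_add: "cpe (p + q) a = cpe p a + cpe q a"
  by (induction p q rule: poly_induct2) (simp_all add: sc_add_left algebra_simps)
lemma cpe_smult: "cpe (smult c p) a = sc c (cpe p a)"
  by (induction p) (simp_all add: sc_add_right sc_sc sc_mult_right)
lemma cpe_mult: "cpe (p * q) a = cpe p a * cpe q a"
  by (induction p) (simp_all add: cpe_add cpe_smult sc_mult_left algebra_simps)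

definition rpe :: "real poly \<Rightarrow> 'a \<Rightarrow> 'a" where
  "rpe p a = fold_coeffs (\<lambda>c b. c *\<^sub>R 1 + a * b) p 0"

lemma rpe_0 [simp]: "rpe 0 a = 0" by (simp add: rpe_def)
lemma rpe_pCons [simp]: "rpe (pCons c p) a = c *\<^sub>R 1 + a * rpe p a"
  by (cases "p = 0 \<and> c = 0") (auto simp: rpe_def)
lemma rpe_add: "rpe (p + q) a = rpe p a + rpe q a"
  by (induction p q rule: poly_induct2) (simp_all add: algebra_simps)
lemma rpe_smult: "rpe (smult c p) a = c *\<^sub>R rpe p a"
  by (induction p) (simp_all add: algebra_simps)
lemma rpe_diff: "rpe (p - q) a = rpe p a - rpe q a"
  using rpe_add[of p "- q" a] rpe_smult[of "-1" q a] by simp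
lemma rpe_mult: "rpe (p * q) a = rpe p a * rpe q a"
  by (induction p) (simp_all add: rpe_add rpe_smult algebra_simps)

lemma rpe_commute: "a * b = b * a \<Longrightarrow> rpe p a * b = b * rpe p a"
proof (induction p)
  case (pCons c p)
  have "a * rpe p a * b = a * (b * rpe p a)" using pCons by (simp add: mult.assoc)
  also have "\<dots> = b * (a * rpe p a)" using pCons(3) by (metis mult.assoc)
  finally show ?case by (simp add: distrib_left distrib_right)
qed simp

lemma adj_rpe: "adj a = a \<Longrightarrow> adj (rpe p a) = rpe p a"
  by (induction p) (simp_all add: adj_add adj_mult adj_scaleR rpe_commute)

lemma rpe_cpe: "rpe p a = cpe (map_poly complex_of_real p) a"
  by (induction p) (simp_all add: map_poly_pCons sc_of_real)

lemma poly_map_of_real: "poly (map_poly complex_of_real p) (of_real t) = of_real (poly p t)"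
  by (induction p) (simp_all add: map_poly_pCons)

text \<open>Over the complex numbers \<open>p\<close> is a product of linear factors, none of which
  has its root in the spectrum. The induction splits off one root at a time.\<close>

lemma invertible_cpe:
  "p \<noteq> 0 \<Longrightarrow> (\<And>z. z \<in> spec a \<Longrightarrow> poly p z \<noteq> 0) \<Longrightarrow> invertible_el (cpe p a)"
proof (induction "degree p" arbitrary: p)
  case 0
  then obtain c where "p = [:c:]" "c \<noteq> 0" by (metis degree_eq_zeroE pCons_0_0)
  then show ?case using invertible_el_sc[of c 1] by (simp add: invertible_el_def)
next
  case (Suc n)
  have "\<not> constant (poly p)" using Suc(2) by (simp add: constant_degree)
  then obtain z where z: "poly p z = 0" using fundamental_theorem_of_algebra by blast
  then obtain q where q: "p = [:- z, 1:] * q" by (meson dvdE poly_eq_0_iff_dvd)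
  have q0: "q \<noteq> 0" using q Suc(3) by auto
  have "degree ([:- z, 1:] * q) = degree [:- z, 1:] + degree q"
    by (rule degree_mult_eq) (use q0 in auto)
  then have "degree p = Suc (degree q)" unfolding q by simp
  then have "n = degree q" using Suc(2) by simp
  then have "invertible_el (cpe q a)" using Suc(1)[of q] q0 Suc(4) q by auto
  moreover have "invertible_el (a - sc z 1)" using Suc(4) z by (auto simp: spec_iff)
  moreover have "cpe p a = (a - sc z 1) * cpe q a" unfolding q cpe_mult by (simp add: sc_minus_left)
  ultimately show ?case using invertible_el_mult by simp
qed

lemma cpe_spec_subset:
  assumes "adj a = a" "w \<in> spec (cpe p a)"
  shows "\<exists>z\<in>spec a. poly p z = w"
proof (rule ccontr)
  assume no: "\<not> ?thesis"
  let ?q = "p + [:- w:]"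
  have "poly ?q z \<noteq> 0" if "z \<in> spec a" for z using no that by auto
  \<comment> \<open>That \<open>?q\<close> is not the zero polynomial is seen at a point of the
    spectrum; \<open>norm_in_spec\<close> provides one.\<close>
  moreover from this have "?q \<noteq> 0" using norm_in_spec[OF assms(1)] by (metis poly_0)
  ultimately have "invertible_el (cpe ?q a)" by (intro invertible_cpe)
  then show False using assms(2) by (simp add: spec_iff cpe_add sc_minus_left)
qed

text \<open>Subtracting its value at \<open>z\<close> makes \<open>p\<close> divisible by the linear
  factor of \<open>z\<close>, and a commuting factor of an invertible element is itself
  invertible.\<close>

lemma cpe_spec_superset:
  assumes "z \<in> spec a"
  shows "poly p z \<in> spec (cpe p a)"
proof -
  have "poly (p + [:- poly p z:]) z = 0" by simp
  then obtain q where q: "p + [:- poly p z:] = q * [:- z, 1:]" by (metis dvdE poly_eq_0_iff_dvd mult.commute)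
  have "cpe p a - sc (poly p z) 1 = cpe (p + [:- poly p z:]) a" by (simp add: cpe_add sc_minus_left)
  also have "\<dots> = cpe q a * (a - sc z 1)" unfolding q cpe_mult by (simp add: sc_minus_left)
  finally have 1: "cpe p a - sc (poly p z) 1 = cpe q a * (a - sc z 1)" .
  have "cpe q a * (a - sc z 1) = (a - sc z 1) * cpe q a"
    using cpe_mult[of q "[:- z, 1:]" a] cpe_mult[of "[:- z, 1:]" q a] by (simp add: mult.commute sc_minus_left)
  then show ?thesis unfolding spec_iff 1
    using assms[unfolded spec_iff] invertible_el_commute_factor[of "a - sc z 1" "cpe q a"] by metis
qed

text \<open>The norm of a self-adjoint element is attained on its spectrum, so spectral mapping
  applies. This makes evaluation at \<open>a\<close> continuous for uniform convergence on the
  spectrum.\<close>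

lemma norm_rpe_le:
  assumes "adj a = a" "\<And>t. t \<in> rspec a \<Longrightarrow> \<bar>poly p t\<bar> \<le> K"
  shows "norm (rpe p a) \<le> K"
proof (rule norm_le_rspec[OF adj_rpe[OF assms(1)]])
  fix t assume "t \<in> rspec (rpe p a)"
  then have "complex_of_real t \<in> spec (cpe (map_poly complex_of_real p) a)" by (simp add: rspec_def rpe_cpe)
  then obtain z where z: "z \<in> spec a" "poly (map_poly complex_of_real p) z = complex_of_real t"
    using cpe_spec_subset[OF assms(1)] by blast
  have "z = complex_of_real (Re z)" using spec_sa_complex[OF assms(1) z(1)] .
  then have "Re z \<in> rspec a" "poly p (Re z) = t" using z
    by (simp add: rspec_def, metis of_real_eq_iff poly_map_of_real)
  then show "\<bar>t\<bar> \<le> K" using assms(2) by blast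
qed

lemma norm_rpe_ge:
  assumes "t \<in> rspec a"
  shows "\<bar>poly p t\<bar> \<le> norm (rpe p a)"
  using cpe_spec_superset[of "complex_of_real t" a "map_poly complex_of_real p"] assms
  by (intro rspec_norm_le) (simp add: rspec_def rpe_cpe poly_map_of_real)

end

section \<open>Continuous functions of a self-adjoint element\<close>

lemma real_poly_approx:
  fixes \<phi> :: "real \<Rightarrow> real"
  assumes "continuous_on UNIV \<phi>" "e > 0"
  shows "\<exists>p. \<forall>t. \<bar>t\<bar> \<le> M \<longrightarrow> \<bar>poly p t - \<phi> t\<bar> < e"
proof -
  obtain g where g: "real_polynomial_function g" "\<And>x. x \<in> {-M..M} \<Longrightarrow> \<bar>\<phi> x - g x\<bar> < e"
    by (rule Stone_Weierstrass_real_polynomial_function[of "{-M..M}" \<phi> e])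
      (use assms in \<open>auto intro: continuous_on_subset\<close>)
  obtain a n where an: "g = (\<lambda>x. \<Sum>i\<le>n. a i * x ^ i)" using g(1) by (auto simp: real_polynomial_function_iff_sum)
  have "poly (\<Sum>i\<le>n. monom (a i) i) x = g x" for x by (simp add: an poly_sum poly_monom)
  moreover have "\<bar>g t - \<phi> t\<bar> < e" if "\<bar>t\<bar> \<le> M" for t
    using g(2)[of t] that by (simp add: abs_minus_commute abs_le_iff)
  ultimately show ?thesis by (intro exI[of _ "\<Sum>i\<le>n. monom (a i) i"]) simp
qed

context unital_cstar_algebra
begin

text \<open>The polynomials approximate on the interval of radius \<open>norm a\<close>, which
  contains the real spectrum and to which the Weierstrass theorem applies directly.\<close>

definition cfc :: "'a \<Rightarrow> (real \<Rightarrow> real) \<Rightarrow> 'a" where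
  "cfc a \<phi> = lim (\<lambda>n. rpe (SOME p. \<forall>t. \<bar>t\<bar> \<le> norm a \<longrightarrow> \<bar>poly p t - \<phi> t\<bar> < inverse (real (Suc n))) a)"

text \<open>The error is measured on the spectrum alone. Hence every polynomial that is close to
  \<phi> there computes \<open>cfc a \<phi>\<close> up to the same error, whatever polynomials the
  definition has picked.\<close>

lemma cfc_approx:
  assumes a: "adj a = a" and c: "continuous_on UNIV \<phi>"
    and p: "\<And>t. t \<in> rspec a \<Longrightarrow> \<bar>poly p t - \<phi> t\<bar> \<le> e"
  shows "norm (rpe p a - cfc a \<phi>) \<le> e"
proof -
  define P where "P n = (SOME p. \<forall>t. \<bar>t\<bar> \<le> norm a \<longrightarrow> \<bar>poly p t - \<phi> t\<bar> < inverse (real (Suc n)))" for n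
  have P: "\<bar>poly (P n) t - \<phi> t\<bar> < inverse (real (Suc n))" if "\<bar>t\<bar> \<le> norm a" for n t
  proof -
    have "\<exists>p. \<forall>t. \<bar>t\<bar> \<le> norm a \<longrightarrow> \<bar>poly p t - \<phi> t\<bar> < inverse (real (Suc n))"
      by (rule real_poly_approx[OF c]) simp
    from someI_ex[OF this] show ?thesis using that unfolding P_def by blast
  qed
  have close: "norm (rpe q a - rpe (P n) a) \<le> e' + inverse (real (Suc n))"
    if "\<And>t. t \<in> rspec a \<Longrightarrow> \<bar>poly q t - \<phi> t\<bar> \<le> e'" for q n e'
    unfolding rpe_diff[symmetric]
  proof (rule norm_rpe_le[OF a])
    fix t assume "t \<in> rspec a"
    then show "\<bar>poly (q - P n) t\<bar> \<le> e' + inverse (real (Suc n))"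
      using that[of t] P[of t n] rspec_norm_le[of t a] by simp
  qed
  have "Cauchy (\<lambda>n. rpe (P n) a)"
  proof (rule metric_CauchyI)
    fix r :: real assume r: "r > 0"
    then obtain N where N: "inverse (real (Suc N)) < r / 2" using reals_Archimedean[of "r/2"] by auto
    have "dist (rpe (P m) a) (rpe (P n) a) < r" if "m \<ge> N" "n \<ge> N" for m n
    proof -
      have "norm (rpe (P m) a - rpe (P n) a) \<le> inverse (real (Suc m)) + inverse (real (Suc n))"
        by (rule close) (use P rspec_norm_le less_imp_le in blast)
      moreover have "inverse (real (Suc m)) \<le> inverse (real (Suc N))" "inverse (real (Suc n)) \<le> inverse (real (Suc N))"
        using that by (auto intro!: le_imp_inverse_le)
      ultimately show ?thesis using N unfolding dist_norm by linarith
    qed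
    then show "\<exists>M. \<forall>m\<ge>M. \<forall>n\<ge>M. dist (rpe (P m) a) (rpe (P n) a) < r" by blast
  qed
  then have "(\<lambda>n. rpe (P n) a) \<longlonglongrightarrow> cfc a \<phi>"
    unfolding cfc_def P_def[symmetric] by (simp add: Cauchy_convergent_iff convergent_LIMSEQ_iff)
  then have "(\<lambda>n. norm (rpe p a - rpe (P n) a)) \<longlonglongrightarrow> norm (rpe p a - cfc a \<phi>)"
    by (intro tendsto_intros)
  moreover have "(\<lambda>n. e + inverse (real (Suc n))) \<longlonglongrightarrow> e + 0"
    by (intro tendsto_intros LIMSEQ_inverse_real_of_nat)
  ultimately show ?thesis
    using close[OF p] by (intro LIMSEQ_le[of _ _ "\<lambda>n. e + inverse (real (Suc n))" e]) auto
qed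

lemma cfc_poly_close:
  assumes "adj a = a" "continuous_on UNIV \<phi>" "e > 0" "norm a \<le> M"
  obtains p where "norm (rpe p a - cfc a \<phi>) \<le> e" "\<And>t. \<bar>t\<bar> \<le> M \<Longrightarrow> \<bar>poly p t - \<phi> t\<bar> < e"
proof -
  obtain p where p: "\<And>t. \<bar>t\<bar> \<le> M \<Longrightarrow> \<bar>poly p t - \<phi> t\<bar> < e"
    using real_poly_approx[OF assms(2,3), of M] by blast
  moreover have "norm (rpe p a - cfc a \<phi>) \<le> e"
    by (rule cfc_approx[OF assms(1,2)]) (meson p rspec_norm_le assms(4) order_trans less_imp_le)
  ultimately show thesis using that by blast
qed

lemma norm_cfc_le:
  assumes a: "adj a = a" and c: "continuous_on UNIV \<phi>" and K: "\<And>t. t \<in> rspec a \<Longrightarrow> \<bar>\<phi> t\<bar> \<le> K"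
  shows "norm (cfc a \<phi>) \<le> K"
proof (rule field_le_epsilon)
  fix e :: real assume "e > 0"
  then obtain p where p: "norm (rpe p a - cfc a \<phi>) \<le> e / 2" "\<And>t. \<bar>t\<bar> \<le> norm a \<Longrightarrow> \<bar>poly p t - \<phi> t\<bar> < e / 2"
    using cfc_poly_close[OF a c, of "e/2" "norm a"] by auto
  have "norm (rpe p a) \<le> K + e / 2"
  proof (rule norm_rpe_le[OF a])
    fix t assume "t \<in> rspec a"
    then show "\<bar>poly p t\<bar> \<le> K + e / 2" using p(2)[of t] K[of t] rspec_norm_le[of t a] by linarith
  qed
  then show "norm (cfc a \<phi>) \<le> K + e"
    using p(1) norm_triangle_ineq2[of "cfc a \<phi>" "rpe p a"] by (simp add: norm_minus_commute)
qed

lemma norm_cfc_ge: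
  assumes a: "adj a = a" and c: "continuous_on UNIV \<phi>" and t: "t \<in> rspec a"
  shows "\<bar>\<phi> t\<bar> \<le> norm (cfc a \<phi>)"
proof (rule field_le_epsilon)
  fix e :: real assume "e > 0"
  then obtain p where p: "norm (rpe p a - cfc a \<phi>) \<le> e / 2" "\<And>t. \<bar>t\<bar> \<le> norm a \<Longrightarrow> \<bar>poly p t - \<phi> t\<bar> < e / 2"
    using cfc_poly_close[OF a c, of "e/2" "norm a"] by auto
  have "\<bar>\<phi> t\<bar> \<le> \<bar>poly p t\<bar> + e / 2" using p(2)[of t] rspec_norm_le[OF t] by linarith
  also have "\<bar>poly p t\<bar> \<le> norm (rpe p a)" by (rule norm_rpe_ge[OF t])
  also have "\<dots> \<le> norm (cfc a \<phi>) + e / 2"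
    using p(1) norm_triangle_ineq2[of "rpe p a" "cfc a \<phi>"] by simp
  finally show "\<bar>\<phi> t\<bar> \<le> norm (cfc a \<phi>) + e" by simp
qed

lemma cfc_rpe: 
  assumes "adj a = a" shows "cfc a (poly p) = rpe p a"
  using cfc_approx[OF assms, of "poly p" p 0] by (simp add: continuous_on_poly)

lemma uniform_poly_approx:
  assumes c: "continuous_on UNIV \<phi>"
  obtains P where "uniform_limit {- norm a..norm a} (\<lambda>n. poly (P n)) \<phi> sequentially"
proof -
  have "\<forall>n. \<exists>p. \<forall>t. \<bar>t\<bar> \<le> norm a \<longrightarrow> \<bar>poly p t - \<phi> t\<bar> < inverse (real (Suc n))"
    using real_poly_approx[OF c] by simp
  from choice[OF this] obtain P where P: "\<And>n t. \<bar>t\<bar> \<le> norm a \<Longrightarrow> \<bar>poly (P n) t - \<phi> t\<bar> < inverse (real (Suc n))" by blast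
  show thesis
  proof (rule that[of P], rule uniform_limitI)
    fix e :: real assume "e > 0"
    then have "eventually (\<lambda>n. inverse (real (Suc n)) < e) sequentially"
      using order_tendstoD(2)[OF LIMSEQ_inverse_real_of_nat] by blast
    then show "eventually (\<lambda>n. \<forall>t\<in>{- norm a..norm a}. dist (poly (P n) t) (\<phi> t) < e) sequentially"
      by eventually_elim (use P in \<open>force simp: dist_real_def abs_le_iff intro: less_trans\<close>)
  qed
qed

lemma cfc_tendsto:
  assumes a: "adj a = a" and c: "continuous_on UNIV \<phi>"
    and P: "uniform_limit {- norm a..norm a} (\<lambda>n. poly (P n)) \<phi> sequentially"
  shows "(\<lambda>n. rpe (P n) a) \<longlonglongrightarrow> cfc a \<phi>"
proof (rule tendstoI)
  fix e :: real assume e: "e > 0"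
  then have "eventually (\<lambda>n. \<forall>t\<in>{- norm a..norm a}. dist (poly (P n) t) (\<phi> t) < e / 2) sequentially"
    by (intro uniform_limitD[OF P]) simp
  then show "eventually (\<lambda>n. dist (rpe (P n) a) (cfc a \<phi>) < e) sequentially"
  proof eventually_elim
    case (elim n)
    have "norm (rpe (P n) a - cfc a \<phi>) \<le> e / 2"
    proof (rule cfc_approx[OF a c])
      fix t assume "t \<in> rspec a"
      then have "t \<in> {- norm a..norm a}" using rspec_norm_le[of t a] by auto
      with elim show "\<bar>poly (P n) t - \<phi> t\<bar> \<le> e / 2" by (fastforce simp: dist_real_def)
    qed
    then show ?case using e by (simp add: dist_norm)
  qed
qed

lemma cfc_ident: "adj a = a \<Longrightarrow> cfc a (\<lambda>t. t) = a"
  using cfc_rpe[of a "[:0, 1:]"] by (simp add: poly_pCons[abs_def])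

lemma cfc_const: "adj a = a \<Longrightarrow> cfc a (\<lambda>t. r) = r *\<^sub>R 1"
  using cfc_rpe[of a "[:r:]"] by (simp add: poly_pCons[abs_def])

lemma cfc_add:
  assumes a: "adj a = a" and c: "continuous_on UNIV \<phi>" "continuous_on UNIV \<psi>"
  shows "cfc a (\<lambda>t. \<phi> t + \<psi> t) = cfc a \<phi> + cfc a \<psi>"
proof -
  obtain P Q where P: "uniform_limit {- norm a..norm a} (\<lambda>n. poly (P n)) \<phi> sequentially"
    and Q: "uniform_limit {- norm a..norm a} (\<lambda>n. poly (Q n)) \<psi> sequentially"
    using uniform_poly_approx[OF c(1)] uniform_poly_approx[OF c(2)] by metis
  have "(\<lambda>n. rpe (P n + Q n) a) \<longlonglongrightarrow> cfc a (\<lambda>t. \<phi> t + \<psi> t)"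
    by (rule cfc_tendsto[OF a]) (use uniform_limit_add[OF P Q] in \<open>auto intro!: continuous_intros c simp: poly_add[abs_def]\<close>)
  moreover have "(\<lambda>n. rpe (P n + Q n) a) \<longlonglongrightarrow> cfc a \<phi> + cfc a \<psi>"
    unfolding rpe_add by (intro tendsto_add cfc_tendsto a c P Q)
  ultimately show ?thesis by (rule LIMSEQ_unique)
qed

lemma cfc_mult:
  assumes a: "adj a = a" and c: "continuous_on UNIV \<phi>" "continuous_on UNIV \<psi>"
  shows "cfc a (\<lambda>t. \<phi> t * \<psi> t) = cfc a \<phi> * cfc a \<psi>"
proof -
  obtain P Q where P: "uniform_limit {- norm a..norm a} (\<lambda>n. poly (P n)) \<phi> sequentially"
    and Q: "uniform_limit {- norm a..norm a} (\<lambda>n. poly (Q n)) \<psi> sequentially"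
    using uniform_poly_approx[OF c(1)] uniform_poly_approx[OF c(2)] by metis
  have b: "bounded (\<phi> ` {- norm a..norm a})" "bounded (\<psi> ` {- norm a..norm a})"
    by (intro compact_imp_bounded compact_continuous_image continuous_on_subset[OF c(1)] continuous_on_subset[OF c(2)]; simp)+
  have "(\<lambda>n. rpe (P n * Q n) a) \<longlonglongrightarrow> cfc a (\<lambda>t. \<phi> t * \<psi> t)"
    by (rule cfc_tendsto[OF a]) (use uniform_lim_mult[OF P Q b] in \<open>auto intro!: continuous_intros c simp: poly_mult[abs_def]\<close>)
  moreover have "(\<lambda>n. rpe (P n * Q n) a) \<longlonglongrightarrow> cfc a \<phi> * cfc a \<psi>"
    unfolding rpe_mult by (intro tendsto_mult cfc_tendsto a c P Q)
  ultimately show ?thesis by (rule LIMSEQ_unique)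
qed

lemma cfc_cong:
  assumes a: "adj a = a" and c: "continuous_on UNIV \<phi>" "continuous_on UNIV \<psi>"
    and eq: "\<And>t. t \<in> rspec a \<Longrightarrow> \<phi> t = \<psi> t"
  shows "cfc a \<phi> = cfc a \<psi>"
proof -
  \<comment> \<open>Differences are written as sums with a factor \<open>- 1\<close>, so that the
    rules for sums, products and constants cover them.\<close>
  have c': "continuous_on UNIV (\<lambda>t. (- 1) * \<psi> t)" by (intro continuous_intros c)
  have "norm (cfc a (\<lambda>t. \<phi> t + (- 1) * \<psi> t)) \<le> 0"
    by (rule norm_cfc_le[OF a]) (use eq in \<open>auto intro!: continuous_intros c\<close>)
  then show ?thesis
    unfolding cfc_add[OF a c(1) c'] cfc_mult[OF a continuous_on_const c(2)] cfc_const[OF a] by simp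
qed

lemma cfc_commute:
  assumes a: "adj a = a" and c: "continuous_on UNIV \<phi>" and ab: "a * b = b * a"
  shows "cfc a \<phi> * b = b * cfc a \<phi>"
proof -
  obtain P where P: "uniform_limit {- norm a..norm a} (\<lambda>n. poly (P n)) \<phi> sequentially" by (rule uniform_poly_approx[OF c])
  note lim = cfc_tendsto[OF a c P]
  have "(\<lambda>n. rpe (P n) a * b) \<longlonglongrightarrow> b * cfc a \<phi>"
    unfolding rpe_commute[OF ab] by (intro tendsto_intros lim)
  moreover have "(\<lambda>n. rpe (P n) a * b) \<longlonglongrightarrow> cfc a \<phi> * b" by (intro tendsto_intros lim)
  ultimately show ?thesis by (rule LIMSEQ_unique[rotated])
qed

lemma adj_cfc:
  assumes a: "adj a = a" and c: "continuous_on UNIV \<phi>"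
  shows "adj (cfc a \<phi>) = cfc a \<phi>"
proof -
  obtain P where P: "uniform_limit {- norm a..norm a} (\<lambda>n. poly (P n)) \<phi> sequentially" by (rule uniform_poly_approx[OF c])
  note lim = cfc_tendsto[OF a c P]
  from tendsto_adj[OF lim] show ?thesis unfolding adj_rpe[OF a] by (rule LIMSEQ_unique) (rule lim)
qed


section \<open>Positive elements\<close>

abbreviation "pos \<equiv> positive_el sc adj"

lemma pos_iff: "pos a \<longleftrightarrow> adj a = a \<and> (\<forall>t\<in>rspec a. 0 \<le> t)"
proof
  assume "pos a"
  then show "adj a = a \<and> (\<forall>t\<in>rspec a. 0 \<le> t)"
    unfolding positive_el_def rspec_def by auto
next
  assume *: "adj a = a \<and> (\<forall>t\<in>rspec a. 0 \<le> t)"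
  have "z \<in> complex_of_real ` {0..}" if "z \<in> spec a" for z
    using * that spec_sa_complex[of a z] unfolding rspec_def
    by (metis atLeast_iff image_eqI mem_Collect_eq)
  then show "pos a" using * unfolding positive_el_def by blast
qed

lemma pos_sa: "pos a \<Longrightarrow> adj a = a"
  by (simp add: positive_el_def)

lemma pos_square: assumes "adj h = h" shows "pos (h * h)"
proof -
  have "0 \<le> t" if t: "t \<in> rspec (h * h)" for t
  proof -
    have "cpe [:0, 0, 1:] h = h * h" by simp
    then obtain z where z: "z \<in> spec h" "z * z = complex_of_real t"
      using t cpe_spec_subset[OF assms, of "complex_of_real t" "[:0, 0, 1:]"] unfolding rspec_def by auto
    have "complex_of_real (Re z * Re z) = complex_of_real t"
      using spec_sa_complex[OF assms z(1)] z(2) by (metis of_real_mult)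
    then have "Re z * Re z = t" by (simp only: of_real_eq_iff)
    then show ?thesis by (metis zero_le_square)
  qed
  then show ?thesis by (simp add: pos_iff adj_mult assms)
qed

text \<open>Cutting \<phi> off at \<open>0\<close> gives it a continuous square root on the whole
  line without changing it on the spectrum, and squares of self-adjoint elements are
  positive.\<close>

lemma pos_cfc:
  assumes a: "adj a = a" and c: "continuous_on UNIV \<phi>" and nn: "\<And>t. t \<in> rspec a \<Longrightarrow> 0 \<le> \<phi> t"
  shows "pos (cfc a \<phi>)"
proof -
  let ?s = "\<lambda>t. sqrt (max (\<phi> t) 0)"
  have cs: "continuous_on UNIV ?s" by (intro continuous_intros c)
  have "cfc a \<phi> = cfc a (\<lambda>t. ?s t * ?s t)"
    by (rule cfc_cong[OF a c]) (use nn in \<open>auto intro!: continuous_intros c\<close>)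
  also have "\<dots> = cfc a ?s * cfc a ?s" by (rule cfc_mult[OF a cs cs])
  finally show ?thesis using pos_square[OF adj_cfc[OF a cs]] by simp
qed

lemma pos_sqrt:
  assumes "pos a" obtains b where "pos b" "b * b = a"
proof
  have a: "adj a = a" using assms by (rule pos_sa)
  let ?s = "\<lambda>t. sqrt (max t 0)"
  have cs: "continuous_on UNIV ?s" by (intro continuous_intros)
  show "pos (cfc a ?s)" by (rule pos_cfc[OF a cs]) simp
  have "cfc a ?s * cfc a ?s = cfc a (\<lambda>t. ?s t * ?s t)" by (rule cfc_mult[OF a cs cs, symmetric])
  also have "\<dots> = cfc a (\<lambda>t. t)"
    by (rule cfc_cong[OF a]) (use assms in \<open>auto simp: pos_iff intro!: continuous_intros\<close>)
  finally show "cfc a ?s * cfc a ?s = a" using cfc_ident[OF a] by simp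
qed

lemma rspec_reflect: "t \<in> rspec (K *\<^sub>R 1 - a) \<longleftrightarrow> K - t \<in> rspec a"
  using spec_shift_real[of "complex_of_real t" "- a" K] spec_uminus[of "complex_of_real t - complex_of_real K" a]
  by (simp add: rspec_def)

text \<open>Together with \<open>norm_reflect_pos\<close> this describes positivity by a norm
  condition; sums of positive elements are then handled by the triangle inequality.\<close>

lemma pos_norm_reflect: "adj a = a \<Longrightarrow> norm (K *\<^sub>R 1 - a) \<le> K \<Longrightarrow> pos a"
  unfolding pos_iff
proof (intro conjI ballI)
  fix t assume n: "norm (K *\<^sub>R 1 - a) \<le> K" and "t \<in> rspec a"
  then have "K - t \<in> rspec (K *\<^sub>R 1 - a)" by (simp add: rspec_reflect)
  then show "0 \<le> t" using rspec_norm_le n by fastforce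
qed

lemma norm_reflect_pos:
  assumes "pos a" "norm a \<le> K" shows "norm (K *\<^sub>R 1 - a) \<le> K"
proof (rule norm_le_rspec)
  show "adj (K *\<^sub>R 1 - a) = K *\<^sub>R 1 - a" using assms by (simp add: adj_diff adj_scaleR pos_sa)
  fix t assume "t \<in> rspec (K *\<^sub>R 1 - a)"
  then have "K - t \<in> rspec a" by (simp add: rspec_reflect)
  then show "\<bar>t\<bar> \<le> K" using assms rspec_norm_le[of "K - t" a] by (auto simp: pos_iff)
qed

lemma pos_add: assumes "pos a" "pos b" shows "pos (a + b)"
proof (rule pos_norm_reflect)
  show "adj (a + b) = a + b" using assms by (simp add: adj_add pos_sa)
  have "(norm a + norm b) *\<^sub>R 1 - (a + b) = (norm a *\<^sub>R 1 - a) + (norm b *\<^sub>R 1 - b)"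
    by (simp add: algebra_simps)
  then show "norm ((norm a + norm b) *\<^sub>R 1 - (a + b)) \<le> norm a + norm b"
    using norm_triangle_mono[OF norm_reflect_pos norm_reflect_pos, OF assms(1) order_refl assms(2) order_refl]
    by (simp only:)
qed

lemma pos_zero [simp]: "pos 0"
  using pos_square[of 0] by simp

lemma pos_one [simp]: "pos 1"
  using pos_square[of 1] by simp

lemma pos_sum: "(\<And>s. s \<in> S \<Longrightarrow> pos (f s)) \<Longrightarrow> pos (sum f S)"
  by (induction S rule: infinite_finite_induct) (simp_all add: pos_add)

lemma pos_scaleR: "pos a \<Longrightarrow> 0 \<le> r \<Longrightarrow> pos (r *\<^sub>R a)"
proof -
  assume "pos a" "0 \<le> r"
  obtain b where b: "pos b" "b * b = a" using pos_sqrt[OF \<open>pos a\<close>] .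
  have "r *\<^sub>R a = (sqrt r *\<^sub>R b) * (sqrt r *\<^sub>R b)" using b \<open>0 \<le> r\<close> by simp
  then show ?thesis using pos_square[of "sqrt r *\<^sub>R b"] b by (simp only: adj_scaleR pos_sa)
qed

lemma pos_norm_minus: "adj a = a \<Longrightarrow> norm a \<le> K \<Longrightarrow> pos (K *\<^sub>R 1 - a)"
proof -
  assume a: "adj a = a" "norm a \<le> K"
  show ?thesis unfolding pos_iff
  proof (intro conjI ballI)
    show "adj (K *\<^sub>R 1 - a) = K *\<^sub>R 1 - a" using a by (simp add: adj_diff adj_scaleR)
    fix t assume "t \<in> rspec (K *\<^sub>R 1 - a)"
    then show "0 \<le> t" using rspec_norm_le[of "K - t" a] a by (simp add: rspec_reflect)
  qed
qed

lemma norm_le_pos: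
  assumes "pos a" "pos (K *\<^sub>R 1 - a)" shows "norm a \<le> K"
proof (rule norm_le_rspec[OF pos_sa[OF assms(1)]])
  fix t assume t: "t \<in> rspec a"
  then have "K - t \<in> rspec (K *\<^sub>R 1 - a)" by (simp add: rspec_reflect)
  then show "\<bar>t\<bar> \<le> K" using t assms by (fastforce simp: pos_iff)
qed

lemma norm_mono_pos:
  assumes "pos a" "pos (b - a)" shows "norm a \<le> norm b"
proof (rule norm_le_pos[OF assms(1)])
  have "adj b = b" using pos_sa[OF pos_add[OF assms]] by simp
  then have "pos (norm b *\<^sub>R 1 - b)" by (rule pos_norm_minus) simp
  from pos_add[OF this assms(2)] show "pos (norm b *\<^sub>R 1 - a)" by simp
qed

lemma pos_antisym: "pos a \<Longrightarrow> pos (- a) \<Longrightarrow> a = 0"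
  using norm_le_pos[of a 0] by simp

lemma rspec_swap:
  assumes "t \<noteq> 0" "t \<in> rspec (a * b)" shows "t \<in> rspec (b * a)"
proof -
  have *: "invertible_el (x - t *\<^sub>R 1) \<longleftrightarrow> invertible_el (1 - (1 / t) *\<^sub>R x)" for x :: 'a
  proof -
    have "sc (complex_of_real (- t)) (1 - (1 / t) *\<^sub>R x) = x - t *\<^sub>R 1"
      unfolding sc_of_real using assms(1) by (simp add: algebra_simps)
    then show ?thesis using invertible_el_sc[of "complex_of_real (- t)" "1 - (1 / t) *\<^sub>R x"] assms(1) by simp
  qed
  show ?thesis using assms(2) invertible_el_one_minus_swap[of b "(1 / t) *\<^sub>R a"]
    unfolding rspec_iff * by auto
qed

text \<open>Kaplansky's argument: cutting \<open>w\<close> by the negative part of \<open>w\<^sup>* w\<close> gives \<open>v\<close> with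
  \<open>v\<^sup>* v \<le> 0\<close>, hence also \<open>v v\<^sup>* \<le> 0\<close>, while \<open>v\<^sup>* v + v v\<^sup>* \<ge> 0\<close>.\<close>

lemma pos_adj_mult: "pos (adj w * w)"
proof -
  define a where "a = adj w * w"
  have a: "adj a = a" by (simp add: a_def adj_mult adj_adj)
  let ?m = "\<lambda>t::real. max (- t) 0"
  have cm: "continuous_on UNIV ?m" by (intro continuous_intros)
  define n where "n = cfc a ?m"
  have n: "adj n = n" unfolding n_def by (rule adj_cfc[OF a cm])
  define v where "v = w * n"
  have "adj v * v = n * a * n" by (simp add: v_def a_def adj_mult n mult.assoc)
  also have "\<dots> = cfc a (\<lambda>t. ?m t * t * ?m t)"
  proof -
    have "cfc a (\<lambda>t. ?m t * t * ?m t) = cfc a (\<lambda>t. ?m t * t) * n"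
      unfolding n_def by (rule cfc_mult[OF a]) (intro continuous_intros)+
    moreover have "cfc a (\<lambda>t. ?m t * t) = n * cfc a (\<lambda>t. t)"
      unfolding n_def by (rule cfc_mult[OF a]) (intro continuous_intros)+
    ultimately show ?thesis by (simp add: cfc_ident[OF a])
  qed
  finally have vv: "adj v * v = cfc a (\<lambda>t. ?m t * t * ?m t)" .
  have c3: "continuous_on UNIV (\<lambda>t. ?m t * t * ?m t)" by (intro continuous_intros)
  have sv: "adj (adj v * v) = adj v * v" "adj (v * adj v) = v * adj v" by (simp_all add: adj_mult adj_adj)
  have "pos (cfc a (\<lambda>t. - (?m t * t * ?m t)))"
  proof (rule pos_cfc[OF a])
    show "continuous_on UNIV (\<lambda>t. - (?m t * t * ?m t))" by (intro continuous_intros)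
  qed (auto simp: max_def mult_le_0_iff)
  moreover have "cfc a (\<lambda>t. - (?m t * t * ?m t)) = - (adj v * v)"
  proof -
    have "cfc a (\<lambda>t. (- 1) * (?m t * t * ?m t)) = cfc a (\<lambda>t. - 1) * cfc a (\<lambda>t. ?m t * t * ?m t)"
      by (rule cfc_mult[OF a _ c3]) (intro continuous_intros)
    then show ?thesis by (simp add: cfc_const[OF a] vv)
  qed
  ultimately have neg: "pos (- (adj v * v))" by simp
  have neg': "pos (- (v * adj v))" unfolding pos_iff
  proof (intro conjI ballI)
    show "adj (- (v * adj v)) = - (v * adj v)" using sv by (simp add: adj_minus)
    fix t assume "t \<in> rspec (- (v * adj v))"
    then have "t \<in> rspec (- v * adj v)" by simp
    then have "t = 0 \<or> t \<in> rspec (- (adj v * v))" using rspec_swap[of t "- v" "adj v"] by auto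
    then show "0 \<le> t" using neg by (auto simp: pos_iff)
  qed
  \<comment> \<open>The cross terms of \<open>adj v * v\<close> and \<open>v * adj v\<close> cancel
    in the sum, which leaves twice a sum of two squares of self-adjoint elements.\<close>
  obtain h k where hk: "adj h = h" "adj k = k" "v = h + sc \<i> k" "adj v = h - sc \<i> k"
    by (rule re_im_decomp)
  have "sc \<i> k * sc \<i> k = - (k * k)" using sc_of_real[of "-1"] by (simp add: sc_mult_left sc_mult_right sc_sc)
  then have "adj v * v + v * adj v = 2 *\<^sub>R (h * h) + 2 *\<^sub>R (k * k)"
    unfolding hk(4) unfolding hk(3) by (simp add: algebra_simps scaleR_2)
  then have "pos (adj v * v + v * adj v)" using hk by (simp add: pos_add pos_scaleR pos_square)
  from pos_add[OF this neg'] have "adj v * v = 0" using neg by (intro pos_antisym) simp_all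
  then have 0: "norm (cfc a (\<lambda>t. ?m t * t * ?m t)) = 0" using vv by simp
  have "0 \<le> t" if "t \<in> rspec a" for t
  proof (rule ccontr)
    assume "\<not> 0 \<le> t"
    moreover have "\<bar>?m t * t * ?m t\<bar> \<le> 0" using norm_cfc_ge[OF a c3 that] 0 by simp
    ultimately show False by (simp add: max_def)
  qed
  then show ?thesis using a by (simp add: pos_iff a_def)
qed

lemma pos_mult_adj: "pos (w * adj w)"
  using pos_adj_mult[of "adj w"] by (simp add: adj_adj)

lemma pos_conj: assumes "pos a" shows "pos (adj w * a * w)"
proof -
  obtain b where b: "pos b" "b * b = a" using pos_sqrt[OF assms] .
  have "adj w * a * w = adj (b * w) * (b * w)" using b by (simp add: adj_mult pos_sa mult.assoc flip: b(2))
  then show ?thesis using pos_adj_mult by simp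
qed

lemma pos_conj': assumes "pos a" shows "pos (w * a * adj w)"
  using pos_conj[OF assms, of "adj w"] by (simp add: adj_adj)

text \<open>For a positive contraction \<open>e * e\<close> lies below \<open>e\<close>. The purpose
  is to turn an estimate for \<open>adj w * e * w\<close> into one for \<open>e * w\<close>, at the
  price of a square root.\<close>

lemma norm_contraction_mult:
  assumes "pos e" "norm e \<le> 1" shows "(norm (e * w))\<^sup>2 \<le> norm (adj w * e * w)"
proof -
  have e: "adj e = e" using assms by (simp add: pos_sa)
  have "pos (rpe [:0, 1, -1:] e)"
    unfolding cfc_rpe[OF e, symmetric]
  proof (rule pos_cfc[OF e])
    fix t assume "t \<in> rspec e"
    then have "0 \<le> t" "t \<le> 1" using assms rspec_norm_le[of t e] by (auto simp: pos_iff)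
    then have "0 \<le> t * (1 - t)" by simp
    then show "0 \<le> poly [:0, 1, -1:] t" by (simp add: algebra_simps)
  qed (intro continuous_intros)
  then have "pos (e - e * e)" by (simp add: algebra_simps)
  from pos_conj[OF this, of w] have 1: "pos (adj w * e * w - adj w * (e * e) * w)" by (simp add: algebra_simps)
  have 2: "adj w * (e * e) * w = adj (e * w) * (e * w)" by (simp add: adj_mult e mult.assoc)
  then have "norm (adj w * (e * e) * w) = (norm (e * w))\<^sup>2" by (simp only: cstar_identity)
  then show ?thesis using norm_mono_pos[OF _ 1] pos_adj_mult[of "e * w"] 2 by simp
qed

lemma pos_one_minus: "pos a \<Longrightarrow> norm a \<le> 1 \<Longrightarrow> pos (1 - a)"
  using pos_norm_minus[of a 1] by (simp add: pos_sa)

lemma norm_one_minus_pos: "pos a \<Longrightarrow> norm a \<le> 1 \<Longrightarrow> norm (1 - a) \<le> 1"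
  using norm_reflect_pos[of a 1] by simp

abbreviation "proj \<equiv> projection_el adj"

lemma proj_norm: "proj p \<Longrightarrow> norm p \<le> 1"
  using norm_sa_square[of p] by (cases "p = 0") (auto simp: projection_el_def power2_eq_square)

lemma proj_pos: "proj p \<Longrightarrow> pos p"
  using pos_square[of p] by (auto simp: projection_el_def)

lemma proj_one_minus: "proj p \<Longrightarrow> proj (1 - p)"
  by (simp add: projection_el_def adj_diff algebra_simps)

lemma proj_norm_nonzero: "proj p \<Longrightarrow> p \<noteq> 0 \<Longrightarrow> norm p = 1"
  using norm_sa_square[of p] by (auto simp: projection_el_def power2_eq_square)

lemma norm_square_mono: assumes "pos a" "norm a \<le> 1" shows "pos (a - a * a)"
proof -
  obtain b where b: "pos b" "b * b = a" using pos_sqrt[OF assms(1)] .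
  have "a - a * a = adj b * (1 - a) * b" using b by (simp add: pos_sa algebra_simps flip: b(2))
  then show ?thesis using pos_conj[OF pos_one_minus[OF assms]] by simp
qed

section \<open>Cuntz subequivalence\<close>

abbreviation cb (infix "\<preceq>" 50) where "a \<preceq> b \<equiv> cuntz_below adj a b"

lemma cb_iff: "a \<preceq> b \<longleftrightarrow> (\<forall>e>0. \<exists>v. norm (a - v * b * adj v) < e)"
proof
  assume "a \<preceq> b"
  then obtain v where "(\<lambda>n. norm (a - v n * b * adj (v n))) \<longlonglongrightarrow> 0" unfolding cuntz_below_def by blast
  from LIMSEQ_D[OF this] show "\<forall>e>0. \<exists>v. norm (a - v * b * adj v) < e"
    by fastforce
next
  assume *: "\<forall>e>0. \<exists>v. norm (a - v * b * adj v) < e"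
  have "\<exists>v. norm (a - v * b * adj v) < inverse (real (Suc n))" for n using * by simp
  then obtain v where v: "\<And>n. norm (a - v n * b * adj (v n)) < inverse (real (Suc n))" by metis
  have "(\<lambda>n. norm (a - v n * b * adj (v n))) \<longlonglongrightarrow> 0"
    by (rule tendsto_sandwich[OF _ _ tendsto_const LIMSEQ_inverse_real_of_nat])
       (use less_imp_le[OF v] in \<open>auto intro!: always_eventually simp del: of_nat_Suc\<close>)
  then show "a \<preceq> b" unfolding cuntz_below_def by blast
qed

lemma cb_exact: "a = v * b * adj v \<Longrightarrow> a \<preceq> b"
  unfolding cb_iff by (metis diff_self norm_zero)

lemma cb_trans: assumes "a \<preceq> b" "b \<preceq> c" shows "a \<preceq> c"
  unfolding cb_iff
proof (intro allI impI)
  fix e :: real assume e: "e > 0"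
  obtain v where v: "norm (a - v * b * adj v) < e / 2" using assms(1) e unfolding cb_iff by (meson half_gt_zero)
  define K where "K = norm v * norm v + 1"
  have K: "K > 0" by (simp add: K_def add_nonneg_pos)
  obtain w where w: "norm (b - w * c * adj w) < e / (2 * K)" using assms(2) e K unfolding cb_iff
    by (meson divide_pos_pos mult_pos_pos zero_less_numeral)
  have "a - v * w * c * adj (v * w) = (a - v * b * adj v) + v * (b - w * c * adj w) * adj v"
    by (simp add: algebra_simps adj_mult)
  also have "norm \<dots> \<le> norm (a - v * b * adj v) + norm (v * (b - w * c * adj w) * adj v)"
    by (rule norm_triangle_ineq)
  also have "norm (v * (b - w * c * adj w) * adj v) \<le> norm v * norm (b - w * c * adj w) * norm v"
    using norm_mult_ineq3[of v "b - w * c * adj w" "adj v"] by simp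
  also have "\<dots> \<le> K * norm (b - w * c * adj w)" by (simp add: K_def algebra_simps)
  also have "\<dots> < e / 2" using w K by (simp add: field_simps)
  finally have "norm (a - v * w * c * adj (v * w)) < e" using v by simp
  then show "\<exists>v. norm (a - v * c * adj v) < e" by blast
qed

text \<open>Conjugation by the function \<open>1 / sqrt (max t d)\<close> of \<open>b\<close> turns
  \<open>t * t\<close> into \<open>t * t / max t d\<close>, which differs from \<open>t\<close> by
  at most \<open>d\<close> for \<open>t \<ge> 0\<close>.\<close>

lemma cb_pos_square: assumes "pos b" shows "b \<preceq> b * b"
  unfolding cb_iff
proof (intro allI impI)
  fix e :: real assume e: "e > 0"
  have b: "adj b = b" using assms by (rule pos_sa)
  define d where "d = e / 2"
  have d: "d > 0" "d < e" using e by (simp_all add: d_def)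
  let ?g = "\<lambda>t. 1 / sqrt (max t d)"
  have cg: "continuous_on UNIV ?g" by (intro continuous_intros) (use d in auto)
  let ?v = "cfc b ?g"
  have v: "adj ?v = ?v" by (rule adj_cfc[OF b cg])
  have ci: "continuous_on UNIV (\<lambda>t::real. t)" by (intro continuous_intros)
  have 1: "?v * (b * b) * adj ?v = cfc b (\<lambda>t. ?g t * (t * t) * ?g t)"
    using cfc_mult[OF b continuous_on_mult[OF cg continuous_on_mult[OF ci ci]] cg]
      cfc_mult[OF b cg continuous_on_mult[OF ci ci]] cfc_mult[OF b ci ci] by (simp add: v cfc_ident[OF b])
  have cG: "continuous_on UNIV (\<lambda>t. ?g t * (t * t) * ?g t)" by (intro continuous_intros cg)
  have cG': "continuous_on UNIV (\<lambda>t. (- 1) * (?g t * (t * t) * ?g t))" by (intro continuous_intros cg)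
  have "b = cfc b (\<lambda>t. t)" by (simp add: cfc_ident[OF b])
  then have "b - ?v * (b * b) * adj ?v = cfc b (\<lambda>t. t) + cfc b (\<lambda>t. - 1) * cfc b (\<lambda>t. ?g t * (t * t) * ?g t)"
    unfolding 1 by (simp add: cfc_const[OF b] )
  also have "\<dots> = cfc b (\<lambda>t. t + (- 1) * (?g t * (t * t) * ?g t))"
    by (simp only: cfc_add[OF b ci cG'] cfc_mult[OF b continuous_on_const cG])
  finally have 2: "b - ?v * (b * b) * adj ?v = cfc b (\<lambda>t. t + (- 1) * (?g t * (t * t) * ?g t))" .
  have "norm (b - ?v * (b * b) * adj ?v) \<le> d"
    unfolding 2
  proof (rule norm_cfc_le[OF b])
    show "continuous_on UNIV (\<lambda>t. t + (- 1) * (?g t * (t * t) * ?g t))" by (intro continuous_intros cg)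
    fix t assume "t \<in> rspec b"
    then have t: "0 \<le> t" using assms by (simp add: pos_iff)
    have "?g t * (t * t) * ?g t = t * t / max t d" using d by (simp add: field_simps)
    then show "\<bar>t + (- 1) * (?g t * (t * t) * ?g t)\<bar> \<le> d"
    proof (cases "t \<le> d")
      case True
      then have "t * t / d \<le> t" "0 \<le> t * t / d" using t d mult_right_mono[OF True t] by (simp_all add: field_simps)
      moreover have "max t d = d" using True by simp
      ultimately show ?thesis unfolding \<open>?g t * (t * t) * ?g t = _\<close> using True t by linarith
    next
      case False
      then show ?thesis using d \<open>?g t * (t * t) * ?g t = _\<close> by (simp add: max_def)
    qed
  qed
  then show "\<exists>v. norm (b - v * (b * b) * adj v) < e" using d by (meson le_less_trans)
qed

lemma cb_square: assumes "pos b" shows "b * b \<preceq> b"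
proof -
  obtain c where c: "pos c" "c * c = b" using pos_sqrt[OF assms] .
  show ?thesis by (rule cb_exact[of _ c]) (simp add: pos_sa[OF c(1)] mult.assoc flip: c(2))
qed

text \<open>By \<open>cb_pos_square\<close> it suffices to treat the square of
  \<open>z * adj z\<close>, which is \<open>adj z * z\<close> conjugated by
  \<open>z\<close>.\<close>

lemma cb_mult_adj_swap: "z * adj z \<preceq> adj z * z"
proof (rule cb_trans[OF cb_pos_square[OF pos_mult_adj]])
  show "z * adj z * (z * adj z) \<preceq> adj z * z" by (rule cb_exact[of _ z]) (simp add: mult.assoc)
qed

text \<open>In the corner of \<open>p\<close> the compression of \<open>z\<close> has distance less
  than one from the unit, hence is invertible there. Adding \<open>1 - p\<close> turns this into
  invertibility in the whole algebra, where an inverse square root commuting with \<open>p\<close>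
  can be formed.\<close>

lemma cb_projI:
  assumes p: "proj p" and z: "adj z = z" and n: "norm (p * z * p - p) < 1"
  shows "p \<preceq> z"
proof -
  have p': "adj p = p" "p * p = p" using p by (auto simp: projection_el_def)
  define b where "b = p * z * p + (1 - p)"
  define k where "k = 1 - norm (p * z * p - p)"
  have k: "k > 0" using n by (simp add: k_def)
  have b: "adj b = b" using p' z by (simp add: b_def adj_add adj_diff adj_mult mult.assoc)
  have pb: "p * b = p * z * p" "b * p = p * z * p"
  proof -
    have "p * b = (p * p) * z * p + (p - p * p)" by (simp add: b_def algebra_simps)
    then show "p * b = p * z * p" using p' by simp
    have "b * p = p * z * (p * p) + (p - p * p)" by (simp add: b_def algebra_simps)
    then show "b * p = p * z * p" using p' by simp
  qed
  have sp: "k \<le> t" if "t \<in> rspec b" for t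
  proof -
    have "1 - t \<in> rspec (1 *\<^sub>R 1 - b)" using that by (simp only: rspec_reflect) simp
    then have "\<bar>1 - t\<bar> \<le> norm (1 - b)" using rspec_norm_le by fastforce
    also have "1 - b = - (p * z * p - p)" by (simp add: b_def)
    finally show ?thesis unfolding norm_minus_cancel k_def by linarith
  qed
  let ?g = "\<lambda>t. 1 / sqrt (max t k)"
  have cg: "continuous_on UNIV ?g" by (intro continuous_intros) (use k in auto)
  have ci: "continuous_on UNIV (\<lambda>t::real. t)" by (intro continuous_intros)
  let ?R = "cfc b ?g"
  have "?R * b * ?R = cfc b (\<lambda>t. ?g t * t * ?g t)"
    using cfc_mult[OF b continuous_on_mult[OF cg ci] cg] cfc_mult[OF b cg ci] by (simp add: cfc_ident[OF b])
  also have "\<dots> = cfc b (\<lambda>t. 1)"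
  proof (rule cfc_cong[OF b])
    show "continuous_on UNIV (\<lambda>t. ?g t * t * ?g t)" by (intro continuous_intros cg)
    fix t assume "t \<in> rspec b"
    then have "k \<le> t" by (rule sp)
    then show "?g t * t * ?g t = 1" using k by (simp add: max_def field_simps)
  qed simp
  finally have RbR: "?R * b * ?R = 1" by (simp add: cfc_const[OF b])
  have Rp: "?R * p = p * ?R" by (rule cfc_commute[OF b cg]) (simp add: pb)
  have pp: "p * (p * x) = p * x" for x using p'(2) by (simp flip: mult.assoc)
  have "p = p * (?R * b * ?R) * p" using RbR p' by simp
  also have "\<dots> = (p * ?R) * b * (?R * p)" by (simp add: mult.assoc)
  also have "\<dots> = (?R * p) * b * (p * ?R)" by (simp only: Rp)
  also have "\<dots> = ?R * (p * b) * (p * ?R)" by (simp only: mult.assoc)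
  also have "\<dots> = ?R * p * z * adj (?R * p)"
    unfolding pb adj_mult adj_cfc[OF b cg] p'(1) by (simp add: mult.assoc pp)
  finally show ?thesis by (rule cb_exact)
qed

text \<open>The closed left ideal generated by \<open>x\<close>. For positive \<open>x\<close>, a
  self-adjoint element belongs to it exactly if it lies in the hereditary subalgebra generated by
  \<open>x\<close>.\<close>

definition lideal :: "'a \<Rightarrow> 'a set" where
  "lideal x = closure (range (\<lambda>s. s * x))"

lemma lideal_iff: "u \<in> lideal x \<longleftrightarrow> (\<forall>e>0. \<exists>s. norm (u - s * x) < e)"
  unfolding lideal_def closure_approachable by (auto simp: dist_norm norm_minus_commute)

lemma lideal_mult: assumes "u \<in> lideal x" shows "a * u \<in> lideal x"
  unfolding lideal_iff
proof (intro allI impI)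
  fix e :: real assume e: "e > 0"
  have "norm a + 1 > 0" by (simp add: add_nonneg_pos)
  then obtain s where s: "norm (u - s * x) < e / (norm a + 1)" using assms e unfolding lideal_iff
    by (meson divide_pos_pos)
  have "norm (a * u - (a * s) * x) \<le> norm a * norm (u - s * x)"
    using norm_mult_ineq[of a "u - s * x"] by (simp add: algebra_simps)
  also have "\<dots> \<le> (norm a + 1) * norm (u - s * x)" by (simp add: mult_right_mono)
  also have "\<dots> < e" using s \<open>norm a + 1 > 0\<close> by (simp add: field_simps)
  finally show "\<exists>s. norm (a * u - s * x) < e" by blast
qed

lemma lideal_add: assumes "u \<in> lideal x" "v \<in> lideal x" shows "u + v \<in> lideal x"
  unfolding lideal_iff
proof (intro allI impI)
  fix e :: real assume e: "e > 0"
  obtain s t where st: "norm (u - s * x) < e / 2" "norm (v - t * x) < e / 2"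
    using assms e unfolding lideal_iff by (meson half_gt_zero)
  have "norm (u + v - (s + t) * x) < e"
    using norm_triangle_lt[of "u - s * x" "v - t * x" e] st by (simp add: algebra_simps)
  then show "\<exists>s. norm (u + v - s * x) < e" by blast
qed

lemma lideal_self: "x \<in> lideal x"
  unfolding lideal_iff by (metis diff_self mult_1_left norm_zero)

lemma lideal_zero: "0 \<in> lideal x"
  using lideal_mult[OF lideal_self, of 0 x] by simp

lemma lideal_sum: "(\<And>i. i \<in> S \<Longrightarrow> f i \<in> lideal x) \<Longrightarrow> sum f S \<in> lideal x"
  by (induction S rule: infinite_finite_induct) (simp_all add: lideal_zero lideal_add)

lemma lideal_subset: assumes "u \<in> lideal x" shows "lideal u \<subseteq> lideal x"
  unfolding lideal_def[of u]
  by (rule closure_minimal) (use lideal_mult[OF assms] in \<open>auto simp: lideal_def\<close>)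

lemma lideal_annihilate: assumes "u \<in> lideal x" "x * y = 0" shows "u * y = 0"
proof -
  have "norm (u * y) \<le> 0"
  proof (rule field_le_epsilon)
    fix e :: real assume e: "e > 0"
    have "norm y + 1 > 0" by (simp add: add_nonneg_pos)
    then obtain s where s: "norm (u - s * x) < e / (norm y + 1)" using assms e unfolding lideal_iff
      by (meson divide_pos_pos)
    have "(u - s * x) * y = u * y" using assms(2) by (simp add: left_diff_distrib mult.assoc)
    then have "norm (u * y) \<le> norm (u - s * x) * norm y" using norm_mult_ineq[of "u - s * x" y] by simp
    also have "\<dots> \<le> norm (u - s * x) * (norm y + 1)" by (simp add: mult_left_mono)
    also have "\<dots> < e" using s \<open>norm y + 1 > 0\<close> by (simp add: field_simps)
    finally show "norm (u * y) \<le> 0 + e" by simp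
  qed
  then show ?thesis by simp
qed

text \<open>With \<open>u = \<Sum> v\<^sub>i x\<^sub>i\<close> the orthogonality of the \<open>x\<^sub>i\<close> gives \<open>u u\<^sup>* = \<Sum> v\<^sub>i x\<^sub>i\<^sup>2 v\<^sub>i\<^sup>*\<close>,
  and \<open>u\<close> is close to \<open>s x\<close>.\<close>

lemma cb_sum:
  assumes x: "pos x" and fin: "finite S"
    and sa: "\<And>i. i \<in> S \<Longrightarrow> adj (y i) = y i" and L: "\<And>i. i \<in> S \<Longrightarrow> y i \<in> lideal x"
    and orth: "\<And>i j. i \<in> S \<Longrightarrow> j \<in> S \<Longrightarrow> i \<noteq> j \<Longrightarrow> y i * y j = 0"
    and le: "\<And>i. i \<in> S \<Longrightarrow> a i \<preceq> y i * y i"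
  shows "sum a S \<preceq> x"
\<comment> \<open>It suffices to reach \<open>x * x\<close>: an element \<open>s * x\<close> near
  \<open>u\<close> makes \<open>u * adj u\<close> close to
  \<open>s * (x * x) * adj s\<close>.\<close>
proof (rule cb_trans[OF _ cb_square[OF x]])
  show "sum a S \<preceq> x * x" unfolding cb_iff
  proof (intro allI impI)
    fix e :: real assume e: "e > 0"
    define N where "N = real (card S) + 1"
    have N: "N > 0" by (simp add: N_def add_nonneg_pos)
    have "\<exists>v. norm (a i - v * (y i * y i) * adj v) < e / (2 * N)" if "i \<in> S" for i
      using le[OF that] e N unfolding cb_iff by (meson divide_pos_pos mult_pos_pos zero_less_numeral)
    then obtain v where v: "\<And>i. i \<in> S \<Longrightarrow> norm (a i - v i * (y i * y i) * adj (v i)) < e / (2 * N)"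
      by metis
    define u where "u = (\<Sum>i\<in>S. v i * y i)"
    have "u * adj u = (\<Sum>i\<in>S. \<Sum>j\<in>S. v i * (y i * y j) * adj (v j))"
      unfolding u_def adj_sum sum_product by (intro sum.cong refl) (simp add: adj_mult sa mult.assoc)
    also have "\<dots> = (\<Sum>i\<in>S. v i * (y i * y i) * adj (v i))"
    proof (intro sum.cong refl)
      fix i assume i: "i \<in> S"
      have "(\<Sum>j\<in>S. v i * (y i * y j) * adj (v j)) = (\<Sum>j\<in>S. if j = i then v i * (y i * y i) * adj (v i) else 0)"
        by (intro sum.cong refl) (use orth[OF i] in auto)
      then show "(\<Sum>j\<in>S. v i * (y i * y j) * adj (v j)) = v i * (y i * y i) * adj (v i)" using fin i by simp
    qed
    finally have uu: "u * adj u = (\<Sum>i\<in>S. v i * (y i * y i) * adj (v i))" .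
    have "norm (sum a S - u * adj u) \<le> (\<Sum>i\<in>S. norm (a i - v i * (y i * y i) * adj (v i)))"
      unfolding uu sum_subtractf[symmetric] by (rule norm_sum)
    also have "\<dots> \<le> (\<Sum>i\<in>S. e / (2 * N))" by (intro sum_mono less_imp_le v)
    also have "\<dots> < e / 2" using e N by (simp add: N_def field_simps)
    finally have 1: "norm (sum a S - u * adj u) < e / 2" .
    have uL: "u \<in> lideal x" unfolding u_def by (intro lideal_sum lideal_mult L)
    \<comment> \<open>The cap \<open>1\<close> gives \<open>norm (s * x) \<le> norm u + 1\<close>,
      so the two halves of the difference together have coefficient
      \<open>2 * norm u + 1\<close>.\<close>
    define d where "d = min 1 (e / (2 * (2 * norm u + 1)))"
    have nu: "2 * norm u + 1 > 0" by (simp add: add_nonneg_pos)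
    have d: "d > 0" "d \<le> 1" "d \<le> e / (2 * (2 * norm u + 1))" using e nu by (auto simp: d_def)
    obtain s where s: "norm (u - s * x) < d" using uL d(1) unfolding lideal_iff by blast
    have "norm (s * x) \<le> norm u + 1" using norm_triangle_ineq4[of u "u - s * x"] s d(2) by simp
    have "s * (x * x) * adj s = (s * x) * adj (s * x)" by (simp add: adj_mult pos_sa[OF x] mult.assoc)
    then have "u * adj u - s * (x * x) * adj s = (u - s * x) * adj u + (s * x) * adj (u - s * x)"
      by (simp add: algebra_simps adj_diff)
    also have "norm \<dots> \<le> norm (u - s * x) * norm u + norm (s * x) * norm (u - s * x)"
      by (intro norm_triangle_mono order_trans[OF norm_mult_ineq]) (simp_all only: norm_adj order_refl)
    also have "\<dots> \<le> norm (u - s * x) * (2 * norm u + 1)"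
      using mult_right_mono[OF \<open>norm (s * x) \<le> norm u + 1\<close>, of "norm (u - s * x)"] by (simp add: algebra_simps)
    also have "\<dots> \<le> d * (2 * norm u + 1)" using s nu by (intro mult_right_mono) auto
    also have "\<dots> \<le> e / 2" using d(3) nu by (simp add: field_simps)
    finally have "norm (sum a S - s * (x * x) * adj s) < e"
      using 1 norm_triangle_ineq[of "sum a S - u * adj u" "u * adj u - s * (x * x) * adj s"] by simp
    then show "\<exists>v. norm (sum a S - v * (x * x) * adj v) < e" by blast
  qed
qed

end

section \<open>Simple algebras\<close>

text \<open>The algebraic two-sided ideal generated by \<open>k\<close>, built one summand at a
  time, so that statements about finite sums become inductions.\<close>

inductive_set twosided :: "'a::ring \<Rightarrow> 'a set" for k where
  zero: "0 \<in> twosided k"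
| add: "u \<in> twosided k \<Longrightarrow> u + a * k * b \<in> twosided k"

lemma twosided_add: "v \<in> twosided k \<Longrightarrow> u \<in> twosided k \<Longrightarrow> u + v \<in> twosided k"
  by (induction rule: twosided.induct) (auto simp: add.assoc[symmetric] intro: twosided.add)

lemma twosided_mult_left: "u \<in> twosided k \<Longrightarrow> c * u \<in> twosided k"
proof (induction rule: twosided.induct)
  case (add u a b)
  then show ?case using twosided.add[of "c * u" k "c * a" b] by (simp add: distrib_left mult.assoc)
qed (simp add: twosided.zero)

lemma twosided_mult_right: "u \<in> twosided k \<Longrightarrow> u * c \<in> twosided k"
proof (induction rule: twosided.induct)
  case (add u a b)
  then show ?case using twosided.add[of "u * c" k a "b * c"] by (simp add: distrib_right mult.assoc)
qed (simp add: twosided.zero)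

lemma twosided_self: "(k::'a::ring_1) \<in> twosided k"
  using twosided.add[OF twosided.zero, where a = 1 and b = 1 and k = k] by simp

context unital_cstar_algebra
begin

lemma continuous_on_sc: "continuous_on S (sc c)"
proof (rule continuous_on_subset)
  have "bounded_linear (sc c)"
  proof (rule bounded_linear_intro[of _ "cmod c"])
    show "sc c (r *\<^sub>R x) = r *\<^sub>R sc c x" for r x
      unfolding sc_of_real[symmetric] by (simp add: sc_sc mult.commute)
  qed (simp_all add: sc_add_right sc_norm mult.commute)
  then show "continuous_on UNIV (sc c)" by (rule linear_continuous_on)
qed simp

lemma closed_ideal_closure_twosided: "closed_ideal sc (closure (twosided k))"
proof -
  let ?T = "twosided k"
  have sub: "?T \<subseteq> closure ?T" by (rule closure_subset)
  \<comment> \<open>Closure under addition is extended one argument at a time: first with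
    \<open>a\<close> in the ideal itself, then with both in its closure.\<close>
  have 1: "(\<lambda>b. a + b) ` closure ?T \<subseteq> closure ?T" if "a \<in> ?T" for a
    by (rule image_closure_subset) (use that sub twosided_add in \<open>auto intro!: continuous_intros\<close>)
  have 2: "(\<lambda>a. a + b) ` closure ?T \<subseteq> closure ?T" if "b \<in> closure ?T" for b
    by (rule image_closure_subset) (use that 1 in \<open>auto intro!: continuous_intros\<close>)
  have 3: "sc c ` closure ?T \<subseteq> closure ?T" for c
  proof (rule image_closure_subset)
    have "sc c u \<in> ?T" if "u \<in> ?T" for u
      using twosided_mult_left[OF that, of "sc c 1"] by (simp add: sc_mult_left)
    then show "sc c ` ?T \<subseteq> closure ?T" using sub by blast
  qed (simp_all add: continuous_on_sc)
  have 4: "(\<lambda>u. x * u) ` closure ?T \<subseteq> closure ?T" for x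
    by (rule image_closure_subset) (use sub twosided_mult_left in \<open>auto intro!: continuous_intros\<close>)
  have 5: "(\<lambda>u. u * x) ` closure ?T \<subseteq> closure ?T" for x
    by (rule image_closure_subset) (use sub twosided_mult_right in \<open>auto intro!: continuous_intros\<close>)
  have "0 \<in> closure ?T" using sub twosided.zero by blast
  then show ?thesis unfolding closed_ideal_def
    using image_subset_iff[THEN iffD1, OF 2] image_subset_iff[THEN iffD1, OF 3]
      image_subset_iff[THEN iffD1, OF 4] image_subset_iff[THEN iffD1, OF 5]
    by (intro conjI ballI allI closed_closure) simp_all
qed

text \<open>A dense ideal meets the open unit ball around \<open>1\<close>, which consists of
  invertible elements. So simplicity gives an exact finite sum of terms \<open>a * k * b\<close>
  equal to \<open>1\<close>, not just approximations.\<close>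

lemma one_in_twosided:
  assumes simple: "simple_algebra sc TYPE('a)" and k: "k \<noteq> 0"
  shows "1 \<in> twosided (k::'a)"
proof -
  have "closure (twosided k) \<noteq> {0}" using k twosided_self[of k] closure_subset by blast
  then have "closure (twosided k) = UNIV" using simple closed_ideal_closure_twosided unfolding simple_algebra_def by blast
  then have "1 \<in> closure (twosided k)" by simp
  then obtain t where t: "t \<in> twosided k" "dist t 1 < 1" unfolding closure_approachable by (meson zero_less_one)
  then have "invertible_el t" by (intro invertible_el_near_one) (simp add: dist_norm norm_minus_commute)
  then obtain b where "b * t = 1" unfolding invertible_el_def by blast
  then show ?thesis using twosided_mult_left[OF t(1), of b] by simp
qed

text \<open>Simple unital algebras are prime: otherwise left multiplication by \<open>y\<close>
  would kill the ideal generated by \<open>x\<close>, which contains \<open>1\<close>.\<close>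

lemma simple_prime:
  assumes simple: "simple_algebra sc TYPE('a)" and "y \<noteq> (0::'a)" "x \<noteq> 0"
  obtains a where "y * a * x \<noteq> 0"
proof (rule ccontr)
  assume "\<not> thesis"
  then have 0: "y * a * x = 0" for a using that by blast
  have "y * u = 0" if "u \<in> twosided x" for u
    using that by (induction rule: twosided.induct) (simp_all add: distrib_left mult.assoc[symmetric] 0)
  from this[OF one_in_twosided[OF simple assms(3)]] show False using assms(2) by simp
qed

text \<open>Primeness gives a nonzero \<open>z = y * a * x j\<close>. As a left multiple of
  \<open>x j\<close> it is below the new element; as a right multiple of \<open>y\<close> it is
  below the old bound, after exchanging \<open>z * adj z\<close> and
  \<open>adj z * z\<close>.\<close>

lemma cb_common_lower_bound:
  assumes simple: "simple_algebra sc TYPE('a)" and fin: "finite S" and nz: "\<And>i. i \<in> S \<Longrightarrow> x i \<noteq> (0::'a)"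
  shows "\<exists>y. y \<noteq> 0 \<and> (\<forall>i\<in>S. y * adj y \<preceq> x i * adj (x i))"
  using fin nz
proof (induction S)
  case empty
  show ?case by (intro exI[of _ 1]) simp
next
  case (insert j S)
  then obtain y where y: "y \<noteq> 0" "\<And>i. i \<in> S \<Longrightarrow> y * adj y \<preceq> x i * adj (x i)" by auto
  obtain a where a: "y * a * x j \<noteq> 0" using simple_prime[OF simple y(1)] insert.prems by blast
  let ?z = "y * a * x j"
  have 1: "?z * adj ?z \<preceq> x j * adj (x j)" by (rule cb_exact[of _ "y * a"]) (simp add: adj_mult mult.assoc)
  have "adj ?z * ?z \<preceq> adj y * y"
    by (rule cb_exact[of _ "adj (a * x j)"]) (simp add: adj_mult adj_adj mult.assoc)
  then have "?z * adj ?z \<preceq> adj y * y" using cb_mult_adj_swap cb_trans by blast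
  then have 2: "?z * adj ?z \<preceq> y * adj y" using cb_mult_adj_swap[of "adj y"] cb_trans by (simp add: adj_adj)
  show ?case using a 1 cb_trans[OF 2 y(2)] by (intro exI[of _ ?z]) auto
qed

lemma one_in_rspec: "pos x \<Longrightarrow> norm x = 1 \<Longrightarrow> 1 \<in> rspec x"
  using norm_in_rspec[of x] unfolding pos_iff by (metis abs_of_nonneg)

text \<open>A nonzero self-adjoint element with only one nonzero spectral value is a multiple of a
  projection; two nonzero spectral values yield orthogonal elements through disjoint bumps.\<close>

lemma minimal_is_multiple_of_proj:
  assumes k: "adj k = k" "k \<in> lideal h" "k \<noteq> 0"
    and H: "\<And>h1 h2. adj h1 = h1 \<Longrightarrow> adj h2 = h2 \<Longrightarrow> h1 \<in> lideal h \<Longrightarrow> h2 \<in> lideal h \<Longrightarrow> h1 * h2 = 0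
      \<Longrightarrow> h1 = 0 \<or> h2 = 0"
  shows "\<exists>r e. r \<noteq> 0 \<and> k = r *\<^sub>R e \<and> proj e \<and> e \<noteq> 0"
proof -
  obtain t where t: "t \<in> rspec k" "\<bar>t\<bar> = norm k" using norm_in_rspec[OF k(1)] by blast
  have t0: "t \<noteq> 0" using t k(3) by auto
  have only: "s = 0 \<or> s = t" if s: "s \<in> rspec k" for s
  proof (rule ccontr)
    assume "\<not> (s = 0 \<or> s = t)"
    then have st: "s \<noteq> 0" "s \<noteq> t" by auto
    define d where "d = min (\<bar>s - t\<bar> / 2) (min (\<bar>t\<bar> / 2) (\<bar>s\<bar> / 2))"
    have d: "d > 0" "2 * d \<le> \<bar>s - t\<bar>" "2 * d \<le> \<bar>t\<bar>" "2 * d \<le> \<bar>s\<bar>" using st t0 by (auto simp: d_def min_def)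
    define f where "f u x = max 0 (d - \<bar>x - u\<bar>)" for u x :: real
    \<comment> \<open>Dividing by \<open>x\<close> shows that the bump at \<open>u\<close>, applied
      to \<open>k\<close>, is a multiple of \<open>k\<close> and hence in the left ideal of
      \<open>h\<close>. The maximum equals \<open>x * x\<close> wherever the bump is nonzero and
      keeps the denominator positive elsewhere.\<close>
    define g where "g u x = f u x * x / max (x * x) (d * d)" for u x
    have cf: "continuous_on UNIV (f u)" for u unfolding f_def by (intro continuous_intros)
    have cg: "continuous_on UNIV (g u)" for u
      unfolding g_def f_def by (intro continuous_intros) (use d(1) in \<open>auto simp: max_def\<close>)
    have ci: "continuous_on UNIV (\<lambda>x::real. x)" by (intro continuous_intros)
    have fg: "f u x = g u x * x" if "2 * d \<le> \<bar>u\<bar>" for u x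
    proof (cases "f u x = 0")
      case False
      then have "d - \<bar>x - u\<bar> > 0" by (auto simp: f_def max_def split: if_splits)
      then have "d \<le> \<bar>x\<bar>" using that by linarith
      then have "d * d \<le> \<bar>x\<bar> * \<bar>x\<bar>" using d(1) by (intro mult_mono) auto
      then have "d * d \<le> x * x" by simp
      then have "max (x * x) (d * d) = x * x" by simp
      moreover have "x \<noteq> 0" using \<open>d \<le> \<bar>x\<bar>\<close> d(1) by auto
      ultimately show ?thesis by (simp add: g_def)
    qed (simp add: g_def)
    have L: "cfc k (f u) \<in> lideal h" if "2 * d \<le> \<bar>u\<bar>" for u
    proof -
      have "f u = (\<lambda>x. g u x * x)" using fg[OF that] by auto
      then have "cfc k (f u) = cfc k (g u) * k" using cfc_mult[OF k(1) cg ci] by (simp add: cfc_ident[OF k(1)])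
      then show ?thesis using lideal_mult[OF k(2)] by simp
    qed
    have nz: "cfc k (f u) \<noteq> 0" if "u \<in> rspec k" for u
      using norm_cfc_ge[OF k(1) cf that, of u] d(1) by (auto simp: f_def)
    have "(\<lambda>x. f t x * f s x) = (\<lambda>x. 0)"
    proof
      fix x
      show "f t x * f s x = 0" using d(2) by (auto simp: f_def max_def)
    qed
    then have "cfc k (f t) * cfc k (f s) = 0" using cfc_mult[OF k(1) cf[of t] cf[of s]] by (simp add: cfc_const[OF k(1)])
    then show False using H[OF adj_cfc[OF k(1) cf] adj_cfc[OF k(1) cf] L L, of t s] d nz t(1) s by blast
  qed
  have "k * k = rpe [:0, 0, 1:] k" by simp
  also have "\<dots> = cfc k (poly [:0, 0, 1:])" by (rule cfc_rpe[OF k(1), symmetric])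
  also have "\<dots> = cfc k (poly [:0, t:])"
    by (rule cfc_cong[OF k(1)]) (use only in \<open>auto intro!: continuous_intros\<close>)
  also have "\<dots> = t *\<^sub>R k" by (simp add: cfc_rpe[OF k(1)])
  finally have kk: "k * k = t *\<^sub>R k" .
  define e where "e = (1 / t) *\<^sub>R k"
  have "k = t *\<^sub>R e" using t0 by (simp add: e_def)
  moreover have "proj e" using k(1) kk t0 by (simp add: projection_el_def e_def adj_scaleR)
  moreover have "e \<noteq> 0" using k(3) t0 by (simp add: e_def)
  ultimately show ?thesis using t0 by blast
qed

section \<open>Infinite dimension and families of orthogonal elements\<close>

lemma vector_space_sc: "vector_space sc"
  by unfold_locales (simp_all add: sc_add_right sc_add_left sc_sc)

text \<open>Write \<open>1\<close> as a finite sum of terms \<open>a * e * b\<close> and multiply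
  \<open>x\<close> by it on both sides. Each inner factor \<open>e * (b * x * a') * e\<close> is a
  scalar multiple of \<open>e\<close>, so \<open>x\<close> lies in the span of the finitely many
  \<open>a * e * b'\<close>.\<close>

lemma finite_dim_of_minimal_proj:
  assumes simple: "simple_algebra sc TYPE('a)" and e: "e \<noteq> (0::'a)"
    and scalar: "\<And>a. \<exists>c. e * a * e = sc c e"
  shows "\<not> infinite_dimensional sc TYPE('a)"
proof -
  interpret V: vector_space sc by (rule vector_space_sc)
  have inner: "\<exists>S. finite S \<and> (\<forall>x. a * e * b * x * v \<in> V.span S)" if "v \<in> twosided e" for a b v
    using that
  proof (induction rule: twosided.induct)
    case zero
    show ?case by (intro exI[of _ "{}"]) simp
  next
    case (add u a' b')
    then obtain S where S: "finite S" "\<And>x. a * e * b * x * u \<in> V.span S" by blast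
    have "a * e * b * x * (u + a' * e * b') \<in> V.span (insert (a * e * b') S)" for x
    proof -
      obtain c where c: "e * (b * x * a') * e = sc c e" using scalar by blast
      have "a * e * b * x * (u + a' * e * b') = a * e * b * x * u + a * (e * (b * x * a') * e) * b'"
        by (simp add: algebra_simps)
      also have "\<dots> = a * e * b * x * u + sc c (a * e * b')"
        unfolding c by (simp add: sc_mult_left sc_mult_right)
      also have "\<dots> \<in> V.span (insert (a * e * b') S)"
        using S(2) by (meson V.span_add V.span_base V.span_mono V.span_scale insertI1 subsetD subset_insertI)
      finally show ?thesis .
    qed
    then show ?case using S(1) by (intro exI[of _ "insert (a * e * b') S"]) simp
  qed
  have outer: "\<exists>S. finite S \<and> (\<forall>x. u * x * v \<in> V.span S)" if "u \<in> twosided e" "v \<in> twosided e" for u v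
    using that
  proof (induction rule: twosided.induct)
    case zero
    show ?case by (intro exI[of _ "{}"]) simp
  next
    case (add u a b)
    then obtain S where S: "finite S" "\<And>x. u * x * v \<in> V.span S" by blast
    obtain S' where S': "finite S'" "\<And>x. a * e * b * x * v \<in> V.span S'" using inner[OF add.prems] by blast
    have "(u + a * e * b) * x * v \<in> V.span (S \<union> S')" for x
      unfolding distrib_right
      using S(2) S'(2) by (meson V.span_add V.span_mono subsetD sup_ge1 sup_ge2)
    then show ?case using S(1) S'(1) by (intro exI[of _ "S \<union> S'"]) simp
  qed
  obtain S where S: "finite S" "\<And>x. 1 * x * 1 \<in> V.span S"
    using outer[OF one_in_twosided[OF simple e] one_in_twosided[OF simple e]] by blast
  have "\<exists>f. a = (\<Sum>s\<in>S. sc (f s) s)" for a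
    using S(2)[of a] unfolding V.span_finite[OF S(1)] by auto
  then show ?thesis unfolding infinite_dimensional_def using S(1) by blast
qed

text \<open>Otherwise \<open>h\<close> is a multiple of a projection whose corner consists of
  scalars only, and \<open>finite_dim_of_minimal_proj\<close> contradicts infinite
  dimension.\<close>

lemma orthogonal_pair:
  assumes simple: "simple_algebra sc TYPE('a)" and inf: "infinite_dimensional sc TYPE('a)"
    and h: "adj h = h" "h \<noteq> (0::'a)"
  obtains h1 h2 where "adj h1 = h1" "adj h2 = h2" "h1 \<noteq> 0" "h2 \<noteq> 0" "h1 \<in> lideal h" "h2 \<in> lideal h" "h1 * h2 = 0"
proof (rule ccontr)
  assume "\<not> thesis"
  note contra = this that
  have H: "h1 = 0 \<or> h2 = 0" if "adj h1 = h1" "adj h2 = h2" "h1 \<in> lideal h" "h2 \<in> lideal h" "h1 * h2 = 0" for h1 h2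
    using that contra by blast
  obtain r e where re: "r \<noteq> 0" "h = r *\<^sub>R e" "proj e" "e \<noteq> 0"
    using minimal_is_multiple_of_proj[OF h(1) lideal_self h(2) H] by blast
  have e: "adj e = e" "e * e = e" using re(3) by (auto simp: projection_el_def)
  have eL: "a * e \<in> lideal h" for a
    using lideal_mult[OF lideal_self, of "(1 / r) *\<^sub>R a" h] re(1,2) by simp
  have sa: "\<exists>c. e * w * e = c *\<^sub>R e" if "adj w = w" for w
  proof (cases "e * w * e = 0")
    case True
    then show ?thesis by (intro exI[of _ 0]) simp
  next
    case False
    let ?k = "e * w * e"
    have k: "adj ?k = ?k" using that e by (simp add: adj_mult mult.assoc)
    obtain c q where q: "c \<noteq> 0" "?k = c *\<^sub>R q" "proj q" "q \<noteq> 0"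
      using minimal_is_multiple_of_proj[OF k eL False H] by blast
    \<comment> \<open>Here \<open>q\<close> is a subprojection of \<open>e\<close>. Since
      \<open>q\<close> and \<open>e - q\<close> are orthogonal elements of the ideal and
      \<open>q\<close> is nonzero, they leave only \<open>q = e\<close>.\<close>
    have qk: "q = (1 / c) *\<^sub>R ?k" using q(1,2) by simp
    have "?k * e = ?k" using e by (simp add: mult.assoc)
    then have "q * e = q" unfolding qk by simp
    then have 0: "q * (e - q) = 0" using q(3) by (simp add: right_diff_distrib projection_el_def)
    have "q \<in> lideal h" using eL[of q] \<open>q * e = q\<close> by simp
    moreover have "e - q \<in> lideal h" using eL[of "1 - q"] \<open>q * e = q\<close> by (simp add: left_diff_distrib)
    moreover have "adj q = q" "adj (e - q) = e - q" using q(3) e by (auto simp: projection_el_def adj_diff)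
    ultimately have "e - q = 0" using H[of q "e - q"] 0 q(4) by blast
    then show ?thesis using q(2) by auto
  qed
  have "\<exists>c. e * a * e = sc c e" for a
  proof -
    obtain u v where uv: "adj u = u" "adj v = v" "a = u + sc \<i> v" using re_im_decomp[of a] by metis
    obtain c d where "e * u * e = c *\<^sub>R e" "e * v * e = d *\<^sub>R e" using sa uv(1,2) by meson
    then have "e * a * e = sc (complex_of_real c + \<i> * complex_of_real d) e"
      unfolding uv(3) by (simp add: distrib_left distrib_right sc_mult_left sc_mult_right sc_add_left sc_of_real sc_sc[symmetric])
    then show ?thesis by blast
  qed
  then show False using finite_dim_of_minimal_proj[OF simple re(4)] inf by blast
qed

text \<open>One element of the pair is kept and the other is split further. The left ideal of the
  latter stays orthogonal to the kept element by \<open>lideal_annihilate\<close>.\<close>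

lemma orthogonal_sequence:
  assumes simple: "simple_algebra sc TYPE('a)" and inf: "infinite_dimensional sc TYPE('a)"
    and h: "adj h = h" "h \<noteq> (0::'a)"
  shows "\<exists>y::nat \<Rightarrow> 'a. (\<forall>i<n. adj (y i) = y i \<and> y i \<noteq> 0 \<and> y i \<in> lideal h) \<and>
    (\<forall>i<n. \<forall>j<n. i \<noteq> j \<longrightarrow> y i * y j = 0)"
  using h
proof (induction n arbitrary: h)
  case 0
  show ?case by simp
next
  case (Suc n)
  obtain h1 h2 where h12: "adj h1 = h1" "adj h2 = h2" "h1 \<noteq> 0" "h2 \<noteq> 0" "h1 \<in> lideal h" "h2 \<in> lideal h" "h1 * h2 = 0"
    using orthogonal_pair[OF simple inf Suc.prems] by blast
  obtain y where y: "\<And>i. i < n \<Longrightarrow> adj (y i) = y i \<and> y i \<noteq> 0 \<and> y i \<in> lideal h1"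
    "\<And>i j. i < n \<Longrightarrow> j < n \<Longrightarrow> i \<noteq> j \<Longrightarrow> y i * y j = 0"
    using Suc.IH[OF h12(1,3)] by blast
  have 1: "y i * h2 = 0" if "i < n" for i using lideal_annihilate h12(7) y(1)[OF that] by blast
  have 2: "h2 * y i = 0" if "i < n" for i
    using 1[OF that] y(1)[OF that] h12(2) by (metis adj_mult adj_zero)
  have "y i \<in> lideal h" if "i < n" for i using y(1)[OF that] lideal_subset[OF h12(5)] by blast
  then show ?case using y h12 1 2
    by (intro exI[of _ "y(n := h2)"]) (auto simp: less_Suc_eq)
qed

lemma orthogonal_family:
  assumes simple: "simple_algebra sc TYPE('a)" and inf: "infinite_dimensional sc TYPE('a)"
    and h: "adj h = h" "h \<noteq> (0::'a)" and fin: "finite S"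
  obtains y where "\<And>i. i \<in> S \<Longrightarrow> adj (y i) = y i" "\<And>i. i \<in> S \<Longrightarrow> y i \<noteq> 0" "\<And>i. i \<in> S \<Longrightarrow> y i \<in> lideal h"
    "\<And>i j. i \<in> S \<Longrightarrow> j \<in> S \<Longrightarrow> i \<noteq> j \<Longrightarrow> y i * y j = 0"
proof -
  obtain f where f: "bij_betw f S {0..<card S}" using ex_bij_betw_finite_nat[OF fin] by blast
  obtain y where "\<forall>i<card S. adj (y i) = y i \<and> y i \<noteq> 0 \<and> y i \<in> lideal h"
    "\<forall>i<card S. \<forall>j<card S. i \<noteq> j \<longrightarrow> y i * y j = 0"
    using orthogonal_sequence[OF simple inf h, of "card S"] by blast
  moreover have "f i < card S" if "i \<in> S" for i using f that by (auto simp: bij_betw_def)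
  moreover have "f i \<noteq> f j" if "i \<in> S" "j \<in> S" "i \<noteq> j" for i j using f that by (auto simp: bij_betw_def inj_on_def)
  ultimately show thesis by (intro that[of "\<lambda>i. y (f i)"]) auto
qed

text \<open>If \<open>u\<close> is a sum of terms \<open>a * k * b\<close>, an almost central
  \<open>q\<close> can be moved past each left factor \<open>a\<close> to meet \<open>k\<close>.
  \<open>F\<close> collects these left factors, and neither \<open>F\<close> nor \<open>C\<close>
  depends on \<open>q\<close>.\<close>

lemma twosided_commute_bound:
  assumes "u \<in> twosided (k::'a)"
  shows "\<exists>F C. finite F \<and> 0 \<le> C \<and> (\<forall>q \<tau>. norm q \<le> 1 \<longrightarrow> 0 \<le> \<tau> \<longrightarrow> (\<forall>a\<in>F. norm (q * a - a * q) \<le> \<tau>) \<longrightarrow>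
    norm (q * u) \<le> C * (norm (q * k) + \<tau>))"
  using assms
proof (induction rule: twosided.induct)
  case zero
  show ?case by (intro exI[of _ "{}"] exI[of _ 0]) simp
next
  case (add u a b)
  then obtain F C where FC: "finite F" "0 \<le> C" "\<And>q \<tau>. norm q \<le> 1 \<Longrightarrow> 0 \<le> \<tau> \<Longrightarrow> (\<forall>a\<in>F. norm (q * a - a * q) \<le> \<tau>) \<Longrightarrow>
    norm (q * u) \<le> C * (norm (q * k) + \<tau>)" by blast
  define D where "D = norm a * norm b + norm k * norm b"
  have "norm (q * (u + a * k * b)) \<le> (C + D) * (norm (q * k) + \<tau>)"
    if q: "norm q \<le> 1" "0 \<le> \<tau>" "\<forall>a\<in>insert a F. norm (q * a - a * q) \<le> \<tau>" for q \<tau>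
  proof -
    have "q * (u + a * k * b) = q * u + (a * (q * k) * b + (q * a - a * q) * k * b)" by (simp add: algebra_simps)
    also have "norm \<dots> \<le> C * (norm (q * k) + \<tau>) + (norm a * norm (q * k) * norm b + norm (q * a - a * q) * norm k * norm b)"
      using FC(3)[OF q(1,2)] q(3) by (intro norm_triangle_mono norm_mult_ineq3) auto
    also have "norm (q * a - a * q) * norm k * norm b \<le> \<tau> * norm k * norm b"
      using q(3) by (intro mult_right_mono) auto
    also have "norm a * norm (q * k) * norm b + \<tau> * norm k * norm b \<le> D * (norm (q * k) + \<tau>)"
      using q(2) by (simp add: D_def algebra_simps)
    finally show ?thesis by (simp add: algebra_simps)
  qed
  then show ?case using FC(1,2) by (intro exI[of _ "insert a F"] exI[of _ "C + D"]) (simp add: D_def)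
qed

text \<open>\<open>k\<close> lives where \<open>x\<close> exceeds \<open>1 - r\<close>, and there
  \<open>1 - x\<close> agrees with its truncation \<open>g\<close>, which is small on the whole
  spectrum. An exact identity, unlike a norm estimate, survives multiplication from the
  right.\<close>

lemma spectral_peak:
  assumes x: "pos x" "norm x = 1" and r: "r > 0"
  obtains k g where "adj k = k" "k \<noteq> 0" "norm g \<le> r" "(1 - x) * k = g * k"
proof -
  let ?f = "\<lambda>t. max 0 (t - (1 - r))" and ?g = "\<lambda>t. min (1 - t) r"
  have a: "adj x = x" using x by (simp add: pos_sa)
  have cf: "continuous_on UNIV ?f" and cg: "continuous_on UNIV ?g" and ci: "continuous_on UNIV (\<lambda>t::real. t)"
    by (intro continuous_intros)+
  define k where "k = cfc x ?f"
  define g where "g = cfc x ?g"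
  have k: "adj k = k" unfolding k_def by (rule adj_cfc[OF a cf])
  have k0: "k \<noteq> 0" using norm_cfc_ge[OF a cf one_in_rspec[OF x]] r by (auto simp: k_def)
  have g: "norm g \<le> r" unfolding g_def
  proof (rule norm_cfc_le[OF a cg])
    fix t assume "t \<in> rspec x"
    then have "\<bar>t\<bar> \<le> 1" using rspec_norm_le x(2) by metis
    then show "\<bar>?g t\<bar> \<le> r" using r by (auto simp: min_def)
  qed
  have "k = cfc x (\<lambda>t. t * ?f t + ?g t * ?f t)"
    unfolding k_def
  proof (rule cfc_cong[OF a cf])
    show "continuous_on UNIV (\<lambda>t. t * ?f t + ?g t * ?f t)" by (intro continuous_intros)
    show "?f t = t * ?f t + ?g t * ?f t" for t
    proof (cases "t \<le> 1 - r")
      case False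
      then have "t + ?g t = 1" by simp
      then show ?thesis by (simp only: distrib_right[symmetric] mult_1_left)
    qed simp
  qed
  also have "\<dots> = cfc x (\<lambda>t. t * ?f t) + cfc x (\<lambda>t. ?g t * ?f t)"
    by (rule cfc_add[OF a]) (intro continuous_intros)+
  also have "\<dots> = x * k + g * k"
    unfolding k_def g_def cfc_mult[OF a ci cf] cfc_mult[OF a cg cf] cfc_ident[OF a] ..
  finally have e: "k = x * k + g * k" .
  have "k - x * k = g * k" using arg_cong[OF e, of "\<lambda>u. u - x * k"] by (simp only: add_diff_cancel_left')
  then have "(1 - x) * k = g * k" by (simp add: left_diff_distrib)
  from that[OF k k0 g this] show thesis .
qed

text \<open>Condition (d) is automatic for nonzero projections: \<open>1 = \<Sum> a\<^sub>i k b\<^sub>i\<close> with \<open>k\<close> supported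
  where \<open>x\<close> is close to its norm, so an almost central projection \<open>q\<close> cannot be almost orthogonal
  to \<open>k\<close>.\<close>

lemma almost_central_proj_norm:
  assumes simple: "simple_algebra sc TYPE('a)" and x: "pos x" "norm (x::'a) = 1" and e: "e > 0"
  shows "\<exists>F \<tau>. finite F \<and> \<tau> > 0 \<and> (\<forall>q. proj q \<longrightarrow> q \<noteq> 0 \<longrightarrow> (\<forall>a\<in>F. norm (q * a - a * q) \<le> \<tau>) \<longrightarrow>
    norm (q * x * q) > 1 - e)"
proof -
  have a: "adj x = x" using x by (simp add: pos_sa)
  obtain k g where k: "adj k = k" and k0: "k \<noteq> 0" and g: "norm g \<le> e / 2" and gk: "(1 - x) * k = g * k"
    using spectral_peak[OF x, of "e / 2"] e by auto
  have xk: "x * k = k - g * k" by (simp add: gk[symmetric] left_diff_distrib)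
  obtain F C where FC: "finite F" "0 \<le> C" "\<And>q \<tau>. norm q \<le> 1 \<Longrightarrow> 0 \<le> \<tau> \<Longrightarrow> (\<forall>a\<in>F. norm (q * a - a * q) \<le> \<tau>) \<Longrightarrow>
    norm (q * 1) \<le> C * (norm (q * k) + \<tau>)"
    using twosided_commute_bound[OF one_in_twosided[OF simple k0]] by blast
  \<comment> \<open>By \<open>1 \<le> C * (norm (q * k) + \<tau>)\<close>, this \<kappa> is a lower
    bound for \<open>norm (q * k)\<close> once \<open>\<tau> \<le> \<kappa>\<close>. The other bound
    on \<tau> makes the commutator errors at most \<open>e / 4\<close> times that norm.\<close>
  define \<kappa> where "\<kappa> = 1 / (2 * (C + 1))"
  define \<tau> where "\<tau> = min \<kappa> (\<kappa> * e / 8)"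
  have kt: "\<kappa> > 0" "\<tau> > 0" "\<tau> \<le> \<kappa>" "\<tau> \<le> \<kappa> * e / 8" using FC(2) e by (auto simp: \<kappa>_def \<tau>_def)
  have "norm (q * x * q) > 1 - e"
    if q: "proj q" "q \<noteq> 0" "\<forall>a\<in>insert k F. norm (q * a - a * q) \<le> \<tau>" for q
  proof -
    have qq: "q * q = q" "adj q = q" using q(1) by (auto simp: projection_el_def)
    have n1: "norm q = 1" by (rule proj_norm_nonzero[OF q(1,2)])
    have qk: "norm (q * k) \<ge> \<kappa>"
    proof (rule ccontr)
      assume "\<not> ?thesis"
      then have "norm (q * k) + \<tau> < 2 * \<kappa>" using kt by simp
      then have "(C + 1) * (norm (q * k) + \<tau>) < (C + 1) * (2 * \<kappa>)" using FC(2) by (intro mult_strict_left_mono) auto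
      also have "\<dots> = 1" using FC(2) by (simp add: \<kappa>_def)
      also have "1 \<le> C * (norm (q * k) + \<tau>)" using FC(3)[of q \<tau>] n1 q(3) kt by simp
      finally have "norm (q * k) + \<tau> < 0" by (simp only: distrib_right mult_1_left add_less_same_cancel1)
      then show False using kt(2) norm_ge_zero[of "q * k"] by linarith
    qed
    have ck: "norm (q * k - k * q) \<le> \<tau>" using q(3) by simp
    have nkq: "norm (k * q) = norm (q * k)" using norm_adj[of "q * k"] by (simp add: adj_mult k qq)
    \<comment> \<open>Since \<open>x\<close> acts on \<open>k\<close> as \<open>1 - g\<close>, the
      compression \<open>q * x * q\<close> nearly fixes \<open>q * k\<close>; dividing by
      \<open>norm (q * k)\<close> at the end gives the bound.\<close>
    have "q * k = (q * x * q) * (q * k) + (q * (q * k - k * q) + (q * g * (k * q) - (q * x) * (q * k - k * q)))"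
    proof -
      have "(q * x * q) * (q * k) = q * x * (q * q) * k" by (simp add: mult.assoc)
      also have "\<dots> = q * x * (q * k - k * q) + q * (x * k) * q" by (simp add: qq algebra_simps)
      also have "\<dots> = q * x * (q * k - k * q) + q * k * q - q * g * (k * q)" unfolding xk by (simp add: algebra_simps)
      finally have 1: "(q * x * q) * (q * k) = q * x * (q * k - k * q) + q * k * q - q * g * (k * q)" .
      have "q * (q * k - k * q) = (q * q) * k - q * k * q" by (simp add: algebra_simps)
      then have 2: "q * (q * k - k * q) = q * k - q * k * q" by (simp add: qq)
      show ?thesis unfolding 1 2 by simp
    qed
    then have "norm (q * k) \<le> norm ((q * x * q) * (q * k)) + (norm (q * (q * k - k * q)) + (norm (q * g * (k * q)) + norm ((q * x) * (q * k - k * q))))"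
      using norm_triangle_ineq[of "q * x * q * (q * k)" "q * (q * k - k * q) + (q * g * (k * q) - q * x * (q * k - k * q))"]
        norm_triangle_ineq[of "q * (q * k - k * q)" "q * g * (k * q) - q * x * (q * k - k * q)"]
        norm_triangle_ineq4[of "q * g * (k * q)" "q * x * (q * k - k * q)"] by simp
    also have "norm ((q * x * q) * (q * k)) \<le> norm (q * x * q) * norm (q * k)" by (rule norm_mult_ineq)
    also have "norm (q * (q * k - k * q)) \<le> 1 * \<tau>" by (intro norm_mult_le) (use n1 ck in auto)
    also have "norm (q * g * (k * q)) \<le> 1 * (e / 2) * norm (k * q)"
      by (intro norm_mult_le) (use n1 g e in auto)
    also have "norm ((q * x) * (q * k - k * q)) \<le> 1 * 1 * \<tau>"
      by (intro norm_mult_le) (use n1 x ck in auto)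
    finally have "norm (q * k) \<le> norm (q * x * q) * norm (q * k) + (e / 2 * norm (q * k) + 2 * \<tau>)" by (simp add: nkq)
    also have "2 * \<tau> \<le> (e / 4) * norm (q * k)"
    proof -
      have "2 * \<tau> \<le> e / 4 * \<kappa>" using kt(4) by (simp add: mult.commute)
      also have "\<dots> \<le> (e / 4) * norm (q * k)" using qk e by (intro mult_left_mono) auto
      finally show ?thesis .
    qed
    finally have "1 * norm (q * k) \<le> (norm (q * x * q) + e / 2 + e / 4) * norm (q * k)" by (simp add: algebra_simps)
    then have "1 \<le> norm (q * x * q) + e / 2 + e / 4" by (rule mult_right_le_imp_le) (use qk kt(1) in linarith)
    then show ?thesis using e by simp
  qed
  then show ?thesis using FC(1) kt(2) by (intro exI[of _ "insert k F"] exI[of _ \<tau>]) simp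
qed


section \<open>Projections\<close>

lemma proj_idem: "proj p \<Longrightarrow> p * p = p" and proj_sa: "proj p \<Longrightarrow> adj p = p"
  by (auto simp: projection_el_def)

lemma rspec_idempotent_defect:
  assumes "t \<in> rspec a" shows "\<bar>t * t - t\<bar> \<le> norm (a * a - a)"
  using norm_rpe_ge[OF assms, of "[:0, -1, 1:]"] by (simp add: algebra_simps)

lemma proj_cfc:
  assumes a: "adj a = a" and c: "continuous_on UNIV \<phi>" and "\<And>t. t \<in> rspec a \<Longrightarrow> \<phi> t = 0 \<or> \<phi> t = 1"
  shows "proj (cfc a \<phi>)"
proof -
  have "cfc a \<phi> * cfc a \<phi> = cfc a (\<lambda>t. \<phi> t * \<phi> t)" by (rule cfc_mult[OF a c c, symmetric])
  also have "\<dots> = cfc a \<phi>"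
    by (rule cfc_cong[OF a]) (use assms(3) in \<open>auto intro!: continuous_intros c\<close>)
  finally show ?thesis using adj_cfc[OF a c] by (simp add: projection_el_def)
qed

text \<open>Spectral values are within \<open>2 * d\<close> of \<open>0\<close> or \<open>1\<close>,
  because one of \<open>t\<close> and \<open>1 - t\<close> has modulus at least \<open>1/2\<close>.
  For \<open>d < 1/8\<close> the ramp from \<open>1/4\<close> to \<open>3/4\<close> therefore takes
  only the values \<open>0\<close> and \<open>1\<close> on the spectrum. The ramp is divisible by
  \<open>t\<close>, which gives the last clause; that clause later turns almost orthogonality into
  exact orthogonality.\<close>

lemma proj_near_almost_proj:
  assumes a: "adj a = a" and d: "norm (a * a - a) \<le> d" "d < 1/8"
  shows "\<exists>q. proj q \<and> norm (q - a) \<le> 2 * d \<and> (\<forall>r. a * r = 0 \<longrightarrow> q * r = 0)"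
proof -
  let ?f = "\<lambda>t::real. max 0 (min 1 (2 * t - 1/2))" and ?g = "\<lambda>t::real. max 0 (min 1 (2 * t - 1/2)) / max t (1/4)"
  have cf: "continuous_on UNIV ?f" by (intro continuous_intros)
  have cg: "continuous_on UNIV ?g" by (intro continuous_intros) auto
  have ci: "continuous_on UNIV (\<lambda>t::real. t)" by (intro continuous_intros)
  have two: "\<bar>t\<bar> \<le> 2 * d \<or> \<bar>1 - t\<bar> \<le> 2 * d" if "t \<in> rspec a" for t
  proof -
    have "\<bar>t * (1 - t)\<bar> \<le> d" using rspec_idempotent_defect[OF that] d(1) by (simp add: algebra_simps abs_minus_commute)
    then have *: "\<bar>t\<bar> * \<bar>1 - t\<bar> \<le> d" by (simp add: abs_mult)
    show ?thesis
    proof (cases "\<bar>t\<bar> \<le> 1/2")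
      case True
      then have "\<bar>1 - t\<bar> \<ge> 1/2" by linarith
      then have "\<bar>t\<bar> * (1/2) \<le> \<bar>t\<bar> * \<bar>1 - t\<bar>" by (intro mult_left_mono) auto
      from order_trans[OF this *] show ?thesis by simp
    next
      case False
      then have "(1/2) * \<bar>1 - t\<bar> \<le> \<bar>t\<bar> * \<bar>1 - t\<bar>" by (intro mult_right_mono) auto
      from order_trans[OF this *] show ?thesis by simp
    qed
  qed
  let ?q = "cfc a ?f"
  have q: "proj ?q"
  proof (rule proj_cfc[OF a cf])
    fix t assume "t \<in> rspec a"
    from two[OF this] d(2) have "t \<le> 1/4 \<or> 3/4 \<le> t" by linarith
    then show "?f t = 0 \<or> ?f t = 1" by auto
  qed
  have "norm (rpe [:0, 1:] a - ?q) \<le> 2 * d"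
  proof (rule cfc_approx[OF a cf])
    fix t assume "t \<in> rspec a"
    from two[OF this] d(2) have *: "t \<le> 1/4 \<and> \<bar>t\<bar> \<le> 2 * d \<or> 3/4 \<le> t \<and> \<bar>1 - t\<bar> \<le> 2 * d" by linarith
    then show "\<bar>poly [:0, 1:] t - ?f t\<bar> \<le> 2 * d" by (auto simp: max_def min_def)
  qed
  then have n: "norm (?q - a) \<le> 2 * d" by (simp add: norm_minus_commute)
  have "?f = (\<lambda>t. ?g t * t)" by (auto simp: max_def fun_eq_iff)
  then have qg: "?q = cfc a ?g * a" using cfc_mult[OF a cg ci] by (simp add: cfc_ident[OF a])
  have "?q * r = 0" if "a * r = 0" for r using that unfolding qg by (simp add: mult.assoc)
  then show ?thesis using q n by blast
qed

lemma proj_sum: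
  assumes "finite S" "\<And>i. i \<in> S \<Longrightarrow> proj (q i)"
    "\<And>i j. i \<in> S \<Longrightarrow> j \<in> S \<Longrightarrow> i \<noteq> j \<Longrightarrow> q i * q j = 0"
  shows "proj (sum q S)" and "i \<in> S \<Longrightarrow> sum q S * q i = q i" and "i \<in> S \<Longrightarrow> q i * sum q S = q i"
proof -
  have r: "sum q S * q i = q i" if i: "i \<in> S" for i
  proof -
    have "sum q S * q i = (\<Sum>j\<in>S. if j = i then q i else 0)"
      unfolding sum_distrib_right by (intro sum.cong refl) (use i assms in \<open>auto simp: projection_el_def\<close>)
    then show ?thesis using i assms(1) by simp
  qed
  have sa: "adj (sum q S) = sum q S" unfolding adj_sum by (intro sum.cong refl) (use assms(2) in \<open>auto simp: projection_el_def\<close>)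
  have "sum q S * sum q S = (\<Sum>i\<in>S. sum q S * q i)" by (rule sum_distrib_left)
  also have "\<dots> = sum q S" by (intro sum.cong refl r)
  finally show "proj (sum q S)" using sa by (simp add: projection_el_def)
  show "i \<in> S \<Longrightarrow> sum q S * q i = q i" by (rule r)
  assume i: "i \<in> S"
  have "adj (sum q S * q i) = adj (q i)" using r[OF i] by simp
  then show "q i * sum q S = q i" using sa proj_sa[OF assms(2)[OF i]] by (simp add: adj_mult)
qed

text \<open>The new projection is compressed to the complement of those already treated and then
  rounded; rounding keeps what the compression annihilates, so the result is exactly orthogonal.
  \<delta> depends on the index set and \<nu> only and can be fixed in advance.\<close>

lemma orthogonalize_projs:
  assumes "finite S" "\<nu> > 0"
  shows "\<exists>\<delta>>0. \<forall>p. (\<forall>i\<in>S. proj (p i)) \<and> (\<forall>i\<in>S. \<forall>j\<in>S. i \<noteq> j \<longrightarrow> norm (p i * p j) \<le> \<delta>) \<longrightarrow>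
    (\<exists>q. (\<forall>i\<in>S. proj (q i)) \<and> (\<forall>i\<in>S. \<forall>j\<in>S. i \<noteq> j \<longrightarrow> q i * q j = 0) \<and> (\<forall>i\<in>S. norm (q i - p i) \<le> \<nu>))"
  using assms
proof (induction S arbitrary: \<nu>)
  case empty
  show ?case by (intro exI[of _ 1]) simp
next
  case (insert j S)
  define n where "n = real (card S) + 1"
  have n: "n > 0" by (simp add: n_def add_nonneg_pos)
  \<comment> \<open>Compression and rounding each move the projection by at most
    \<open>2 * c\<close>, whence \<open>\<nu> / 4\<close>; the entry \<open>1/16\<close> stays below
    the threshold for rounding. The quotients by \<open>2 * n\<close> further on add up to
    \<open>norm (Q * p j) \<le> c\<close>.\<close>
  define c where "c = min (\<nu> / 4) (1 / 16)"
  have c: "c > 0" "c \<le> \<nu> / 4" "c < 1 / 8" using insert.prems by (auto simp: c_def)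
  define \<nu>' where "\<nu>' = min \<nu> (c / (2 * n))"
  have nu': "\<nu>' > 0" "\<nu>' \<le> \<nu>" "\<nu>' \<le> c / (2 * n)" using insert.prems c n by (auto simp: \<nu>'_def)
  from insert.IH[OF nu'(1)] obtain \<delta>' where d': "\<delta>' > 0"
    and IH: "\<forall>p. (\<forall>i\<in>S. proj (p i)) \<and> (\<forall>i\<in>S. \<forall>j\<in>S. i \<noteq> j \<longrightarrow> norm (p i * p j) \<le> \<delta>') \<longrightarrow>
    (\<exists>q. (\<forall>i\<in>S. proj (q i)) \<and> (\<forall>i\<in>S. \<forall>j\<in>S. i \<noteq> j \<longrightarrow> q i * q j = 0) \<and> (\<forall>i\<in>S. norm (q i - p i) \<le> \<nu>'))"
    by (elim exE conjE) (rule that)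
  define \<delta> where "\<delta> = min \<delta>' (c / (2 * n))"
  have d: "\<delta> > 0" "\<delta> \<le> \<delta>'" "\<delta> \<le> c / (2 * n)" using d' c n by (auto simp: \<delta>_def)
  have step: "\<exists>q. (\<forall>i\<in>insert j S. proj (q i)) \<and> (\<forall>i\<in>insert j S. \<forall>k\<in>insert j S. i \<noteq> k \<longrightarrow> q i * q k = 0) \<and>
      (\<forall>i\<in>insert j S. norm (q i - p i) \<le> \<nu>)"
    if p: "\<forall>i\<in>insert j S. proj (p i)" "\<forall>i\<in>insert j S. \<forall>k\<in>insert j S. i \<noteq> k \<longrightarrow> norm (p i * p k) \<le> \<delta>" for p
  proof -
    have "\<forall>i\<in>S. \<forall>k\<in>S. i \<noteq> k \<longrightarrow> norm (p i * p k) \<le> \<delta>'"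
      by (intro ballI impI order_trans[OF p(2)[rule_format] d(2)]) auto
    moreover have "\<forall>i\<in>S. proj (p i)" using p(1) by simp
    ultimately have "(\<forall>i\<in>S. proj (p i)) \<and> (\<forall>i\<in>S. \<forall>k\<in>S. i \<noteq> k \<longrightarrow> norm (p i * p k) \<le> \<delta>')" by (rule conjI[rotated])
    from IH[THEN spec, THEN mp, OF this]
    obtain q where q0: "(\<forall>i\<in>S. proj (q i)) \<and> (\<forall>i\<in>S. \<forall>j\<in>S. i \<noteq> j \<longrightarrow> q i * q j = 0) \<and> (\<forall>i\<in>S. norm (q i - p i) \<le> \<nu>')"
      by (rule exE)
    then have q: "\<And>i. i \<in> S \<Longrightarrow> proj (q i)" "\<And>i k. i \<in> S \<Longrightarrow> k \<in> S \<Longrightarrow> i \<noteq> k \<Longrightarrow> q i * q k = 0"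
      "\<And>i. i \<in> S \<Longrightarrow> norm (q i - p i) \<le> \<nu>'" by simp_all
    define Q where "Q = sum q S"
    have Q: "proj Q" "\<And>i. i \<in> S \<Longrightarrow> Q * q i = q i" unfolding Q_def using proj_sum[where q = q, OF insert.hyps(1) q(1,2)] by simp_all
    have Qs: "adj Q = Q" "Q * Q = Q" using Q(1) by (auto simp: projection_el_def)
    have pj: "adj (p j) = p j" "p j * p j = p j" "norm (p j) \<le> 1" using p(1) proj_norm by (auto simp: projection_el_def)
    have "norm (Q * p j) \<le> (\<Sum>i\<in>S. norm (q i * p j))"
      unfolding Q_def sum_distrib_right by (rule norm_sum)
    also have "\<dots> \<le> (\<Sum>i\<in>S. \<nu>' + \<delta>)"
    proof (rule sum_mono)
      fix i assume i: "i \<in> S"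
      then have "i \<noteq> j" using insert.hyps by auto
      then have "norm (p i * p j) \<le> \<delta>" using p(2) i by auto
      moreover have "norm ((q i - p i) * p j) \<le> \<nu>' * 1"
        by (intro norm_mult_le) (use q(3)[OF i] pj nu' in auto)
      moreover have "q i * p j = (q i - p i) * p j + p i * p j" by (simp add: algebra_simps)
      ultimately show "norm (q i * p j) \<le> \<nu>' + \<delta>" using norm_triangle_ineq[of "(q i - p i) * p j" "p i * p j"] by simp
    qed
    also have "\<dots> = real (card S) * (\<nu>' + \<delta>)" by simp
    also have "\<dots> \<le> n * (c / (2 * n) + c / (2 * n))"
      using nu' d n by (intro mult_mono add_mono) (auto simp: n_def)
    also have "\<dots> = c" using n by simp
    finally have Qp: "norm (Q * p j) \<le> c" .
    then have pQ: "norm (p j * Q) \<le> c" using norm_adj[of "Q * p j"] by (simp add: adj_mult Qs pj)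
    define a where "a = (1 - Q) * p j * (1 - Q)"
    have a: "adj a = a" by (simp add: a_def adj_mult adj_diff Qs pj mult.assoc)
    have nQ: "norm (1 - Q) \<le> 1" using proj_norm[OF proj_one_minus[OF Q(1)]] .
    have QQ: "(1 - Q) * (1 - Q) = 1 - Q" using Qs by (simp add: algebra_simps)
    have "a * a - a = - ((1 - Q) * p j * (Q * p j) * (1 - Q))"
    proof -
      have "a * a = (1 - Q) * p j * ((1 - Q) * (1 - Q)) * p j * (1 - Q)" by (simp add: a_def mult.assoc)
      also have "\<dots> = (1 - Q) * (p j * p j) * (1 - Q) - (1 - Q) * p j * (Q * p j) * (1 - Q)"
        unfolding QQ by (simp add: algebra_simps)
      finally show ?thesis by (simp add: pj a_def)
    qed
    also have "norm \<dots> \<le> 1 * 1 * c * 1" unfolding norm_minus_cancel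
      by (intro norm_mult_le) (use nQ pj Qp in auto)
    finally have aa: "norm (a * a - a) \<le> c" by simp
    obtain r where r: "proj r" "norm (r - a) \<le> 2 * c" "\<And>x. a * x = 0 \<Longrightarrow> r * x = 0"
      using proj_near_almost_proj[OF a aa c(3)] by blast
    have "p j - a = Q * p j + (1 - Q) * (p j * Q)" by (simp add: a_def algebra_simps)
    also have "norm \<dots> \<le> c + 1 * c"
      by (rule norm_triangle_mono[OF Qp], rule norm_mult_le) (use nQ pQ c in auto)
    finally have "norm (a - p j) \<le> 2 * c" by (simp add: norm_minus_commute)
    then have rp: "norm (r - p j) \<le> \<nu>" using norm_triangle_mono[OF r(2)] c(2) by fastforce
    have rq: "r * q i = 0" if i: "i \<in> S" for i
    proof (rule r(3))
      have "(1 - Q) * q i = 0" using Q(2)[OF i] by (simp add: algebra_simps)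
      then show "a * q i = 0" by (simp add: a_def mult.assoc)
    qed
    have qr: "q i * r = 0" if i: "i \<in> S" for i
      using rq[OF i] proj_sa[OF r(1)] proj_sa[OF q(1)[OF i]] by (metis adj_mult adj_zero)
    show ?thesis
    proof (intro exI[of _ "q(j := r)"] conjI ballI impI)
      fix i assume i: "i \<in> insert j S"
      show "proj ((q(j := r)) i)" using i q(1) r(1) by auto
      show "norm ((q(j := r)) i - p i) \<le> \<nu>" using i order_trans[OF q(3) nu'(2)] rp by auto
    next
      fix i k assume "i \<in> insert j S" "k \<in> insert j S" "i \<noteq> k"
      then show "(q(j := r)) i * (q(j := r)) k = 0" using q(2) rq qr by auto
    qed
  qed
  show ?case by (rule exI[of _ \<delta>], rule conjI, rule d(1), intro allI impI, erule conjE, rule step)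
qed

section \<open>Norms of sums of orthogonal elements\<close>

lemma orthogonal_sum_power:
  assumes fin: "finite S" and orth: "\<And>i j. i \<in> S \<Longrightarrow> j \<in> S \<Longrightarrow> i \<noteq> j \<Longrightarrow> y i * y j = (0::'a)"
  shows "sum y S ^ Suc m = (\<Sum>i\<in>S. y i ^ Suc m)"
proof (induction m)
  case (Suc m)
  have "sum y S ^ Suc (Suc m) = (\<Sum>i\<in>S. \<Sum>j\<in>S. y i * y j ^ Suc m)"
    using Suc by (simp only: power_Suc[of _ "Suc m"] sum_product)
  also have "\<dots> = (\<Sum>i\<in>S. \<Sum>j\<in>S. if j = i then y i ^ Suc (Suc m) else 0)"
  proof (intro sum.cong refl)
    fix i j assume "i \<in> S" "j \<in> S"
    then show "y i * y j ^ Suc m = (if j = i then y i ^ Suc (Suc m) else 0)"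
      using orth[of i j] by (auto simp: mult.assoc[symmetric])
  qed
  also have "\<dots> = (\<Sum>i\<in>S. y i ^ Suc (Suc m))" using fin by simp
  finally show ?case .
qed simp

text \<open>Orthogonality makes powers additive, so the power \<open>2 ^ N\<close> of the norm is at
  most \<open>card S\<close> times that of \<open>K\<close>. For large \<open>N\<close> the factor
  \<open>card S\<close> is beaten by exponential growth.\<close>

lemma norm_orthogonal_sum_le:
  assumes fin: "finite S" and sa: "\<And>i. i \<in> S \<Longrightarrow> adj (y i) = y i"
    and orth: "\<And>i j. i \<in> S \<Longrightarrow> j \<in> S \<Longrightarrow> i \<noteq> j \<Longrightarrow> y i * y j = 0"
    and K: "\<And>i. i \<in> S \<Longrightarrow> norm (y i) \<le> K" "0 < K"
  shows "norm (sum y S) \<le> K"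
proof (rule ccontr)
  assume neg: "\<not> ?thesis"
  define r where "r = norm (sum y S) / K"
  have r: "r > 1" using neg K(2) by (simp add: r_def field_simps)
  obtain N where N: "real (card S) < r ^ N" using real_arch_pow[OF r] by blast
  have "N \<le> 2 ^ N" by (simp add: less_imp_le)
  then have "r ^ N \<le> r ^ 2 ^ N" using r by (intro power_increasing) auto
  have sas: "adj (sum y S) = sum y S" unfolding adj_sum by (intro sum.cong refl sa)
  obtain m where m: "(2::nat) ^ N = Suc m" by (metis not0_implies_Suc power_eq_0_iff zero_neq_numeral)
  have "norm (sum y S) ^ 2 ^ N = norm (sum y S ^ 2 ^ N)" by (rule norm_sa_power2[OF sas, symmetric])
  also have "sum y S ^ 2 ^ N = (\<Sum>i\<in>S. y i ^ 2 ^ N)" unfolding m by (rule orthogonal_sum_power[OF fin orth])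
  also have "norm \<dots> \<le> (\<Sum>i\<in>S. K ^ 2 ^ N)"
    by (intro order_trans[OF norm_sum] sum_mono order_trans[OF norm_power_ineq] power_mono K) simp_all
  also have "\<dots> = real (card S) * K ^ 2 ^ N" by simp
  finally have "r ^ 2 ^ N \<le> real (card S)" using K(2) by (simp add: r_def power_divide field_simps)
  then show False using N \<open>r ^ N \<le> r ^ 2 ^ N\<close> by linarith
qed

lemma orthogonal_sum_norm_attained:
  assumes fin: "finite S" and sa: "\<And>i. i \<in> S \<Longrightarrow> adj (y i) = y i"
    and orth: "\<And>i j. i \<in> S \<Longrightarrow> j \<in> S \<Longrightarrow> i \<noteq> j \<Longrightarrow> y i * y j = 0"
    and K: "K < norm (sum y S)" "0 < K"
  shows "\<exists>i\<in>S. K < norm (y i)"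
  using norm_orthogonal_sum_le[of S y K, OF fin sa orth _ K(2)] K(1) by (meson not_le)

section \<open>Spectral projections of invertible elements\<close>

text \<open>As long as \<open>\<bar>t\<bar> * M < 1/2\<close>, \<open>w\<close> is still an
  approximate inverse of \<open>y - t\<close> on both sides: the two errors together stay below
  one.\<close>

lemma rspec_gap:
  assumes "norm (y * w - 1) \<le> 1/2" "norm (w * y - 1) \<le> 1/2" "norm w \<le> M" "0 < M" "t \<in> rspec y"
  shows "1 / (2 * M) \<le> \<bar>t\<bar>"
proof (rule ccontr)
  assume "\<not> ?thesis"
  then have t: "\<bar>t\<bar> * M < 1/2" using assms(4) by (simp add: field_simps)
  have "\<bar>t\<bar> * norm w \<le> \<bar>t\<bar> * M" using assms(3) by (intro mult_left_mono) auto
  then have tw: "\<bar>t\<bar> * norm w < 1/2" using t by linarith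
  have "norm (1 - w * (y - t *\<^sub>R 1)) \<le> norm (w * y - 1) + \<bar>t\<bar> * norm w"
    using norm_triangle_ineq4[of "t *\<^sub>R w" "w * y - 1"] by (simp add: algebra_simps)
  then have 1: "invertible_el (w * (y - t *\<^sub>R 1))" using tw assms(2) by (intro invertible_el_near_one) linarith
  have "norm (1 - (y - t *\<^sub>R 1) * w) \<le> norm (y * w - 1) + \<bar>t\<bar> * norm w"
    using norm_triangle_ineq4[of "t *\<^sub>R w" "y * w - 1"] by (simp add: algebra_simps)
  then have 2: "invertible_el ((y - t *\<^sub>R 1) * w)" using tw assms(1) by (intro invertible_el_near_one) linarith
  from invertible_el_lr'[OF 1 2] show False using assms(5) by (simp add: rspec_iff)
qed

text \<open>A ramp from \<open>0\<close> at \<open>- 1 / (2 * M)\<close> to \<open>1\<close> at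
  \<open>1 / (2 * M)\<close>. On a spectrum that avoids the open interval between these points it is
  the indicator function of the positive half-line.\<close>

definition jump :: "real \<Rightarrow> real \<Rightarrow> real" where
  "jump M t = max 0 (min 1 (1/2 + M * t))"

lemma continuous_jump: "continuous_on UNIV (jump M)"
  unfolding jump_def by (intro continuous_intros)

lemma jump_gap: assumes "0 < M" "1 / (2 * M) \<le> \<bar>t\<bar>" shows "t < 0 \<and> jump M t = 0 \<or> 0 < t \<and> jump M t = 1"
proof -
  have "1 \<le> 2 * (M * \<bar>t\<bar>)" using assms by (simp add: field_simps)
  moreover from this have "t \<noteq> 0" by auto
  ultimately show ?thesis using assms by (cases "t \<ge> 0") (auto simp: jump_def max_def min_def)
qed

text \<open>\<open>p\<close> is the spectral projection of \<open>d\<close> for values above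
  \<open>s\<close>. All four conclusions are free of \<open>M\<close>. The hypothesis
  \<open>low\<close> bounds \<open>d\<close> from below by \<open>- \<eta>\<close>, which with
  \<open>\<eta> \<le> s\<close> keeps \<open>d\<close> between \<open>- s\<close> and
  \<open>s\<close> on the complement of \<open>p\<close>.\<close>

lemma spectral_proj:
  assumes y: "adj y = y" and gap: "\<And>t. t \<in> rspec y \<Longrightarrow> 1 / (2 * M) \<le> \<bar>t\<bar>" "0 < M"
    and s: "0 < s" and low: "pos (y + (s + \<eta>) *\<^sub>R 1)" and eta: "\<eta> \<le> s"
  defines "p \<equiv> cfc y (jump M)" and "d \<equiv> y + s *\<^sub>R 1"
  shows "proj p" "\<exists>u. norm u \<le> 1 / s \<and> p = u * d" "norm ((1 - p) * d) \<le> s" "pos (p * d * p - s *\<^sub>R p)"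
proof -
  note cj = continuous_jump[of M]
  note jg = jump_gap[OF gap(2) gap(1)]
  have ci: "continuous_on UNIV (\<lambda>t::real. t)" and ci': "continuous_on UNIV (\<lambda>t. t + s)" by (intro continuous_intros)+
  show p: "proj p" unfolding p_def by (rule proj_cfc[OF y cj]) (use jg in blast)
  have d: "d = cfc y (\<lambda>t. t + s)"
    unfolding d_def using cfc_add[OF y ci continuous_on_const, of s] by (simp add: cfc_ident[OF y] cfc_const[OF y])
  \<comment> \<open>On the part of the spectrum seen by \<open>p\<close> this is
    \<open>1 / (t + s)\<close>; the maximum keeps the denominator at least \<open>s\<close> on the
    whole line.\<close>
  let ?u = "\<lambda>t. jump M t / (max t 0 + s)"
  have cu: "continuous_on UNIV ?u" by (intro continuous_intros cj) (use s in \<open>auto simp: max_def\<close>)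
  have "p = cfc y (\<lambda>t. ?u t * (t + s))" unfolding p_def
  proof (rule cfc_cong[OF y cj])
    show "continuous_on UNIV (\<lambda>t. ?u t * (t + s))" by (intro continuous_on_mult cu ci')
    fix t assume "t \<in> rspec y"
    from jg[OF this] show "jump M t = ?u t * (t + s)" using s by auto
  qed
  also have "\<dots> = cfc y ?u * d" unfolding d by (rule cfc_mult[OF y cu ci'])
  finally have "p = cfc y ?u * d" .
  moreover have "norm (cfc y ?u) \<le> 1 / s"
  proof (rule norm_cfc_le[OF y cu])
    fix t assume "t \<in> rspec y"
    from jg[OF this] show "\<bar>?u t\<bar> \<le> 1 / s" using s by (auto simp: divide_simps)
  qed
  ultimately show "\<exists>u. norm u \<le> 1 / s \<and> p = u * d" by blast
  have c1: "continuous_on UNIV (\<lambda>t. 1 + (-1) * jump M t)" by (intro continuous_intros cj)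
  have "1 - p = cfc y (\<lambda>t. 1) + cfc y (\<lambda>t. -1) * cfc y (jump M)" by (simp add: p_def cfc_const[OF y])
  also have "\<dots> = cfc y (\<lambda>t. 1 + (-1) * jump M t)"
    unfolding cfc_mult[OF y continuous_on_const cj, symmetric]
    by (rule cfc_add[OF y, symmetric]) (intro continuous_intros cj)+
  finally have "(1 - p) * d = cfc y (\<lambda>t. (1 + (-1) * jump M t) * (t + s))"
    unfolding d cfc_mult[OF y c1 ci'] by simp
  also have "norm \<dots> \<le> s"
  proof (rule norm_cfc_le[OF y])
    show "continuous_on UNIV (\<lambda>t. (1 + (-1) * jump M t) * (t + s))" by (intro continuous_intros cj)
    fix t assume t: "t \<in> rspec y"
    have "complex_of_real (t + (s + \<eta>)) \<in> spec (y + (s + \<eta>) *\<^sub>R 1)"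
      using t by (simp only: spec_shift_real rspec_def of_real_diff[symmetric]) simp
    then have "0 \<le> t + (s + \<eta>)" using low by (simp add: pos_iff rspec_def)
    then show "\<bar>(1 + (-1) * jump M t) * (t + s)\<bar> \<le> s" using jg[OF t] s eta by auto
  qed
  finally show "norm ((1 - p) * d) \<le> s" .
  have cpp: "continuous_on UNIV (\<lambda>t. jump M t * t)" by (intro continuous_intros cj)
  have "pos (cfc y (\<lambda>t. jump M t * t * jump M t))"
  proof (rule pos_cfc[OF y])
    show "continuous_on UNIV (\<lambda>t. jump M t * t * jump M t)" by (intro continuous_intros cj)
    fix t assume "t \<in> rspec y"
    from jg[OF this] show "0 \<le> jump M t * t * jump M t" by auto
  qed
  also have "cfc y (\<lambda>t. jump M t * t * jump M t) = p * y * p"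
    unfolding p_def cfc_mult[OF y cpp cj] cfc_mult[OF y cj ci] cfc_ident[OF y] ..
  also have "p * y * p = p * d * p - s *\<^sub>R p"
    using proj_idem[OF p] by (simp add: d_def algebra_simps)
  finally show "pos (p * d * p - s *\<^sub>R p)" .
qed

text \<open>The commutator with \<open>b\<close> is a derivation, so the bound propagates along
  Horner's scheme with a constant that depends on the polynomial and on \<open>M\<close>
  only.\<close>

lemma rpe_commutator_bound:
  assumes "0 \<le> M"
  shows "\<exists>C\<ge>0. \<forall>y b. norm y \<le> M \<longrightarrow> norm (rpe p y) \<le> C \<and>
    norm (rpe p y * b - b * rpe p y) \<le> C * norm (y * b - b * y)"
proof (induction p)
  case 0
  show ?case by (intro exI[of _ 0]) simp
next
  case (pCons c p)
  then obtain C where C: "C \<ge> 0" "\<And>y b. norm y \<le> M \<Longrightarrow> norm (rpe p y) \<le> C"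
    "\<And>y b. norm y \<le> M \<Longrightarrow> norm (rpe p y * b - b * rpe p y) \<le> C * norm (y * b - b * y)" by blast
  define D where "D = \<bar>c\<bar> + M * C + C"
  have "norm (rpe (pCons c p) y) \<le> D" if "norm y \<le> M" for y
  proof -
    have "norm (rpe (pCons c p) y) \<le> norm (c *\<^sub>R (1::'a)) + M * C"
      unfolding rpe_pCons
      by (intro norm_triangle_mono order_refl norm_mult_le) (use that C assms in auto)
    then show ?thesis using C(1) by (simp add: D_def)
  qed
  moreover have "norm (rpe (pCons c p) y * b - b * rpe (pCons c p) y) \<le> D * norm (y * b - b * y)" if "norm y \<le> M" for y b
  proof -
    have "rpe (pCons c p) y * b - b * rpe (pCons c p) y = y * (rpe p y * b - b * rpe p y) + (y * b - b * y) * rpe p y"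
      by (simp add: algebra_simps)
    also have "norm \<dots> \<le> M * (C * norm (y * b - b * y)) + norm (y * b - b * y) * C"
      by (intro norm_triangle_mono norm_mult_le) (use that C assms in auto)
    also have "\<dots> \<le> D * norm (y * b - b * y)" by (simp add: D_def algebra_simps)
    finally show ?thesis .
  qed
  moreover have "D \<ge> 0" using C(1) assms by (simp add: D_def)
  ultimately show ?case by blast
qed

text \<open>One polynomial approximates \<phi> on the whole interval of radius \<open>M\<close>, so
  \<tau> is uniform in \<open>y\<close> and \<open>b\<close>. The function can thus be fixed before
  the element is picked.\<close>

lemma cfc_almost_commute:
  assumes c: "continuous_on UNIV \<phi>" and "0 \<le> M" "0 \<le> K" "0 < e"
  shows "\<exists>\<tau>>0. \<forall>y b. adj y = y \<longrightarrow> norm y \<le> M \<longrightarrow> norm b \<le> K \<longrightarrow> norm (y * b - b * y) \<le> \<tau> \<longrightarrow>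
    norm (cfc y \<phi> * b - b * cfc y \<phi>) \<le> e"
proof -
  define d where "d = e / 4 / (K + 1)"
  have d: "d > 0" using assms by (simp add: d_def)
  obtain p where p: "\<And>t. \<bar>t\<bar> \<le> M \<Longrightarrow> \<bar>poly p t - \<phi> t\<bar> < d" using real_poly_approx[OF c d] by blast
  obtain C where C: "C \<ge> 0" "\<And>y b. norm y \<le> M \<Longrightarrow> norm (rpe p y * b - b * rpe p y) \<le> C * norm (y * b - b * y)"
    using rpe_commutator_bound[OF assms(2), of p] by blast
  define \<tau> where "\<tau> = e / (2 * (C + 1))"
  have t: "\<tau> > 0" using assms C by (simp add: \<tau>_def)
  have "norm (cfc y \<phi> * b - b * cfc y \<phi>) \<le> e"
    if y: "adj y = y" "norm y \<le> M" "norm b \<le> K" "norm (y * b - b * y) \<le> \<tau>" for y b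
  proof -
    have "norm (rpe p y - cfc y \<phi>) \<le> d"
      by (rule cfc_approx[OF y(1) c]) (meson p rspec_norm_le y(2) order_trans less_imp_le)
    note pd = this
    have "cfc y \<phi> * b - b * cfc y \<phi> = (rpe p y * b - b * rpe p y) + (b * (rpe p y - cfc y \<phi>) - (rpe p y - cfc y \<phi>) * b)"
      by (simp add: algebra_simps)
    also have "norm \<dots> \<le> C * \<tau> + (K * d + d * K)"
    proof (intro norm_triangle_mono)
      show "norm (rpe p y * b - b * rpe p y) \<le> C * \<tau>"
        using C(2)[OF y(2), of b] mult_left_mono[OF y(4) C(1)] by linarith
      show "norm (b * (rpe p y - cfc y \<phi>) - (rpe p y - cfc y \<phi>) * b) \<le> K * d + d * K"
        by (intro norm_diff_mono norm_mult_le) (use pd y d assms in auto)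
    qed
    also have "C * \<tau> \<le> e / 2" using C(1) assms(4) by (simp add: \<tau>_def field_simps)
    also have "K * d + d * K \<le> e / 2"
    proof -
      have "x * (e / 4 / x) = e / 4" if "x \<noteq> 0" for x using that by simp
      from this[of "K + 1"] have "(K + 1) * d = e / 4" using assms(3) by (simp only: d_def)
      then show ?thesis using d by (simp add: algebra_simps)
    qed
    finally show ?thesis by simp
  qed
  then show ?thesis using t by blast
qed

end

section \<open>Limits along free ultrafilters\<close>

text \<open>Compactness yields a cluster point. Along an ultrafilter a neighbourhood is either
  eventually entered or eventually avoided, so the cluster point is a limit.\<close>

lemma ultrafilter_bounded_tendsto:
  fixes X :: "nat \<Rightarrow> real"
  assumes u: "free_ultrafilter \<omega>" and b: "bounded (range X)"
  obtains l where "(X \<longlongrightarrow> l) \<omega>"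
proof -
  let ?F = "filtermap X \<omega>"
  have nb: "?F \<noteq> bot" using u by (simp add: free_ultrafilter_def filtermap_bot_iff)
  have "compact (closure (range X))" using b by (simp add: compact_closure)
  moreover have "eventually (\<lambda>x. x \<in> closure (range X)) ?F"
    unfolding eventually_filtermap by (intro always_eventually allI closure_subset[THEN subsetD] rangeI)
  ultimately obtain l where l: "inf (nhds l) ?F \<noteq> bot" using nb unfolding compact_filter by blast
  have "(X \<longlongrightarrow> l) \<omega>"
  proof (rule topological_tendstoI)
    fix S assume S: "open S" "l \<in> S"
    show "eventually (\<lambda>n. X n \<in> S) \<omega>"
    proof (rule ccontr)
      assume "\<not> ?thesis"
      then have "eventually (\<lambda>n. \<not> X n \<in> S) \<omega>" using u unfolding free_ultrafilter_def by blast
      then have "eventually (\<lambda>x. x \<notin> S) ?F" by (simp add: eventually_filtermap)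
      moreover have "eventually (\<lambda>x. x \<in> S) (nhds l)" using S by (simp add: eventually_nhds) blast
      ultimately have "eventually (\<lambda>x. False) (inf (nhds l) ?F)"
        unfolding eventually_inf by (intro exI[of _ "\<lambda>x. x \<in> S"] exI[of _ "\<lambda>x. x \<notin> S"]) simp
      then show False using l by (simp add: eventually_False)
    qed
  qed
  then show thesis by (rule that)
qed

text \<open>\<open>unorm\<close> is defined through \<open>Lim\<close>, which carries information
  only if the limit exists; boundedness of the representing sequence guarantees that.\<close>

lemma unorm_tendsto:
  fixes X :: "nat \<Rightarrow> 'a::real_normed_vector"
  assumes u: "free_ultrafilter \<omega>" and b: "bounded (range X)"
  shows "((\<lambda>n. norm (X n)) \<longlongrightarrow> unorm \<omega> X) \<omega>"
proof -
  have "bounded (range (\<lambda>n. norm (X n)))" using b unfolding bounded_iff by auto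
  then obtain l where l: "((\<lambda>n. norm (X n)) \<longlongrightarrow> l) \<omega>" using ultrafilter_bounded_tendsto[OF u] by blast
  have "\<omega> \<noteq> bot" using u by (simp add: free_ultrafilter_def)
  then have "unorm \<omega> X = l" unfolding unorm_def using l by (intro tendsto_Lim) auto
  then show ?thesis using l by simp
qed

lemma unorm_less_eventually:
  fixes X :: "nat \<Rightarrow> 'a::real_normed_vector"
  assumes "free_ultrafilter \<omega>" "bounded (range X)" "unorm \<omega> X < e"
  shows "eventually (\<lambda>n. norm (X n) < e) \<omega>"
  using order_tendstoD(2)[OF unorm_tendsto[OF assms(1,2)] assms(3)] .

lemma unorm_eq_0I:
  fixes X :: "nat \<Rightarrow> 'a::real_normed_vector"
  assumes "free_ultrafilter \<omega>" "\<And>e. e > 0 \<Longrightarrow> eventually (\<lambda>n. norm (X n) < e) \<omega>"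
  shows "unorm \<omega> X = 0"
proof -
  have "((\<lambda>n. norm (X n)) \<longlongrightarrow> 0) \<omega>"
    by (rule tendstoI) (use assms(2) in \<open>simp add: dist_norm\<close>)
  moreover have "\<omega> \<noteq> bot" using assms(1) by (simp add: free_ultrafilter_def)
  ultimately show ?thesis unfolding unorm_def by (intro tendsto_Lim) auto
qed

text \<open>Freeness excludes single points, hence finite sets.\<close>

lemma free_ultrafilter_eventually_ge:
  assumes u: "free_ultrafilter \<omega>"
  shows "eventually (\<lambda>n. N \<le> n) \<omega>"
proof -
  have "eventually (\<lambda>n. \<not> n = m) \<omega>" for m using u unfolding free_ultrafilter_def by blast
  then have "eventually (\<lambda>n. \<forall>m\<in>{..<N}. \<not> n = m) \<omega>" by (intro eventually_ball_finite) auto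
  then show ?thesis by (rule eventually_mono) (auto simp: not_less[symmetric])
qed

lemma bounded_range_norm_le: "(\<And>n. norm (X n) \<le> K) \<Longrightarrow> bounded (range X)"
  unfolding bounded_iff by auto

context unital_cstar_algebra
begin

text \<open>Passage from the ultrapower back to \<open>A\<close>: the bound on the inverse sequence fixes the gap, and
  hence the function \<open>jump M\<close>, before the index \<open>n\<close> is chosen.\<close>

lemma real_rank_zero_gap:
  assumes u: "free_ultrafilter \<omega>" and rr: "rel_comm_real_rank_zero \<omega> adj B"
    and d: "\<And>n. adj (d n) = d n" "\<And>n. norm (d n) \<le> 1"
    and comm: "\<And>b e. b \<in> B \<Longrightarrow> e > 0 \<Longrightarrow> eventually (\<lambda>n. norm (d n * b - b * d n) < e) \<omega>"
    and eta: "\<eta> > 0" and Fb: "finite Fb" "Fb \<subseteq> B" and e2: "e2 > 0"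
  shows "\<exists>n y M. 0 < M \<and> adj y = y \<and> (\<forall>t\<in>rspec y. 1 / (2 * M) \<le> \<bar>t\<bar>) \<and>
    norm (y + s *\<^sub>R 1 - d n) \<le> \<eta> \<and> (\<forall>b\<in>Fb. norm (cfc y (jump M) * b - b * cfc y (jump M)) \<le> e2)"
proof -
  define X where "X n = d n - s *\<^sub>R 1" for n
  have Xb: "bounded (range X)"
  proof (rule bounded_range_norm_le)
    show "norm (X n) \<le> 1 + \<bar>s\<bar>" for n
      unfolding X_def using norm_triangle_ineq4[of "d n" "s *\<^sub>R 1"] d(2)[of n] by simp
  qed
  have "X n * b - b * X n = d n * b - b * d n" for n b by (simp add: X_def algebra_simps)
  then have "unorm \<omega> (\<lambda>n. X n * b - b * X n) = 0" if "b \<in> B" for b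
    using unorm_eq_0I[OF u comm[OF that]] by simp
  then have rX: "rel_comm_elt \<omega> B X" unfolding rel_comm_elt_def using Xb by blast
  have Xs: "adj (X n) = X n" for n by (simp add: X_def adj_diff adj_scaleR d)
  have "u_self_adjoint \<omega> adj X" unfolding u_self_adjoint_def by (rule unorm_eq_0I[OF u]) (simp add: Xs)
  then obtain Y where Y: "rel_comm_elt \<omega> B Y" "u_self_adjoint \<omega> adj Y" "rel_comm_invertible \<omega> B Y"
    "unorm \<omega> (\<lambda>n. X n - Y n) < \<eta>"
    using rr rX eta unfolding rel_comm_real_rank_zero_def by blast
  obtain W where W: "rel_comm_elt \<omega> B W" "unorm \<omega> (\<lambda>n. Y n * W n - 1) = 0" "unorm \<omega> (\<lambda>n. W n * Y n - 1) = 0"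
    using Y(3) unfolding rel_comm_invertible_def by blast
  have "bounded (range Y)" "bounded (range W)" using Y(1) W(1) unfolding rel_comm_elt_def by blast+
  then obtain M1 M2 where M12: "\<And>n. norm (Y n) \<le> M1" "\<And>n. norm (W n) \<le> M2" unfolding bounded_iff by auto
  define M where "M = max 1 (max M1 M2)"
  have M: "M \<ge> 1" "\<And>n. norm (Y n) \<le> M" "\<And>n. norm (W n) \<le> M"
    using M12 unfolding M_def by (auto simp: le_max_iff_disj)
  define Kb where "Kb = (\<Sum>b\<in>Fb. norm b)"
  have Kb: "Kb \<ge> 0" "\<And>b. b \<in> Fb \<Longrightarrow> norm b \<le> Kb"
    unfolding Kb_def using Fb(1) by (auto intro: sum_nonneg member_le_sum)
  obtain \<tau> where tau: "\<tau> > 0" "\<And>y b. adj y = y \<Longrightarrow> norm y \<le> M \<Longrightarrow> norm b \<le> Kb \<Longrightarrow> norm (y * b - b * y) \<le> \<tau> \<Longrightarrow>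
    norm (cfc y (jump M) * b - b * cfc y (jump M)) \<le> e2"
    using cfc_almost_commute[OF continuous_jump, of M Kb e2 M] M Kb e2 by fastforce
  \<comment> \<open>\<rho> bounds the defect of self-adjointness. Its first entry adds at most
    \<open>1/4\<close> to the error \<open>1/4\<close> of the approximate inverse, which gives the
    \<open>1/2\<close> of \<open>rspec_gap\<close>; the second costs at most
    \<open>\<tau> / 2\<close> in the commutators.\<close>
  define \<rho> where "\<rho> = min (1 / (2 * M)) (\<tau> / (2 * (Kb + 1)))"
  have rho: "\<rho> > 0" "\<rho> \<le> 1 / (2 * M)" "\<rho> \<le> \<tau> / (2 * (Kb + 1))" using M Kb tau by (auto simp: \<rho>_def)
  have rM: "\<rho> * M \<le> 1 / 2" using rho(2) M(1) by (simp add: field_simps)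
  have rK: "\<rho> * Kb \<le> \<tau> / 2"
  proof -
    have "\<rho> * Kb \<le> \<rho> * (Kb + 1)" using rho by simp
    also have "\<dots> \<le> \<tau> / 2" using rho(3) Kb(1) by (simp add: field_simps)
    finally show ?thesis .
  qed
  have bYW: "norm (Y n * W n - 1) \<le> M * M + 1" "norm (W n * Y n - 1) \<le> M * M + 1" for n
    using M norm_triangle_ineq4[of "Y n * W n" 1] norm_triangle_ineq4[of "W n * Y n" 1]
      order_trans[OF norm_mult_ineq mult_mono, of "Y n" M "W n" M] order_trans[OF norm_mult_ineq mult_mono, of "W n" M "Y n" M]
    by (simp_all add: order_trans[OF norm_ge_zero])
  have "eventually (\<lambda>n. norm (X n - Y n) < \<eta>) \<omega>"
    by (rule unorm_less_eventually[OF u _ Y(4)]) (use Xb \<open>bounded (range Y)\<close> in \<open>simp add: bounded_minus_comp\<close>)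
  moreover have "eventually (\<lambda>n. norm (adj (Y n) - Y n) < \<rho>) \<omega>"
  proof (rule unorm_less_eventually[OF u])
    show "bounded (range (\<lambda>n. adj (Y n) - Y n))"
    proof (rule bounded_range_norm_le)
      show "norm (adj (Y n) - Y n) \<le> M + M" for n
        using norm_triangle_ineq4[of "adj (Y n)" "Y n"] M(2)[of n] by simp
    qed
    show "unorm \<omega> (\<lambda>n. adj (Y n) - Y n) < \<rho>" using Y(2) rho by (simp add: u_self_adjoint_def)
  qed
  moreover have "eventually (\<lambda>n. norm (Y n * W n - 1) < 1/4) \<omega>"
    by (rule unorm_less_eventually[OF u bounded_range_norm_le[OF bYW(1)]]) (simp add: W(2))
  moreover have "eventually (\<lambda>n. norm (W n * Y n - 1) < 1/4) \<omega>"
    by (rule unorm_less_eventually[OF u bounded_range_norm_le[OF bYW(2)]]) (simp add: W(3))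
  moreover have "eventually (\<lambda>n. \<forall>b\<in>Fb. norm (Y n * b - b * Y n) < \<tau> / 2) \<omega>"
  proof (rule eventually_ball_finite[OF Fb(1)], intro ballI)
    fix b assume b: "b \<in> Fb"
    show "eventually (\<lambda>n. norm (Y n * b - b * Y n) < \<tau> / 2) \<omega>"
    proof (rule unorm_less_eventually[OF u])
      show "bounded (range (\<lambda>n. Y n * b - b * Y n))"
      proof (rule bounded_range_norm_le)
        show "norm (Y n * b - b * Y n) \<le> M * norm b + norm b * M" for n
          by (rule norm_diff_mono[OF norm_mult_le norm_mult_le])
            (use M in auto)
      qed
      show "unorm \<omega> (\<lambda>n. Y n * b - b * Y n) < \<tau> / 2" using Y(1) b Fb(2) tau unfolding rel_comm_elt_def by auto
    qed
  qed
  ultimately have "eventually (\<lambda>n. norm (X n - Y n) < \<eta> \<and> norm (adj (Y n) - Y n) < \<rho> \<and> norm (Y n * W n - 1) < 1/4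
    \<and> norm (W n * Y n - 1) < 1/4 \<and> (\<forall>b\<in>Fb. norm (Y n * b - b * Y n) < \<tau> / 2)) \<omega>"
    by eventually_elim simp
  moreover have "\<omega> \<noteq> bot" using u by (simp add: free_ultrafilter_def)
  ultimately obtain n where n: "norm (X n - Y n) < \<eta>" "norm (adj (Y n) - Y n) < \<rho>" "norm (Y n * W n - 1) < 1/4"
    "norm (W n * Y n - 1) < 1/4" "\<And>b. b \<in> Fb \<Longrightarrow> norm (Y n * b - b * Y n) < \<tau> / 2"
    using eventually_happens' by blast
  \<comment> \<open>\<open>Y n\<close> is self-adjoint only in the limit, so it is replaced by its
    real part. The distance to \<open>X n\<close> does not grow, because \<open>X n\<close> is
    self-adjoint.\<close>
  define y where "y = (1/2) *\<^sub>R (Y n + adj (Y n))"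
  have y: "adj y = y" by (simp add: y_def adj_scaleR adj_add adj_adj add.commute)
  have "y - Y n = (1/2) *\<^sub>R (adj (Y n) - Y n)"
    by (simp add: y_def algebra_simps flip: scaleR_add_left)
  then have yY: "norm (y - Y n) \<le> \<rho> / 2" using n(2) by simp
  have ny: "norm y \<le> M" using norm_triangle_ineq[of "Y n" "adj (Y n)"] M(2)[of n] by (simp add: y_def)
  have "y + s *\<^sub>R 1 - d n = - ((1/2) *\<^sub>R ((X n - Y n) + adj (X n - Y n)))"
    unfolding adj_diff Xs by (simp add: y_def X_def algebra_simps flip: scaleR_add_left)
  then have "norm (y + s *\<^sub>R 1 - d n) = norm ((X n - Y n) + adj (X n - Y n)) / 2" by simp
  also have "\<dots> \<le> \<eta>" using norm_triangle_ineq[of "X n - Y n" "adj (X n - Y n)"] n(1) by simp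
  finally have c1: "norm (y + s *\<^sub>R 1 - d n) \<le> \<eta>" .
  have c2: "1 / (2 * M) \<le> \<bar>t\<bar>" if "t \<in> rspec y" for t
  proof (rule rspec_gap[OF _ _ M(3) _ that])
    have 1: "norm ((y - Y n) * W n) \<le> \<rho> / 2 * M" "norm (W n * (y - Y n)) \<le> M * (\<rho> / 2)"
      by (rule norm_mult_le; use yY M rho in auto)+
    have "y * W n - 1 = (Y n * W n - 1) + (y - Y n) * W n" by (simp add: algebra_simps)
    then have "norm (y * W n - 1) \<le> norm (Y n * W n - 1) + norm ((y - Y n) * W n)" by (simp only: norm_triangle_ineq)
    then show "norm (y * W n - 1) \<le> 1/2" using 1(1) n(3) rM by simp
    have "W n * y - 1 = (W n * Y n - 1) + W n * (y - Y n)" by (simp add: algebra_simps)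
    then have "norm (W n * y - 1) \<le> norm (W n * Y n - 1) + norm (W n * (y - Y n))" by (simp only: norm_triangle_ineq)
    then show "norm (W n * y - 1) \<le> 1/2" using 1(2) n(4) rM by (simp add: mult.commute)
    show "0 < M" using M by simp
  qed
  have c3: "norm (cfc y (jump M) * b - b * cfc y (jump M)) \<le> e2" if b: "b \<in> Fb" for b
  proof (rule tau(2)[OF y ny Kb(2)[OF b]])
    have "y * b - b * y = (Y n * b - b * Y n) + ((y - Y n) * b - b * (y - Y n))" by (simp add: algebra_simps)
    also have "norm \<dots> \<le> \<tau> / 2 + (\<rho> / 2 * Kb + Kb * (\<rho> / 2))"
      by (rule norm_triangle_mono[OF less_imp_le[OF n(5)[OF b]] norm_diff_mono[OF norm_mult_le norm_mult_le]])
        (use yY Kb b rho in auto)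
    also have "\<dots> \<le> \<tau>" using rK by (simp add: algebra_simps)
    finally show "norm (y * b - b * y) \<le> \<tau>" .
  qed
  show ?thesis using M(1) y c1 c2 c3 by (intro exI[of _ n] exI[of _ y] exI[of _ M]) auto
qed

section \<open>Automorphisms\<close>

lemma star_automorphism_simps:
  assumes "star_automorphism sc adj \<phi>"
  shows "\<phi> (a + b) = \<phi> a + \<phi> b" "\<phi> (a * b) = \<phi> a * \<phi> b" "\<phi> (sc c a) = sc c (\<phi> a)" "\<phi> (adj a) = adj (\<phi> a)"
    "\<phi> 0 = 0" "\<phi> 1 = 1" "\<phi> (- a) = - \<phi> a" "\<phi> (a - b) = \<phi> a - \<phi> b" "\<phi> (r *\<^sub>R a) = r *\<^sub>R \<phi> a"
    "\<phi> a = 0 \<longleftrightarrow> a = 0"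
proof -
  note A = assms[unfolded star_automorphism_def]
  show add: "\<phi> (a + b) = \<phi> a + \<phi> b" for a b using A by blast
  show mult: "\<phi> (a * b) = \<phi> a * \<phi> b" for a b using A by blast
  show s: "\<phi> (sc c a) = sc c (\<phi> a)" for c a using A by blast
  show "\<phi> (adj a) = adj (\<phi> a)" using A by blast
  show z: "\<phi> 0 = 0" using add[of 0 0] by simp
  obtain e where e: "\<phi> e = 1" using A unfolding bij_def surj_def by metis
  show "\<phi> 1 = 1" using mult[of 1 e] e by simp
  show m: "\<phi> (- a) = - \<phi> a" for a using add[of a "-a"] z by (simp add: eq_neg_iff_add_eq_0 add.commute)
  show "\<phi> (a - b) = \<phi> a - \<phi> b" using add[of a "-b"] m by simp
  show "\<phi> (r *\<^sub>R a) = r *\<^sub>R \<phi> a" using s[of "complex_of_real r" a] by (simp add: sc_of_real)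
  show "\<phi> a = 0 \<longleftrightarrow> a = 0" using A z by (metis bij_def injD)
qed

text \<open>Unital homomorphisms do not enlarge spectra, which bounds the norm on self-adjoint
  elements; the C*-identity extends this to all elements.\<close>

lemma star_automorphism_norm_le:
  assumes "star_automorphism sc adj \<phi>"
  shows "norm (\<phi> a) \<le> norm a"
proof -
  note S = star_automorphism_simps[OF assms]
  have sa: "norm (\<phi> b) \<le> norm b" if b: "adj b = b" for b
  proof (rule norm_le_rspec)
    show "adj (\<phi> b) = \<phi> b" using S(4)[of b] b by simp
    fix t assume t: "t \<in> rspec (\<phi> b)"
    have "t \<in> rspec b" unfolding rspec_iff
    proof
      assume "invertible_el (b - t *\<^sub>R 1)"
      then obtain v where v: "(b - t *\<^sub>R 1) * v = 1" "v * (b - t *\<^sub>R 1) = 1" unfolding invertible_el_def by blast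
      have "(\<phi> b - t *\<^sub>R 1) * \<phi> v = 1" "\<phi> v * (\<phi> b - t *\<^sub>R 1) = 1"
        using arg_cong[OF v(1), of \<phi>] arg_cong[OF v(2), of \<phi>] unfolding S by simp_all
      then show False using t unfolding rspec_iff invertible_el_def by blast
    qed
    then show "\<bar>t\<bar> \<le> norm b" by (rule rspec_norm_le)
  qed
  have "(norm (\<phi> a))\<^sup>2 = norm (\<phi> (adj a * a))" by (simp add: S cstar_identity)
  also have "\<dots> \<le> norm (adj a * a)" by (rule sa) (simp add: adj_mult adj_adj)
  also have "\<dots> = (norm a)\<^sup>2" by (rule cstar_identity)
  finally show ?thesis by (rule power2_le_imp_le) simp
qed

lemma star_automorphism_cb:
  assumes "star_automorphism sc adj \<phi>" "a \<preceq> b"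
  shows "\<phi> a \<preceq> \<phi> b"
  unfolding cb_iff
proof (intro allI impI)
  fix e :: real assume "e > 0"
  then obtain v where v: "norm (a - v * b * adj v) < e" using assms(2) unfolding cb_iff by blast
  have "\<phi> a - \<phi> v * \<phi> b * adj (\<phi> v) = \<phi> (a - v * b * adj v)" by (simp add: star_automorphism_simps[OF assms(1)])
  then have "norm (\<phi> a - \<phi> v * \<phi> b * adj (\<phi> v)) < e" using star_automorphism_norm_le[OF assms(1), of "a - v * b * adj v"] v by simp
  then show "\<exists>v. norm (\<phi> a - v * \<phi> b * adj v) < e" by blast
qed

lemma star_automorphism_proj:
  assumes "star_automorphism sc adj \<phi>" "proj p"
  shows "proj (\<phi> p)"
  using assms(2) star_automorphism_simps(2,4)[OF assms(1), of p] unfolding projection_el_def by metis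

section \<open>Spectral projections of compressed towers\<close>

text \<open>Compressed by \<open>p\<close>, the element \<open>d\<close> is at least
  \<open>1 - \<delta> - \<eta>\<close> times \<open>p\<close>. Since \<open>1 - d\<close> is the sum
  of the positive elements \<open>1 - f\<close>, \<open>f - f * f\<close> and
  \<open>f * (1 - c) * f\<close>, the compression of each of them has norm at most
  \<open>\<delta> + \<eta>\<close>.\<close>

lemma tower_projection:
  assumes f: "pos f" "norm f \<le> 1" and c: "pos c" "norm c \<le> 1"
    and y: "adj y = y" and gap: "\<And>t. t \<in> rspec y \<Longrightarrow> 1 / (2 * M) \<le> \<bar>t\<bar>" "0 < M"
    and del: "0 < \<delta>" "\<delta> \<le> 1/4" and eta: "0 < \<eta>" "\<eta> \<le> \<delta>"
    and near: "norm (y + (1 - \<delta>) *\<^sub>R 1 - f * c * f) \<le> \<eta>"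
  defines "p \<equiv> cfc y (jump M)" and "d \<equiv> f * c * f"
  shows "proj p" "\<exists>u. norm u \<le> 2 \<and> norm (p - u * d) \<le> 2 * \<eta>" "norm ((1 - p) * d) \<le> 1 - \<delta> + \<eta>"
    "norm ((1 - c) * p) \<le> 2 * sqrt (\<delta> + \<eta>)" "1 - \<delta> + \<eta> < norm d \<Longrightarrow> p \<noteq> 0"
proof -
  \<comment> \<open>\<open>p\<close> is a function of \<open>y\<close>, so the spectral estimates
    are exact for \<open>d'\<close> and pass to \<open>d\<close> with an error governed by
    \<eta>.\<close>
  define d' where "d' = y + (1 - \<delta>) *\<^sub>R 1"
  have fs: "adj f = f" and cs: "adj c = c" using f c by (simp_all add: pos_sa)
  have d'd: "norm (d' - d) \<le> \<eta>" using near by (simp add: d'_def d_def)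
  have posd: "pos d" using pos_conj'[OF c(1), of f] by (simp add: d_def fs)
  have sd: "adj (d' - d) = d' - d" using y by (simp add: d'_def adj_diff adj_add adj_scaleR pos_sa[OF posd])
  have sd': "adj (d - d') = d - d'" using sd by (metis adj_minus minus_diff_eq)
  have "pos (d + (\<eta> *\<^sub>R 1 - (d - d')))"
    by (intro pos_add posd pos_norm_minus sd') (use d'd in \<open>simp add: norm_minus_commute\<close>)
  also have "d + (\<eta> *\<^sub>R 1 - (d - d')) = y + (1 - \<delta> + \<eta>) *\<^sub>R 1" by (simp add: d'_def algebra_simps)
  finally have low: "pos (y + (1 - \<delta> + \<eta>) *\<^sub>R 1)" .
  have s: "0 < 1 - \<delta>" "\<eta> \<le> 1 - \<delta>" using del eta by auto
  note sp = spectral_proj[OF y gap(1) gap(2) s(1) low s(2), folded p_def d'_def]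
  show p: "proj p" by (rule sp(1)) 
  have ps: "adj p = p" "p * p = p" using p by (auto simp: projection_el_def)
  have np: "norm p \<le> 1" "norm (1 - p) \<le> 1" using proj_norm[OF p] proj_norm[OF proj_one_minus[OF p]] .
  obtain u where u: "norm u \<le> 1 / (1 - \<delta>)" "p = u * d'" using sp(2) by blast
  have "1 / (1 - \<delta>) \<le> 2" using del by (simp add: field_simps)
  then have u2: "norm u \<le> 2" using u(1) by linarith
  have "p - u * d = u * (d' - d)" using u(2) by (simp add: right_diff_distrib)
  then have "norm (p - u * d) \<le> norm u * norm (d' - d)" using norm_mult_ineq[of u "d' - d"] by simp
  also have "\<dots> \<le> 2 * \<eta>" using u2 d'd by (intro mult_mono) auto
  finally show "\<exists>u. norm u \<le> 2 \<and> norm (p - u * d) \<le> 2 * \<eta>" using u2 by blast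
  have "(1 - p) * d = (1 - p) * d' - (1 - p) * (d' - d)" by (simp add: algebra_simps)
  also have "norm \<dots> \<le> (1 - \<delta>) + 1 * \<eta>"
    by (rule norm_diff_mono[OF sp(3) norm_mult_le])
      (use np d'd in auto)
  finally show n1: "norm ((1 - p) * d) \<le> 1 - \<delta> + \<eta>" by simp
  show "1 - \<delta> + \<eta> < norm d \<Longrightarrow> p \<noteq> 0" using n1 by auto
  have "pos (\<eta> *\<^sub>R 1 - (d' - d))" by (rule pos_norm_minus[OF sd d'd])
  from pos_add[OF pos_conj'[OF this, of p] sp(4)]
  have "pos (p * (\<eta> *\<^sub>R 1 - (d' - d)) * p + (p * d' * p - (1 - \<delta>) *\<^sub>R p))" by (simp add: ps)
  also have "p * (\<eta> *\<^sub>R 1 - (d' - d)) * p + (p * d' * p - (1 - \<delta>) *\<^sub>R p) = (\<delta> + \<eta>) *\<^sub>R p - p * (1 - d) * p"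
    by (simp add: algebra_simps ps)
  finally have base: "pos ((\<delta> + \<eta>) *\<^sub>R p - p * (1 - d) * p)" .
  have nb: "norm ((\<delta> + \<eta>) *\<^sub>R p) \<le> \<delta> + \<eta>" using np del eta by (simp add: mult_left_le)
  have pff: "pos (f - f * f)" by (rule norm_square_mono[OF f])
  have p1c: "pos (1 - c)" by (rule pos_one_minus[OF c])
  have p1f: "pos (1 - f)" by (rule pos_one_minus[OF f])
  have pC: "pos (p * (1 - f) * p)" using pos_conj'[OF p1f, of p] by (simp add: ps)
  have pD: "pos (p * (f - f * f) * p)" using pos_conj'[OF pff, of p] by (simp add: ps)
  have pA: "pos (p * (f * (1 - c) * f) * p)" using pos_conj'[OF pos_conj'[OF p1c, of f], of p] by (simp add: ps fs)
  have pB: "pos (p * (1 - f * f) * p)"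
    using pos_add[OF pC pD] by (simp add: algebra_simps)
  have d1: "1 - d = (1 - f * f) + f * (1 - c) * f" by (simp add: d_def algebra_simps)
  have "norm (p * (f * (1 - c) * f) * p) \<le> norm ((\<delta> + \<eta>) *\<^sub>R p)"
    by (rule norm_mono_pos[OF pA]) (use pos_add[OF base pB] in \<open>simp add: d1 algebra_simps\<close>)
  then have n2: "norm (p * (f * (1 - c) * f) * p) \<le> \<delta> + \<eta>" using nb by linarith
  have "norm (p * (1 - f) * p) \<le> norm ((\<delta> + \<eta>) *\<^sub>R p)"
    by (rule norm_mono_pos[OF pC])
      (use pos_add[OF pos_add[OF base pA] pD] in \<open>simp add: d1 algebra_simps\<close>)
  then have n3: "norm (p * (1 - f) * p) \<le> \<delta> + \<eta>" using nb by linarith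
  have "(norm ((1 - c) * (f * p)))\<^sup>2 \<le> norm (adj (f * p) * (1 - c) * (f * p))"
    by (rule norm_contraction_mult[OF p1c norm_one_minus_pos[OF c]])
  also have "adj (f * p) * (1 - c) * (f * p) = p * (f * (1 - c) * f) * p" by (simp add: adj_mult ps fs mult.assoc)
  finally have "(norm ((1 - c) * (f * p)))\<^sup>2 \<le> \<delta> + \<eta>" using n2 by linarith
  then have n4: "norm ((1 - c) * (f * p)) \<le> sqrt (\<delta> + \<eta>)" by (rule real_le_rsqrt)
  have "(norm ((1 - f) * p))\<^sup>2 \<le> norm (adj p * (1 - f) * p)"
    by (rule norm_contraction_mult[OF p1f norm_one_minus_pos[OF f]])
  then have "(norm ((1 - f) * p))\<^sup>2 \<le> \<delta> + \<eta>" using n3 by (simp add: ps)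
  then have n5: "norm ((1 - f) * p) \<le> sqrt (\<delta> + \<eta>)" by (rule real_le_rsqrt)
  have "(1 - c) * p = (1 - c) * (f * p) + (1 - c) * ((1 - f) * p)" by (simp add: algebra_simps)
  also have "norm \<dots> \<le> sqrt (\<delta> + \<eta>) + 1 * sqrt (\<delta> + \<eta>)"
    by (rule norm_triangle_mono[OF n4 norm_mult_le])
      (use n5 norm_one_minus_pos[OF c] in auto)
  finally show "norm ((1 - c) * p) \<le> 2 * sqrt (\<delta> + \<eta>)" by simp
qed

text \<open>Next to \<open>p\<close> the element \<open>a\<close> may be replaced by
  \<open>c * a\<close>, and this by \<open>b\<close>. The cutoff costs
  \<open>\<sigma> * norm a\<close> on each side, \<open>c * a - b\<close> costs \<open>e1\<close> on
  each side, and one more \<open>e1\<close> exchanges \<open>a * c\<close> with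
  \<open>c * a\<close>.\<close>

lemma commutator_via_cutoff:
  assumes p: "proj p" and c: "adj c = c" and "norm ((1 - c) * p) \<le> \<sigma>"
    and "norm (c * a - a * c) \<le> e1" "norm (c * a - b) \<le> e1" "norm (p * b - b * p) \<le> e2"
  shows "norm (p * a - a * p) \<le> 2 * \<sigma> * norm a + 3 * e1 + e2"
proof -
  have np: "norm p \<le> 1" by (rule proj_norm[OF p])
  have s0: "0 \<le> e1" using assms(4) norm_ge_zero order_trans by blast
  have s1: "0 \<le> \<sigma>" using assms(3) norm_ge_zero order_trans by blast
  have pc: "norm (p * (1 - c)) \<le> \<sigma>" using assms(3) norm_adj[of "(1 - c) * p"] by (simp add: adj_mult adj_diff c proj_sa[OF p])
  have n: "norm (p * (1 - c) * a) \<le> \<sigma> * norm a" "norm (a * ((1 - c) * p)) \<le> norm a * \<sigma>"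
    "norm (p * (c * a - b)) \<le> 1 * e1" "norm ((c * a - b) * p) \<le> e1 * 1" "norm ((c * a - a * c) * p) \<le> e1 * 1"
    by (rule norm_mult_le; use pc assms np s0 s1 in auto)+
  have "p * a - a * p = p * (1 - c) * a + (p * (c * a - b) + ((p * b - b * p) + (- ((c * a - b) * p) + ((c * a - a * c) * p + - (a * ((1 - c) * p))))))"
    by (simp add: algebra_simps)
  also have "norm \<dots> \<le> \<sigma> * norm a + (1 * e1 + (e2 + (e1 * 1 + (e1 * 1 + norm a * \<sigma>))))"
    by (intro norm_triangle_mono n assms(6)) (simp_all only: norm_minus_cancel n)
  also have "\<dots> = 2 * \<sigma> * norm a + 3 * e1 + e2" by simp
  finally show ?thesis .
qed

text \<open>\<open>P g\<close> is nearly a left multiple of \<open>T g\<close>, and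
  \<open>T g * T h\<close> vanishes exactly. The last bound is \<theta> for the approximation plus
  \<open>2 * \<theta>\<close> for the factor \<open>U g\<close>.\<close>

lemma almost_orthogonal_projs:
  assumes P: "\<And>g. g \<in> S \<Longrightarrow> proj (P g)" and T: "\<And>g. g \<in> S \<Longrightarrow> adj (T g) = T g" "\<And>g. g \<in> S \<Longrightarrow> norm (T g) \<le> 1"
    "\<And>g h. g \<in> S \<Longrightarrow> h \<in> S \<Longrightarrow> g \<noteq> h \<Longrightarrow> T g * T h = 0"
    and U: "\<And>g. g \<in> S \<Longrightarrow> norm (U g) \<le> 2" "\<And>g. g \<in> S \<Longrightarrow> norm (P g - U g * T g) \<le> \<theta>"
    and gh: "g \<in> S" "h \<in> S" "g \<noteq> h"
  shows "norm (P g * T h) \<le> \<theta>" "norm (T g * P h) \<le> \<theta>" "norm (P g * P h) \<le> 3 * \<theta>"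
proof -
  have th: "0 \<le> \<theta>" using U(2)[OF gh(1)] norm_ge_zero order_trans by blast
  have *: "norm (P k * T l) \<le> \<theta>" if "k \<in> S" "l \<in> S" "k \<noteq> l" for k l
  proof -
    have "P k * T l = (P k - U k * T k) * T l" using T(3)[OF that] by (simp add: left_diff_distrib mult.assoc)
    also have "norm \<dots> \<le> \<theta> * 1"
      by (rule norm_mult_le) (use U(2)[OF that(1)] T(2)[OF that(2)] th in auto)
    finally show ?thesis by simp
  qed
  show "norm (P g * T h) \<le> \<theta>" by (rule *[OF gh])
  show 2: "norm (T g * P h) \<le> \<theta>"
    using *[OF gh(2,1) gh(3)[symmetric]] norm_adj[of "P h * T g"] by (simp add: adj_mult T(1)[OF gh(1)] proj_sa[OF P[OF gh(2)]])
  have "P g * P h = (P g - U g * T g) * P h + U g * (T g * P h)" by (simp add: algebra_simps)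
  also have "norm \<dots> \<le> \<theta> * 1 + 2 * \<theta>"
    by (rule norm_triangle_mono[OF norm_mult_le norm_mult_le])
      (use U(1)[OF gh(1)] U(2)[OF gh(1)] 2 th proj_norm[OF P[OF gh(2)]] in auto)
  finally show "norm (P g * P h) \<le> 3 * \<theta>" by simp
qed

text \<open>Let \<open>e\<close> be the left side and \<open>T\<close> the sum of the
  \<open>T g\<close>. By \<open>cb_projI\<close> it is enough that \<open>norm (e * T) < 1\<close>,
  and this follows from \<open>norm (T * e * T) < 1\<close>, where \<open>T * e * T\<close> is the
  sum of the \<open>T g * (1 - P g) * T g\<close> up to one small error for each triple of
  indices.\<close>

lemma complement_cb:
  assumes fin: "finite S" and P: "\<And>g. g \<in> S \<Longrightarrow> proj (P g)"
    and T: "\<And>g. g \<in> S \<Longrightarrow> adj (T g) = T g" "\<And>g. g \<in> S \<Longrightarrow> norm (T g) \<le> 1"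
    "\<And>g h. g \<in> S \<Longrightarrow> h \<in> S \<Longrightarrow> g \<noteq> h \<Longrightarrow> T g * T h = 0"
    and U: "\<And>g. g \<in> S \<Longrightarrow> norm (U g) \<le> 2" "\<And>g. g \<in> S \<Longrightarrow> norm (P g - U g * T g) \<le> \<theta>"
    and l: "\<And>g. g \<in> S \<Longrightarrow> norm ((1 - P g) * T g) \<le> l" "0 < l"
    and q: "\<And>g. g \<in> S \<Longrightarrow> proj (q g)" "\<And>g h. g \<in> S \<Longrightarrow> h \<in> S \<Longrightarrow> g \<noteq> h \<Longrightarrow> q g * q h = 0"
      "\<And>g. g \<in> S \<Longrightarrow> norm (q g - P g) \<le> \<nu>"
    and small: "l + real (card S) ^ 3 * (\<nu> + \<theta>) < 1" and pos: "0 \<le> \<nu>" "0 \<le> \<theta>"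
  shows "1 - sum q S \<preceq> 1 - sum T S"
proof -
  define e where "e = 1 - sum q S"
  have Q: "proj (sum q S)" by (rule proj_sum(1)[where q = q, OF fin q(1,2)])
  have e: "proj e" unfolding e_def by (rule proj_one_minus[OF Q])
  have ee: "adj e = e" "e * e = e" "norm e \<le> 1" using e proj_norm[OF e] by (auto simp: projection_el_def)
  have Ts: "adj (sum T S) = sum T S" unfolding adj_sum by (intro sum.cong refl T(1))
  \<comment> \<open>The \<open>W g\<close> are orthogonal, so their sum obeys the bound
    \<open>l\<close> of a single one. A factor \<open>card S\<close> would be fatal, since in the
    application \<open>l\<close> is only slightly below one.\<close>
  define W where "W g = T g * (1 - P g) * T g" for g
  have W: "norm (sum W S) \<le> l"
  proof (rule norm_orthogonal_sum_le[OF fin])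
    fix g assume g: "g \<in> S"
    show "adj (W g) = W g" by (simp add: W_def adj_mult adj_diff T(1)[OF g] proj_sa[OF P[OF g]] mult.assoc)
    have "W g = T g * ((1 - P g) * T g)" by (simp add: W_def mult.assoc)
    also have "norm \<dots> \<le> 1 * l" by (rule norm_mult_le) (use T(2)[OF g] l(1)[OF g] in auto)
    finally show "norm (W g) \<le> l" by simp
  next
    fix g h assume gh: "g \<in> S" "h \<in> S" "g \<noteq> h"
    have "W g * W h = T g * (1 - P g) * (T g * T h) * (1 - P h) * T h" by (simp add: W_def mult.assoc)
    then show "W g * W h = 0" using T(3)[OF gh] by simp
  qed (rule l(2))
  \<comment> \<open>The error of replacing \<open>q k\<close> by \<open>P k\<close> and discarding
    all terms except \<open>T g * P g * T g\<close>.\<close>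
  define R where "R g k h = T g * q k * T h - (if k = g \<and> h = g then T g * P g * T g else 0)" for g k h
  have R: "norm (R g k h) \<le> \<nu> + \<theta>" if gkh: "g \<in> S" "k \<in> S" "h \<in> S" for g k h
  proof -
    have n: "norm (T g * (q k - P k) * T h) \<le> \<nu>"
    proof -
      have "norm (T g * (q k - P k) * T h) \<le> 1 * \<nu> * 1"
        by (intro norm_mult_le) (use T(2) q(3) gkh pos in auto)
      then show ?thesis by simp
    qed
    show ?thesis
    proof (cases "k = g \<and> h = g")
      case True
      then have "R g k h = T g * (q k - P k) * T h" by (simp add: R_def algebra_simps)
      then show ?thesis using n pos by simp
    next
      case False
      have "norm (T g * P k * T h) \<le> \<theta>"
      proof (cases "k = h")
        case True
        then have "norm (T g * P k) \<le> \<theta>" using False almost_orthogonal_projs(2)[where P = P and T = T and U = U, OF P T U gkh(1,2)] by auto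
        then have "norm (T g * P k * T h) \<le> \<theta> * 1"
          by (intro norm_mult_le) (use T(2)[OF gkh(3)] pos in auto)
        then show ?thesis by simp
      next
        case False
        then have "norm (P k * T h) \<le> \<theta>" using almost_orthogonal_projs(1)[where P = P and T = T and U = U, OF P T U gkh(2,3)] by auto
        then have "norm (T g * (P k * T h)) \<le> 1 * \<theta>"
          by (intro norm_mult_le) (use T(2)[OF gkh(1)] pos in auto)
        then show ?thesis by (simp add: mult.assoc)
      qed
      moreover have "R g k h = T g * (q k - P k) * T h + T g * P k * T h" using False by (auto simp: R_def algebra_simps)
      ultimately show ?thesis using n norm_triangle_mono by metis
    qed
  qed
  have sumP: "(\<Sum>k\<in>S. \<Sum>h\<in>S. if k = g \<and> h = g then T g * P g * T g else 0) = T g * P g * T g" if g: "g \<in> S" for g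
  proof -
    have "(\<Sum>k\<in>S. \<Sum>h\<in>S. if k = g \<and> h = g then T g * P g * T g else 0) = (\<Sum>k\<in>S. if k = g then T g * P g * T g else 0)"
      by (intro sum.cong refl) (use fin g in \<open>auto simp: sum.delta\<close>)
    then show ?thesis using fin g by simp
  qed
  have "sum T S * sum T S = (\<Sum>g\<in>S. \<Sum>h\<in>S. if h = g then T g * T g else 0)"
    unfolding sum_product by (intro sum.cong refl) (use T(3) in auto)
  also have "\<dots> = (\<Sum>g\<in>S. T g * T g)" using fin by simp
  finally have TT: "sum T S * sum T S = (\<Sum>g\<in>S. T g * T g)" .
  have "sum T S * sum q S * sum T S = (\<Sum>g\<in>S. \<Sum>k\<in>S. T g * q k) * sum T S" by (simp only: sum_product)
  also have "\<dots> = (\<Sum>g\<in>S. \<Sum>k\<in>S. (T g * q k) * sum T S)" by (simp only: sum_distrib_right)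
  also have "\<dots> = (\<Sum>g\<in>S. \<Sum>k\<in>S. \<Sum>h\<in>S. T g * q k * T h)" by (simp only: sum_distrib_left)
  finally have TQT: "sum T S * sum q S * sum T S = (\<Sum>g\<in>S. \<Sum>k\<in>S. \<Sum>h\<in>S. T g * q k * T h)" .
  have "sum T S * e * sum T S = sum T S * sum T S - sum T S * sum q S * sum T S" by (simp add: e_def algebra_simps)
  also have "\<dots> = (\<Sum>g\<in>S. T g * T g - T g * P g * T g) - (\<Sum>g\<in>S. (\<Sum>k\<in>S. \<Sum>h\<in>S. T g * q k * T h) - T g * P g * T g)"
    unfolding TT TQT by (simp add: sum_subtractf)
  also have "(\<Sum>g\<in>S. T g * T g - T g * P g * T g) = sum W S" by (simp add: W_def algebra_simps)
  also have "(\<Sum>g\<in>S. (\<Sum>k\<in>S. \<Sum>h\<in>S. T g * q k * T h) - T g * P g * T g) = (\<Sum>g\<in>S. \<Sum>k\<in>S. \<Sum>h\<in>S. R g k h)"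
    by (intro sum.cong refl) (simp only: R_def sum_subtractf sumP)
  finally have TeT: "sum T S * e * sum T S = sum W S - (\<Sum>g\<in>S. \<Sum>k\<in>S. \<Sum>h\<in>S. R g k h)" .
  have "norm (\<Sum>g\<in>S. \<Sum>k\<in>S. \<Sum>h\<in>S. R g k h) \<le> (\<Sum>g\<in>S. \<Sum>k\<in>S. \<Sum>h\<in>S. \<nu> + \<theta>)"
    by (intro order_trans[OF norm_sum] sum_mono R)
  also have "\<dots> = real (card S) ^ 3 * (\<nu> + \<theta>)" by (simp add: power3_eq_cube)
  finally have n: "norm (sum T S * e * sum T S) < 1"
    unfolding TeT using W small norm_triangle_ineq4[of "sum W S" "\<Sum>g\<in>S. \<Sum>k\<in>S. \<Sum>h\<in>S. R g k h"] by linarith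
  have "(norm (e * sum T S))\<^sup>2 = norm (adj (e * sum T S) * (e * sum T S))" by (rule cstar_identity[symmetric])
  also have "adj (e * sum T S) * (e * sum T S) = sum T S * (e * e) * sum T S" by (simp only: adj_mult Ts ee(1) mult.assoc)
  finally have "(norm (e * sum T S))\<^sup>2 < 1\<^sup>2" using n ee(2) by simp
  then have eT: "norm (e * sum T S) < 1" by (rule power2_less_imp_less) simp
  have "norm (e * (1 - sum T S) * e - e) = norm (e * sum T S * e)"
  proof -
    have "e * (1 - sum T S) * e - e = - (e * sum T S * e)" by (simp add: algebra_simps ee(2))
    then show ?thesis by simp
  qed
  also have "\<dots> \<le> norm (e * sum T S) * 1"
    by (rule order_trans[OF norm_mult_ineq mult_left_mono[OF ee(3)]]) simp
  finally have "norm (e * (1 - sum T S) * e - e) < 1" using eT by simp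
  then show ?thesis unfolding e_def[symmetric] by (intro cb_projI[OF e]) (simp_all add: adj_diff Ts)
qed

end

section \<open>From weak towers to projections\<close>

context unital_cstar_algebra
begin

text \<open>Conditions (a) to (c) of the weak property with tolerance \<tau>. Condition (d) is kept
  apart: it singles out a large component, and the family is then reindexed to bring that component
  to the unit of the group.\<close>

definition towers :: "('g, 'm) monoid_scheme \<Rightarrow> ('g \<Rightarrow> 'a \<Rightarrow> 'a) \<Rightarrow> 'a set \<Rightarrow> real \<Rightarrow> 'a \<Rightarrow> ('g \<Rightarrow> 'a) \<Rightarrow> bool" where
  "towers G \<alpha> F \<tau> x f \<longleftrightarrow>
     (\<forall>g\<in>carrier G. pos (f g) \<and> norm (f g) \<le> 1) \<and>
     (\<forall>g\<in>carrier G. \<forall>h\<in>carrier G. g \<noteq> h \<longrightarrow> f g * f h = 0) \<and>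
     (\<forall>g\<in>carrier G. \<forall>a\<in>F. norm (f g * a - a * f g) < \<tau>) \<and>
     (\<forall>g\<in>carrier G. \<forall>h\<in>carrier G. norm (\<alpha> g (f h) - f (g \<otimes>\<^bsub>G\<^esub> h)) < \<tau>) \<and>
     1 - (\<Sum>g\<in>carrier G. f g) \<preceq> x"

lemma towersD:
  assumes "towers G \<alpha> F \<tau> x f"
  shows "g \<in> carrier G \<Longrightarrow> pos (f g)" "g \<in> carrier G \<Longrightarrow> norm (f g) \<le> 1"
    "g \<in> carrier G \<Longrightarrow> h \<in> carrier G \<Longrightarrow> g \<noteq> h \<Longrightarrow> f g * f h = 0"
    "g \<in> carrier G \<Longrightarrow> a \<in> F \<Longrightarrow> norm (f g * a - a * f g) < \<tau>"
    "g \<in> carrier G \<Longrightarrow> h \<in> carrier G \<Longrightarrow> norm (\<alpha> g (f h) - f (g \<otimes>\<^bsub>G\<^esub> h)) < \<tau>"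
    "1 - (\<Sum>g\<in>carrier G. f g) \<preceq> x"
  using assms unfolding towers_def by simp_all

text \<open>Right translation of the index commutes with the left multiplication that appears in
  equivariance.\<close>

lemma towers_translate:
  fixes G :: "('g, 'm) monoid_scheme" (structure)
  assumes "group G" and t: "towers G \<alpha> F \<tau> x f" and k: "k \<in> carrier G"
  shows "towers G \<alpha> F \<tau> x (\<lambda>g. f (g \<otimes> k))"
proof -
  interpret group G by fact
  have cl: "g \<otimes> k \<in> carrier G" if "g \<in> carrier G" for g using that k by simp
  have ne: "g \<otimes> k \<noteq> h \<otimes> k" if "g \<in> carrier G" "h \<in> carrier G" "g \<noteq> h" for g h using that k by simp
  have s: "(\<Sum>g\<in>carrier G. f (g \<otimes> k)) = (\<Sum>g\<in>carrier G. f g)"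
    by (rule sum.reindex_bij_witness[of _ "\<lambda>g. g \<otimes> inv k" "\<lambda>g. g \<otimes> k"]) (use k in \<open>auto simp: m_assoc\<close>)
  have eq: "norm (\<alpha> g (f (h \<otimes> k)) - f (g \<otimes> h \<otimes> k)) < \<tau>" if "g \<in> carrier G" "h \<in> carrier G" for g h
    using towersD(5)[OF t that(1) cl[OF that(2)]] that k by (simp add: m_assoc)
  show ?thesis unfolding towers_def s
    using towersD(1-4,6)[OF t] cl ne eq by simp
qed

lemma towers_mono: "towers G \<alpha> F \<tau> x f \<Longrightarrow> F' \<subseteq> F \<Longrightarrow> towers G \<alpha> F' \<tau> x f"
  unfolding towers_def by auto

text \<open>Condition (d) makes the compression of \<open>x\<close> large. Almost commuting with
  \<open>x\<close> removes the off-diagonal terms at a cost of \<tau> each, and an orthogonal sum is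
  as large as one of its components. Passing from \<open>x\<close> to \<open>c\<close> costs
  \<kappa> and one commutator; with the loss in (d) this explains the \<open>2\<close> next to the
  squared cardinality.\<close>

lemma large_tower:
  fixes G :: "('g, 'm) monoid_scheme" (structure)
  assumes "group G" and fin: "finite (carrier G)" and weak: "weak_tracial_rokhlin sc adj G \<alpha>"
    and c: "norm c = 1" and x: "pos x" "norm x = 1" "norm ((1 - c) * x) \<le> \<kappa>"
    and F: "finite F" and tau: "0 < \<tau>" and L: "0 \<le> L" "L < 1 - \<kappa> - (real (card (carrier G)) ^ 2 + 2) * \<tau>"
  shows "\<exists>f. towers G \<alpha> F \<tau> x f \<and> L < norm (f \<one> * c * f \<one>)"
proof -
  interpret group G by fact
  have kap: "0 \<le> \<kappa>" using x(3) norm_ge_zero order_trans by blast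
  have "finite (insert x F) \<and> \<tau> > 0 \<and> pos x \<and> norm x = 1" using F tau x by simp
  from weak[unfolded rokhlin_prop_def, rule_format, OF this]
  have "\<exists>f. towers G \<alpha> (insert x F) \<tau> x f \<and>
      norm ((\<Sum>g\<in>carrier G. f g) * x * (\<Sum>g\<in>carrier G. f g)) > 1 - \<tau>"
    unfolding towers_def pos_contraction_def by (simp add: conj_assoc)
  then obtain f where t: "towers G \<alpha> (insert x F) \<tau> x f"
    and big: "norm ((\<Sum>g\<in>carrier G. f g) * x * (\<Sum>g\<in>carrier G. f g)) > 1 - \<tau>" by blast
  note T = towersD[OF t]
  let ?S = "carrier G" and ?N = "real (card (carrier G))"
  have comm: "norm (f g * x - x * f g) \<le> \<tau>" if "g \<in> ?S" for g using T(4)[OF that, of x] by simp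
  have off: "norm (f g * x * f h - (if h = g then f g * x * f g else 0)) \<le> \<tau>" if gh: "g \<in> ?S" "h \<in> ?S" for g h
  proof (cases "h = g")
    case False
    then have "f g * x * f h = (f g * x - x * f g) * f h" using T(3)[OF gh] by (simp add: left_diff_distrib mult.assoc)
    also have "norm \<dots> \<le> \<tau> * 1"
      by (rule norm_mult_le) (use comm gh T(2) tau in auto)
    finally show ?thesis using False by simp
  qed (use tau in simp)
  have "sum f ?S * x * sum f ?S = (\<Sum>g\<in>?S. f g * x) * sum f ?S" by (simp only: sum_distrib_right)
  also have "\<dots> = (\<Sum>g\<in>?S. \<Sum>h\<in>?S. f g * x * f h)" by (simp only: sum_product)
  finally have 1: "sum f ?S * x * sum f ?S = (\<Sum>g\<in>?S. \<Sum>h\<in>?S. f g * x * f h)" .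
  have "(\<Sum>g\<in>?S. \<Sum>h\<in>?S. if h = g then f g * x * f g else 0) = (\<Sum>g\<in>?S. f g * x * f g)" using fin by simp
  then have "norm (sum f ?S * x * sum f ?S - (\<Sum>g\<in>?S. f g * x * f g)) =
    norm (\<Sum>g\<in>?S. \<Sum>h\<in>?S. f g * x * f h - (if h = g then f g * x * f g else 0))"
    unfolding 1 by (simp only: sum_subtractf)
  also have "\<dots> \<le> (\<Sum>g\<in>?S. \<Sum>h\<in>?S. \<tau>)" by (intro order_trans[OF norm_sum] sum_mono off)
  also have "\<dots> = ?N ^ 2 * \<tau>" by (simp add: power2_eq_square)
  finally have 2: "norm (sum f ?S * x * sum f ?S - (\<Sum>g\<in>?S. f g * x * f g)) \<le> ?N ^ 2 * \<tau>" .
  define K where "K = 1 - \<tau> - ?N ^ 2 * \<tau>"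
  have K: "K < norm (\<Sum>g\<in>?S. f g * x * f g)"
    using big 2 norm_triangle_ineq2[of "sum f ?S * x * sum f ?S" "\<Sum>g\<in>?S. f g * x * f g"] by (simp add: K_def)
  have LK: "L < K - \<kappa> - \<tau>" using L(2) by (simp add: K_def algebra_simps)
  have fs: "adj (f g) = f g" if "g \<in> ?S" for g using T(1)[OF that] by (rule pos_sa)
  have "\<exists>k\<in>?S. K < norm (f k * x * f k)"
  proof (rule orthogonal_sum_norm_attained[OF fin _ _ K])
    show "adj (f g * x * f g) = f g * x * f g" if "g \<in> ?S" for g
      by (simp add: adj_mult fs[OF that] pos_sa[OF x(1)] mult.assoc)
    show "f g * x * f g * (f h * x * f h) = 0" if "g \<in> ?S" "h \<in> ?S" "g \<noteq> h" for g h
    proof -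
      have "f g * x * f g * (f h * x * f h) = f g * x * (f g * f h) * x * f h" by (simp add: mult.assoc)
      then show ?thesis using T(3)[OF that] by simp
    qed
    show "0 < K" using LK L(1) kap tau by simp
  qed
  then obtain k where k: "k \<in> ?S" "K < norm (f k * x * f k)" by blast
  have fk: "norm (f k) \<le> 1" by (rule T(2)[OF k(1)])
  have "f k * x * f k = f k * c * f k * x + (f k * ((1 - c) * x) * f k + f k * c * (x * f k - f k * x))"
    by (simp add: algebra_simps)
  also have "norm \<dots> \<le> norm (f k * c * f k) * 1 + (1 * \<kappa> * 1 + 1 * 1 * \<tau>)"
  proof (intro norm_triangle_mono)
    show "norm (f k * c * f k * x) \<le> norm (f k * c * f k) * 1" using norm_mult_ineq[of "f k * c * f k" x] x(2) by simp
    show "norm (f k * ((1 - c) * x) * f k) \<le> 1 * \<kappa> * 1"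
      by (intro norm_mult_le) (use fk x kap in auto)
    show "norm (f k * c * (x * f k - f k * x)) \<le> 1 * 1 * \<tau>"
      by (intro norm_mult_le)
        (use fk c comm[OF k(1)] in \<open>auto simp: norm_minus_commute\<close>)
  qed
  finally have "L < norm (f k * c * f k)" using k(2) LK by simp
  moreover have "towers G \<alpha> F \<tau> x (\<lambda>g. f (g \<otimes> k))"
    by (rule towers_translate[OF assms(1) towers_mono[OF t] k(1)]) blast
  ultimately show ?thesis using k(1) by (intro exI[of _ "\<lambda>g. f (g \<otimes> k)"]) simp
qed

text \<open>\<open>1 - f * f\<close> is \<open>1 - f\<close> conjugated by the square root of
  \<open>1 + f\<close>, which commutes with it.\<close>

lemma one_minus_square_cb:
  assumes f: "pos f" "norm f \<le> 1"
  shows "1 - f * f \<preceq> 1 - f"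
proof -
  let ?h = "\<lambda>t. sqrt (max 0 (1 + t))"
  have fs: "adj f = f" by (rule pos_sa[OF f(1)])
  have ch: "continuous_on UNIV ?h" by (intro continuous_intros)
  let ?r = "cfc f ?h"
  have "?r * ?r = cfc f (\<lambda>t. ?h t * ?h t)" by (rule cfc_mult[OF fs ch ch, symmetric])
  also have "\<dots> = cfc f (poly [:1, 1:])"
    by (rule cfc_cong[OF fs]) (use f in \<open>auto simp: pos_iff intro!: continuous_intros\<close>)
  also have "\<dots> = 1 + f" by (simp add: cfc_rpe[OF fs])
  finally have rr: "?r * ?r = 1 + f" .
  have "?r * (1 - f) = (1 - f) * ?r" by (rule cfc_commute[OF fs ch]) (simp add: algebra_simps)
  then have "?r * (1 - f) * adj ?r = (1 - f) * (?r * ?r)" by (simp add: adj_cfc[OF fs ch] mult.assoc)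
  also have "\<dots> = 1 - f * f" unfolding rr by (simp add: algebra_simps)
  finally show ?thesis by (intro cb_exact[of _ ?r]) simp
qed

lemma sum_towers_pos_contraction:
  assumes fin: "finite S" and f: "\<And>g. g \<in> S \<Longrightarrow> pos (f g)" "\<And>g. g \<in> S \<Longrightarrow> norm (f g) \<le> 1"
    "\<And>g h. g \<in> S \<Longrightarrow> h \<in> S \<Longrightarrow> g \<noteq> h \<Longrightarrow> f g * f h = 0"
  shows "pos (sum f S)" "norm (sum f S) \<le> 1" "sum f S * sum f S = (\<Sum>g\<in>S. f g * f g)"
proof -
  show "pos (sum f S)" by (rule pos_sum) (rule f(1))
  show "norm (sum f S) \<le> 1"
    by (rule norm_orthogonal_sum_le[OF fin]) (use f pos_sa in auto)
  have "sum f S * sum f S = (\<Sum>g\<in>S. \<Sum>h\<in>S. if h = g then f g * f g else 0)"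
    unfolding sum_product by (intro sum.cong refl) (use f(3) in auto)
  also have "\<dots> = (\<Sum>g\<in>S. f g * f g)" using fin by simp
  finally show "sum f S * sum f S = (\<Sum>g\<in>S. f g * f g)" .
qed

text \<open>\<open>1 - \<Sum> f\<^sub>g c\<^sub>g f\<^sub>g = (1 - f\<^sup>2) + \<Sum> f\<^sub>g (1 - c\<^sub>g) f\<^sub>g\<close>, where \<open>f = \<Sum> f\<^sub>g\<close>.\<close>

lemma tower_remainder_cb:
  assumes fin: "finite S" and f: "\<And>g. g \<in> S \<Longrightarrow> pos (f g)" "\<And>g. g \<in> S \<Longrightarrow> norm (f g) \<le> 1"
    "\<And>g h. g \<in> S \<Longrightarrow> h \<in> S \<Longrightarrow> g \<noteq> h \<Longrightarrow> f g * f h = 0"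
    and x: "pos x"
    and y: "\<And>i. i \<in> insert None (Some ` S) \<Longrightarrow> adj (y i) = y i" "\<And>i. i \<in> insert None (Some ` S) \<Longrightarrow> y i \<in> lideal x"
      "\<And>i j. i \<in> insert None (Some ` S) \<Longrightarrow> j \<in> insert None (Some ` S) \<Longrightarrow> i \<noteq> j \<Longrightarrow> y i * y j = 0"
    and le: "1 - sum f S \<preceq> y None * y None" "\<And>g. g \<in> S \<Longrightarrow> 1 - c g \<preceq> y (Some g) * y (Some g)"
  shows "1 - (\<Sum>g\<in>S. f g * c g * f g) \<preceq> x"
proof -
  \<comment> \<open>\<open>None\<close> carries the part that the towers leave uncovered,
    \<open>Some g\<close> the part of the tower at \<open>g\<close> where \<open>c g\<close> falls
    short of \<open>1\<close>.\<close>
  define a where "a i = (case i of None \<Rightarrow> 1 - sum f S * sum f S | Some g \<Rightarrow> f g * (1 - c g) * f g)" for i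
  note s = sum_towers_pos_contraction[where f = f, OF fin f]
  have "sum a (insert None (Some ` S)) = 1 - sum f S * sum f S + (\<Sum>g\<in>S. f g * (1 - c g) * f g)"
    using fin by (simp add: a_def sum.reindex)
  also have "\<dots> = 1 - (\<Sum>g\<in>S. f g * c g * f g)"
    using s(3) by (simp add: right_diff_distrib left_diff_distrib sum_subtractf)
  finally have sa: "sum a (insert None (Some ` S)) = 1 - (\<Sum>g\<in>S. f g * c g * f g)" .
  have "sum a (insert None (Some ` S)) \<preceq> x"
  proof (rule cb_sum[OF x _ y])
    show "finite (insert None (Some ` S))" using fin by simp
    fix i assume i: "i \<in> insert None (Some ` S)"
    show "a i \<preceq> y i * y i"
    proof (cases i)
      case None
      have "1 - sum f S * sum f S \<preceq> y None * y None"
        by (rule cb_trans[OF one_minus_square_cb[OF s(1,2)] le(1)])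
      then show ?thesis using None by (simp add: a_def)
    next
      case (Some g)
      then have g: "g \<in> S" using i by auto
      have "f g * (1 - c g) * f g \<preceq> 1 - c g" by (rule cb_exact[of _ "f g"]) (simp add: pos_sa[OF f(1)[OF g]])
      then show ?thesis using cb_trans[OF _ le(2)[OF g]] Some by (simp add: a_def)
    qed
  qed auto
  then show ?thesis unfolding sa .
qed

text \<open>\<open>x\<close> is \<open>w * adj w\<close> for a normalized
  \<open>w = k * a * y\<close>: the left factor \<open>k\<close> puts it where \<open>c\<close> is
  close to \<open>1\<close>, the right factor \<open>y\<close> puts it below \<open>y * y\<close>,
  and primeness makes \<open>w\<close> nonzero.\<close>

lemma small_element_under_peak:
  assumes simple: "simple_algebra sc TYPE('a)" and c: "pos c" "norm (c::'a) = 1" and k: "0 < \<kappa>" and y: "adj y = y" "y \<noteq> 0"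
  obtains x where "pos x" "norm x = 1" "norm ((1 - c) * x) \<le> \<kappa>" "x \<preceq> y * y"
proof -
  obtain k g where kg: "adj k = k" "k \<noteq> 0" "norm g \<le> \<kappa>" "(1 - c) * k = g * k"
    using spectral_peak[OF c k] .
  obtain a where a: "k * a * y \<noteq> 0" using simple_prime[OF simple kg(2) y(2)] .
  define r where "r = norm (k * a * y)"
  have r: "r > 0" using a by (simp add: r_def)
  define w where "w = (1 / r) *\<^sub>R (k * a * y)"
  have nw: "norm w = 1" using r by (simp add: w_def r_def)
  define x where "x = w * adj w"
  have nx: "norm x = 1" using cstar_identity'[of w] nw by (simp add: x_def)
  have "(1 - c) * w = g * w" by (simp add: w_def mult.assoc[symmetric] kg(4))
  then have "(1 - c) * x = g * x" by (simp add: x_def mult.assoc[symmetric])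
  then have "norm ((1 - c) * x) \<le> norm g * norm x" by (simp only: norm_mult_ineq)
  then have "norm ((1 - c) * x) \<le> \<kappa>" using nx kg(3) by simp
  moreover have "x \<preceq> y * y"
    by (rule cb_exact[of _ "(1 / r) *\<^sub>R (k * a)"]) (simp add: x_def w_def adj_scaleR adj_mult y(1) kg(1) mult.assoc)
  ultimately show thesis using that[of x] nx pos_mult_adj[of w] by (simp add: x_def)
qed

lemma group_action_simps:
  fixes G :: "('g, 'm) monoid_scheme" (structure)
  assumes "group G" and act: "group_action sc adj G \<alpha>"
  shows "g \<in> carrier G \<Longrightarrow> star_automorphism sc adj (\<alpha> g)"
    "g \<in> carrier G \<Longrightarrow> h \<in> carrier G \<Longrightarrow> \<alpha> g (\<alpha> h a) = \<alpha> (g \<otimes> h) a"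
    "\<alpha> \<one> a = a"
    "g \<in> carrier G \<Longrightarrow> \<alpha> g (\<alpha> (inv g) a) = a"
proof -
  interpret group G by fact
  show 1: "g \<in> carrier G \<Longrightarrow> star_automorphism sc adj (\<alpha> g)" for g using act by (simp add: group_action_def)
  show 2: "g \<in> carrier G \<Longrightarrow> h \<in> carrier G \<Longrightarrow> \<alpha> g (\<alpha> h a) = \<alpha> (g \<otimes> h) a" for g h a
    using act by (simp add: group_action_def)
  have "inj (\<alpha> \<one>)" using 1[OF one_closed] by (simp add: star_automorphism_def bij_def)
  then show 3: "\<alpha> \<one> a = a" for a using 2[of \<one> \<one> a] by (simp add: inj_eq)
  show "g \<in> carrier G \<Longrightarrow> \<alpha> g (\<alpha> (inv g) a) = a" using 2[of g "inv g" a] 3 by simp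
qed

text \<open>\<open>c\<close> commutes with \<open>b'\<close> exactly, so only the two factors
  \<open>f\<close> contribute; passing from \<open>b\<close> to \<open>b'\<close> costs
  \<open>s\<close> twice. In use, \<open>b'\<close> runs through a dense sequence in
  \<open>B\<close>.\<close>

lemma compressed_commutator:
  fixes f :: 'a
  assumes "norm f \<le> 1" "norm c \<le> 1" "c * b' = b' * c" "norm (f * b' - b' * f) \<le> t" "norm (b - b') \<le> s"
  shows "norm (f * c * f * b - b * (f * c * f)) \<le> 2 * t + 2 * s"
proof -
  have t: "0 \<le> t" and s: "0 \<le> s" using assms(4,5) norm_ge_zero order_trans by blast+
  have d: "norm (f * c * f) \<le> 1 * 1 * 1" by (intro norm_mult_le) (use assms in auto)
  have "f * c * f * b - b * (f * c * f) = (f * c * f) * (b - b') + (- ((b - b') * (f * c * f)) + (f * c * (f * b' - b' * f) + (f * b' - b' * f) * c * f))"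
  proof -
    have "f * c * (f * b' - b' * f) + (f * b' - b' * f) * c * f = f * c * f * b' - f * (c * b') * f + f * (b' * c) * f - b' * (f * c * f)"
      by (simp add: algebra_simps)
    also have "\<dots> = f * c * f * b' - b' * (f * c * f)" unfolding assms(3) by simp
    finally show ?thesis by (simp add: algebra_simps)
  qed
  also have "norm \<dots> \<le> 1 * s + (s * 1 + (1 * 1 * t + t * 1 * 1))"
  proof (intro norm_triangle_mono)
    show "norm (f * c * f * (b - b')) \<le> 1 * s" by (rule norm_mult_le) (use d assms(5) in auto)
    show "norm (- ((b - b') * (f * c * f))) \<le> s * 1" unfolding norm_minus_cancel
      by (rule norm_mult_le) (use d assms(5) s in auto)
    show "norm (f * c * (f * b' - b' * f)) \<le> 1 * 1 * t" by (intro norm_mult_le) (use assms in auto)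
    show "norm ((f * b' - b' * f) * c * f) \<le> t * 1 * 1" by (intro norm_mult_le) (use assms t in auto)
  qed
  finally show ?thesis by simp
qed

lemma close_compressions:
  fixes f :: 'a
  assumes "norm f \<le> 1" "norm f' \<le> 1" "norm c \<le> 1" "norm (f - f') \<le> t"
  shows "norm (f * c * f - f' * c * f') \<le> 2 * t"
proof -
  have t: "0 \<le> t" using assms(4) norm_ge_zero order_trans by blast
  have "f * c * f - f' * c * f' = (f - f') * c * f + f' * c * (f - f')" by (simp add: algebra_simps)
  also have "norm \<dots> \<le> t * 1 * 1 + 1 * 1 * t"
    by (intro norm_triangle_mono norm_mult_le) (use assms t in auto)
  finally show ?thesis by simp
qed


section \<open>Commutation with the separable subalgebra and the final projections\<close>

lemma member_norm_le_sum: "finite F \<Longrightarrow> a \<in> F \<Longrightarrow> norm a \<le> (\<Sum>a\<in>F. norm (a::'a))"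
  by (rule member_le_sum) auto

lemma exhausting_sequence:
  assumes "separable_set (B::'a set)" "0 \<in> B"
  obtains s :: "nat \<Rightarrow> 'a" where "range s \<subseteq> B" "\<And>b e. b \<in> B \<Longrightarrow> 0 < e \<Longrightarrow> \<exists>i. norm (b - s i) < e"
proof -
  obtain D where D: "countable D" "D \<subseteq> B" "B \<subseteq> closure D" using assms(1) unfolding separable_set_def by blast
  have ne: "D \<noteq> {}" using D(3) assms(2) by auto
  have rs: "range (from_nat_into D) = D" using D(1) ne by (rule range_from_nat_into[rotated])
  have "\<exists>i. norm (b - from_nat_into D i) < e" if b: "b \<in> B" and e: "0 < e" for b e
  proof -
    have "b \<in> closure D" using D(3) b by blast
    then obtain d where "d \<in> D" "dist d b < e" using e unfolding closure_approachable by blast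
    then obtain i where "dist (from_nat_into D i) b < e" using rs by (metis imageE)
    then show ?thesis by (metis dist_norm norm_minus_commute)
  qed
  then show thesis using that[of "from_nat_into D"] rs D(2) by simp
qed

text \<open>A diagonal choice: the tower with index \<open>n\<close> commutes with the first
  \<open>n + 1\<close> points of a dense sequence up to a tolerance tending to zero, so in the
  ultrapower the compressed sequence commutes with all of \<open>B\<close>.\<close>

lemma compressed_sequence_commutes:
  fixes B :: "'a set"
  assumes u: "free_ultrafilter \<omega>" and s: "\<And>b e. b \<in> B \<Longrightarrow> 0 < e \<Longrightarrow> \<exists>i. norm (b - s i) < e"
    and cs: "\<And>i. c * s i = s i * c" and c: "norm c \<le> 1" and f: "\<And>n. norm (f n) \<le> 1" and tau: "0 < \<tau>"
    and comm: "\<And>n i. i \<le> n \<Longrightarrow> norm (f n * s i - s i * f n) \<le> \<tau> / (real n + 1)"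
    and b: "b \<in> B" and e: "0 < e"
  shows "eventually (\<lambda>n. norm (f n * c * f n * b - b * (f n * c * f n)) < e) \<omega>"
proof -
  obtain i where i: "norm (b - s i) < e / 4" using s[OF b, of "e / 4"] e by auto
  obtain N where N: "4 * \<tau> / e < real N" using reals_Archimedean2 by blast
  from free_ultrafilter_eventually_ge[OF u, of "max i N"] show ?thesis
  proof eventually_elim
    case (elim n)
    then have n: "i \<le> n" "N \<le> n" by auto
    have "4 * \<tau> / e < real n + 1" using N n(2) by linarith
    then have "4 * \<tau> < (real n + 1) * e" using e by (simp add: field_simps)
    then have t: "\<tau> / (real n + 1) < e / 4" by (simp add: field_simps)
    have "norm (f n * c * f n * b - b * (f n * c * f n)) \<le> 2 * (\<tau> / (real n + 1)) + 2 * (e / 4)"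
      by (rule compressed_commutator[OF f c cs comm[OF n(1)] less_imp_le[OF i]])
    also have "\<dots> < e" using t by linarith
    finally show ?case .
  qed
qed

text \<open>Here \<open>q \<one> \<noteq> 0\<close> stands in for condition (d). The order of
  choices matters: tolerances, orthogonal elements under \<open>x\<close>, then \<open>B\<close> and
  \<open>c\<close>, then the norm-one element for the towers, which depends on \<open>c\<close>,
  then all towers, and the index last.\<close>

lemma tower_projections:
  fixes G :: "('g, 'm) monoid_scheme" (structure) and x :: 'a
  assumes grp: "group G" and fin: "finite (carrier G)" and act: "group_action sc adj G \<alpha>"
    and u: "free_ultrafilter \<omega>" and simple: "simple_algebra sc TYPE('a)" and inf: "infinite_dimensional sc TYPE('a)"
    and hyp: "\<forall>F \<epsilon> x. finite F \<and> \<epsilon> > 0 \<and> pos x \<and> x \<noteq> 0 \<longrightarrow>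
          (\<exists>B c. cstar_subalgebra sc adj B \<and> separable_set B \<and>
             pos c \<and> norm c = 1 \<and> (\<forall>b\<in>B. c * b = b * c) \<and>
             (\<forall>a\<in>F. norm (c * a - a * c) < \<epsilon>) \<and>
             (\<forall>a\<in>F. \<exists>b\<in>B. norm (c * a - b) < \<epsilon>) \<and>
             1 - c \<preceq> x \<and> rel_comm_real_rank_zero \<omega> adj B)"
    and weak: "weak_tracial_rokhlin sc adj G \<alpha>"
    and F: "finite F" and eps: "\<epsilon> > 0" and x: "pos x" "x \<noteq> 0"
  shows "\<exists>q. (\<forall>g\<in>carrier G. proj (q g)) \<and> (\<forall>g\<in>carrier G. \<forall>h\<in>carrier G. g \<noteq> h \<longrightarrow> q g * q h = 0) \<and>
    (\<forall>g\<in>carrier G. \<forall>a\<in>F. norm (q g * a - a * q g) < \<epsilon>) \<and>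
    (\<forall>g\<in>carrier G. \<forall>h\<in>carrier G. norm (\<alpha> g (q h) - q (g \<otimes> h)) < \<epsilon>) \<and>
    1 - (\<Sum>g\<in>carrier G. q g) \<preceq> x \<and> q \<one> \<noteq> 0"
proof -
  interpret group G by fact
  note A = group_action_simps[OF grp act]
  let ?S = "carrier G"
  define N where "N = real (card ?S)"
  have N1: "N \<ge> 1" unfolding N_def using fin one_closed by (metis One_nat_def Suc_leI card_gt_0_iff empty_iff of_nat_1 of_nat_le_iff)
  define K where "K = 1 + (\<Sum>a\<in>F. norm a)"
  have K: "K \<ge> 1" "\<And>a. a \<in> F \<Longrightarrow> norm a \<le> K"
    using member_norm_le_sum[OF F] by (simp_all add: K_def sum_nonneg add_increasing)

  text \<open>The constants: \<open>\<delta>\<close> is where the spectrum of \<open>f c f\<close> is cut, everything below is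
    small compared with \<open>\<delta>\<close>.\<close>
  define \<delta> where "\<delta> = min (1/4) ((\<epsilon> / (32 * K))\<^sup>2 / 2)"
  have del: "0 < \<delta>" "\<delta> \<le> 1/4" "2 * \<delta> \<le> (\<epsilon> / (32 * K))\<^sup>2" using eps K by (auto simp: \<delta>_def)
  \<comment> \<open>\<nu> is the distance allowed between the final \<open>q g\<close> and
    \<open>P g\<close>. The first entry serves commutators and equivariance, the second the cubic
    number of errors in \<open>complement_cb\<close>, the last keeps \<open>q \<one>\<close>
    nonzero.\<close>
  define \<nu> where "\<nu> = min (\<epsilon> / (8 * K)) (min (\<delta> / (8 * N ^ 3)) (1/2))"
  have N3: "N ^ 3 > 0" "N\<^sup>2 + 2 > 0" using N1 by (auto simp: add_nonneg_pos)
  have nu: "0 < \<nu>" "\<nu> \<le> \<epsilon> / (8 * K)" "\<nu> \<le> \<delta> / (8 * N ^ 3)" "\<nu> < 1" using eps K del N3 by (auto simp: \<nu>_def)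
  obtain \<delta>o where delo: "\<delta>o > 0" and orth: "\<forall>p. (\<forall>i\<in>?S. proj (p i)) \<and> (\<forall>i\<in>?S. \<forall>j\<in>?S. i \<noteq> j \<longrightarrow> norm (p i * p j) \<le> \<delta>o) \<longrightarrow>
    (\<exists>q. (\<forall>i\<in>?S. proj (q i)) \<and> (\<forall>i\<in>?S. \<forall>j\<in>?S. i \<noteq> j \<longrightarrow> q i * q j = 0) \<and> (\<forall>i\<in>?S. norm (q i - p i) \<le> \<nu>))"
    using orthogonalize_projs[OF fin nu(1)] by (elim exE conjE) (rule that)
  \<comment> \<open>\<open>3 * \<theta>\<close> will bound \<open>norm (P g * P h)\<close>, so it
    must not exceed \<open>\<delta>o\<close>; \<theta> also enters the cubic errors.\<close>
  define \<theta> where "\<theta> = min (\<delta>o / 3) (\<delta> / (8 * N ^ 3))"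
  have th: "0 < \<theta>" "3 * \<theta> \<le> \<delta>o" "\<theta> \<le> \<delta> / (8 * N ^ 3)" using delo del N3 by (auto simp: \<theta>_def)
  define \<eta> where "\<eta> = min (\<delta> / 8) (\<theta> / 4)"
  have eta: "0 < \<eta>" "\<eta> \<le> \<delta> / 8" "\<eta> \<le> \<theta> / 4" using th del by (auto simp: \<eta>_def)
  \<comment> \<open>\<open>2 * \<eta> + 4 * \<tau> \<le> \<theta>\<close> will control
    \<open>P g - U g * T g\<close>. The last entry of \<tau> feeds \<open>large_tower\<close>. The
    bounds \<open>\<delta> / 8\<close> for \<eta> and \<open>2 * \<tau>\<close>, with
    \<open>\<delta> / 4\<close> from \<open>N3s\<close>, leave at most
    \<open>1 - \<delta> / 2\<close> in \<open>complement_cb\<close>.\<close>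
  define \<tau> where "\<tau> = min (\<delta> / 16) (min (\<theta> / 8) (\<delta> / (8 * (N\<^sup>2 + 2))))"
  have tau: "0 < \<tau>" "\<tau> \<le> \<delta> / 16" "\<tau> \<le> \<theta> / 8" "\<tau> \<le> \<delta> / (8 * (N\<^sup>2 + 2))"
    unfolding \<tau>_def using th(1) del(1) N3(2)
    by (simp, intro min.cobounded1, intro order_trans[OF min.cobounded2 min.cobounded1],
      intro order_trans[OF min.cobounded2 min.cobounded2])
  have tauN: "(N\<^sup>2 + 2) * \<tau> \<le> \<delta> / 8"
  proof -
    have "\<tau> * (8 * m) \<le> \<delta>" if "\<tau> \<le> \<delta> / (8 * m)" "0 < m" for m
      using that by (simp add: pos_le_divide_eq)
    from this[OF tau(4) N3(2)] show ?thesis by (simp add: algebra_simps)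
  qed
  have N3s: "N ^ 3 * (\<nu> + \<theta>) \<le> \<delta> / 4"
  proof -
    have "N ^ 3 * (\<nu> + \<theta>) \<le> N ^ 3 * (\<delta> / (8 * N ^ 3) + \<delta> / (8 * N ^ 3))"
      using nu(3) th(3) N3 by (intro mult_left_mono add_mono) auto
    also have "\<dots> = \<delta> / 4" using N3(1) by simp
    finally show ?thesis .
  qed

  let ?I = "insert None (Some ` ?S)"
  have finI: "finite ?I" using fin by simp
  obtain y where y: "\<And>i. i \<in> ?I \<Longrightarrow> adj (y i) = y i" "\<And>i. i \<in> ?I \<Longrightarrow> y i \<noteq> 0" "\<And>i. i \<in> ?I \<Longrightarrow> y i \<in> lideal x"
    "\<And>i j. i \<in> ?I \<Longrightarrow> j \<in> ?I \<Longrightarrow> i \<noteq> j \<Longrightarrow> y i * y j = 0"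
    by (rule orthogonal_family[OF simple inf pos_sa[OF x(1)] x(2) finI]) (rule that; assumption)
  \<comment> \<open>The defect \<open>1 - c\<close> must be small after every translation. So
    \<open>z\<close> is put below the inverse translates of the \<open>y (Some g)\<close>, and
    applying \<open>\<alpha> g\<close> to \<open>1 - c \<preceq> z * adj z\<close> leads back to
    \<open>y (Some g)\<close>.\<close>
  have "\<alpha> (inv g) (y (Some g)) \<noteq> 0" if "g \<in> ?S" for g
    using star_automorphism_simps(10)[OF A(1)[OF inv_closed[OF that]]] y(2)[of "Some g"] that by simp
  from cb_common_lower_bound[OF simple fin, of "\<lambda>g. \<alpha> (inv g) (y (Some g))", OF this]
  obtain z where z: "z \<noteq> 0" "\<And>g. g \<in> ?S \<Longrightarrow> z * adj z \<preceq> \<alpha> (inv g) (y (Some g)) * adj (\<alpha> (inv g) (y (Some g)))"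
    by blast
  have zz: "\<alpha> g (z * adj z) \<preceq> y (Some g) * y (Some g)" if g: "g \<in> ?S" for g
  proof -
    have "adj (\<alpha> (inv g) (y (Some g))) = \<alpha> (inv g) (y (Some g))"
      using star_automorphism_simps(4)[OF A(1)[OF inv_closed[OF g]], of "y (Some g)"] y(1)[of "Some g"] g by simp
    then show ?thesis
      using star_automorphism_cb[OF A(1)[OF g] z(2)[OF g]] star_automorphism_simps(2)[OF A(1)[OF g]] A(4)[OF g] by simp
  qed
  have zz0: "z * adj z \<noteq> 0" using cstar_identity'[of z] z(1) by auto
  \<comment> \<open>\<open>\<alpha> g p\<close> commutes with \<open>a\<close> as well as
    \<open>p\<close> does with \<open>\<alpha> (inv g) a\<close>, so \<open>c\<close> and
    \<open>B\<close> are chosen for these inverse translates.\<close>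
  define F0 where "F0 = (\<Union>g\<in>?S. \<alpha> (inv g) ` F)"
  have F0: "finite F0" using fin F by (simp add: F0_def)
  have "\<epsilon> / 24 > 0" using eps by simp
  from hyp[rule_format, OF conjI[OF F0 conjI[OF this conjI[OF pos_mult_adj zz0]]]] obtain B c where Bc: "cstar_subalgebra sc adj B" "separable_set B"
    "pos c" "norm c = 1" "\<And>b. b \<in> B \<Longrightarrow> c * b = b * c" "\<And>a. a \<in> F0 \<Longrightarrow> norm (c * a - a * c) < \<epsilon> / 24"
    "\<And>a. a \<in> F0 \<Longrightarrow> \<exists>b\<in>B. norm (c * a - b) < \<epsilon> / 24"
    "1 - c \<preceq> z * adj z" "rel_comm_real_rank_zero \<omega> adj B"
    by (elim exE conjE) (rule that, simp_all)
  obtain bb where bb: "\<And>a. a \<in> F0 \<Longrightarrow> bb a \<in> B" "\<And>a. a \<in> F0 \<Longrightarrow> norm (c * a - bb a) < \<epsilon> / 24" using Bc(7) by metis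
  have c1: "norm c \<le> 1" using Bc(4) by simp

  \<comment> \<open>The element fed to the weak Rokhlin property has two aims: being nearly fixed by
    \<open>c\<close> it forces \<open>f c f\<close> to be large, and lying below
    \<open>y None * y None\<close> it bounds the uncovered part.\<close>
  have "0 < \<delta> / 4" using del by simp
  from small_element_under_peak[OF simple Bc(3,4) this y(1,2)[of None]]
  obtain w where w: "pos w" "norm w = 1" "norm ((1 - c) * w) \<le> \<delta> / 4" "w \<preceq> y None * y None" by auto
  have "0 \<in> B" using Bc(1) by (simp add: cstar_subalgebra_def)
  then obtain s :: "nat \<Rightarrow> 'a" where s: "range s \<subseteq> B" "\<And>b e. b \<in> B \<Longrightarrow> 0 < e \<Longrightarrow> \<exists>i. norm (b - s i) < e"
    by (rule exhausting_sequence[OF Bc(2)]) (rule that; assumption)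
  \<comment> \<open>The lower bound \<open>1 - \<delta> + \<eta>\<close> is the one from which
    \<open>tower_projection\<close> concludes that the projection is nonzero.\<close>
  have ex: "\<exists>f. towers G \<alpha> (s ` {..n}) (\<tau> / (real n + 1)) w f \<and> 1 - \<delta> + \<eta> < norm (f \<one> * c * f \<one>)" for n
  proof (rule large_tower[OF grp fin weak Bc(4) w(1-3)])
    have "\<tau> / (real n + 1) \<le> \<tau>" using tau(1) by (simp add: field_simps)
    then have "(N\<^sup>2 + 2) * (\<tau> / (real n + 1)) \<le> (N\<^sup>2 + 2) * \<tau>" using N3 by (intro mult_left_mono) auto
    then show "1 - \<delta> + \<eta> < 1 - \<delta> / 4 - (real (card ?S) ^ 2 + 2) * (\<tau> / (real n + 1))"
      using tauN eta(2) del(1) unfolding N_def[symmetric] by linarith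
    show "0 < \<tau> / (real n + 1)" using tau(1) by simp
    show "0 \<le> 1 - \<delta> + \<eta>" using del eta by simp
  qed simp
  have "\<forall>n. \<exists>f. towers G \<alpha> (s ` {..n}) (\<tau> / (real n + 1)) w f \<and> 1 - \<delta> + \<eta> < norm (f \<one> * c * f \<one>)"
    by (intro allI ex)
  from choice[OF this] obtain f where
    all: "\<forall>n. towers G \<alpha> (s ` {..n}) (\<tau> / (real n + 1)) w (f n) \<and> 1 - \<delta> + \<eta> < norm (f n \<one> * c * f n \<one>)"
    by (rule exE)
  have f: "towers G \<alpha> (s ` {..n}) (\<tau> / (real n + 1)) w (f n)" "1 - \<delta> + \<eta> < norm (f n \<one> * c * f n \<one>)" for n
    using all[THEN spec, of n] by simp_all
  have f1: "pos (f n \<one>)" "norm (f n \<one>) \<le> 1" for n using towersD(1,2)[OF f(1)] by blast+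
  have comm: "eventually (\<lambda>n. norm (f n \<one> * c * f n \<one> * b - b * (f n \<one> * c * f n \<one>)) < e) \<omega>" if "b \<in> B" "e > 0" for b e
  proof (rule compressed_sequence_commutes[OF u s(2) _ c1 f1(2) tau(1) _ that])
    show "c * s i = s i * c" for i using Bc(5) s(1) by blast
    show "norm (f n \<one> * s i - s i * f n \<one>) \<le> \<tau> / (real n + 1)" if "i \<le> n" for n i
      using towersD(4)[OF f(1)[of n] one_closed, of "s i"] that by simp
  qed
  have "\<exists>n y M. 0 < M \<and> adj y = y \<and> (\<forall>t\<in>rspec y. 1 / (2 * M) \<le> \<bar>t\<bar>) \<and>
    norm (y + (1 - \<delta>) *\<^sub>R 1 - f n \<one> * c * f n \<one>) \<le> \<eta> \<and>
    (\<forall>b\<in>bb ` F0. norm (cfc y (jump M) * b - b * cfc y (jump M)) \<le> \<epsilon> / 8)"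
  proof (rule real_rank_zero_gap[OF u Bc(9) _ _ comm eta(1)])
    show "adj (f n \<one> * c * f n \<one>) = f n \<one> * c * f n \<one>" for n
      by (simp add: adj_mult pos_sa[OF f1(1)] pos_sa[OF Bc(3)] mult.assoc)
    have "norm (f n \<one> * c * f n \<one>) \<le> 1 * 1 * 1" for n
      by (intro norm_mult_le f1 c1)
    then show "norm (f n \<one> * c * f n \<one>) \<le> 1" for n by simp
  qed (use F0 bb(1) eps in auto)
  then obtain n v M where M: "0 < M" and v: "adj v = v" "\<forall>t\<in>rspec v. 1 / (2 * M) \<le> \<bar>t\<bar>"
    "norm (v + (1 - \<delta>) *\<^sub>R 1 - f n \<one> * c * f n \<one>) \<le> \<eta>"
    "\<forall>b\<in>bb ` F0. norm (cfc v (jump M) * b - b * cfc v (jump M)) \<le> \<epsilon> / 8"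
    by (elim exE conjE) (rule that)
  define p where "p = cfc v (jump M)"
  define d where "d = f n \<one> * c * f n \<one>"
  have ed: "\<eta> \<le> \<delta>" using eta del by simp
  have gap: "1 / (2 * M) \<le> \<bar>t\<bar>" if "t \<in> rspec v" for t using v(2) that by blast
  note tp = tower_projection[OF f1[of n] Bc(3) c1 v(1) gap M del(1,2) eta(1) ed v(3), folded p_def d_def]
  have p: "proj p" by (rule tp(1))
  have cp: "norm ((1 - c) * p) \<le> 2 * sqrt (\<delta> + \<eta>)" by (rule tp(4))
  have p0: "p \<noteq> 0" using tp(5) f(2)[of n] by (simp add: d_def)
  obtain r where r: "norm r \<le> 2" "norm (p - r * d) \<le> 2 * \<eta>" using tp(2) by blast
  \<comment> \<open>The estimate for \<open>(1 - c) * p\<close> loses a square root, which is why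
    \<delta> was chosen below a square.\<close>
  have sq: "2 * sqrt (\<delta> + \<eta>) \<le> \<epsilon> / (16 * K)"
  proof -
    have "\<delta> + \<eta> \<le> (\<epsilon> / (32 * K))\<^sup>2" using del(3) ed by linarith
    then have "sqrt (\<delta> + \<eta>) \<le> \<epsilon> / (32 * K)" using eps K by (intro real_le_lsqrt) auto
    then show ?thesis by simp
  qed

  define P where "P g = \<alpha> g p" for g
  define U where "U g = \<alpha> g r" for g
  \<comment> \<open>Using \<open>f n g\<close> instead of \<open>\<alpha> g (f n \<one>)\<close>
    makes the \<open>T g\<close> exactly orthogonal, while \<open>\<alpha> g d\<close> is at most
    \<open>2 * \<tau>\<close> away.\<close>
  define T where "T g = f n g * \<alpha> g c * f n g" for g
  note t = towersD[OF f(1)[of n]]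
  have tn: "\<tau> / (real n + 1) \<le> \<tau>" using tau(1) by (simp add: field_simps)
  have nac: "norm (\<alpha> g c) \<le> 1" if "g \<in> ?S" for g
    using star_automorphism_norm_le[OF A(1)[OF that], of c] c1 by linarith
  have Pp: "proj (P g)" if "g \<in> ?S" for g unfolding P_def by (rule star_automorphism_proj[OF A(1)[OF that] p])
  have T1: "adj (T g) = T g" if "g \<in> ?S" for g
    using star_automorphism_simps(4)[OF A(1)[OF that], of c]
    by (simp add: T_def adj_mult pos_sa[OF t(1)[OF that]] pos_sa[OF Bc(3)] mult.assoc)
  have T2: "norm (T g) \<le> 1" if "g \<in> ?S" for g
  proof -
    have "norm (T g) \<le> 1 * 1 * 1" unfolding T_def
      by (intro norm_mult_le t(2) nac that)
    then show ?thesis by simp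
  qed
  have T3: "T g * T h = 0" if "g \<in> ?S" "h \<in> ?S" "g \<noteq> h" for g h
  proof -
    have "T g * T h = f n g * \<alpha> g c * (f n g * f n h) * \<alpha> h c * f n h" by (simp add: T_def mult.assoc)
    then show ?thesis using t(3)[OF that] by simp
  qed
  have Td: "norm (\<alpha> g d - T g) \<le> 2 * \<tau>" if g: "g \<in> ?S" for g
  proof -
    have "norm (\<alpha> g (f n \<one>) - f n g) \<le> \<tau>" using t(5)[OF g one_closed] tn g by simp
    moreover have "norm (\<alpha> g (f n \<one>)) \<le> 1" using star_automorphism_norm_le[OF A(1)[OF g], of "f n \<one>"] f1(2)[of n] by linarith
    ultimately show ?thesis unfolding d_def T_def star_automorphism_simps(2)[OF A(1)[OF g]]
      by (intro close_compressions t(2) g nac)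
  qed
  have U1: "norm (U g) \<le> 2" if "g \<in> ?S" for g
    using star_automorphism_norm_le[OF A(1)[OF that], of r] r(1) by (simp add: U_def)
  have U2: "norm (P g - U g * T g) \<le> \<theta>" if g: "g \<in> ?S" for g
  proof -
    have "P g - U g * T g = \<alpha> g (p - r * d) + U g * (\<alpha> g d - T g)"
      by (simp add: P_def U_def star_automorphism_simps[OF A(1)[OF g]] algebra_simps)
    also have "norm \<dots> \<le> 2 * \<eta> + 2 * (2 * \<tau>)"
      by (rule norm_triangle_mono[OF order_trans[OF star_automorphism_norm_le[OF A(1)[OF g]] r(2)] norm_mult_le])
        (use U1[OF g] Td[OF g] in auto)
    also have "\<dots> \<le> \<theta>" using eta(3) tau(3) by linarith
    finally show ?thesis .
  qed
  have l1: "norm ((1 - P g) * T g) \<le> 1 - \<delta> + \<eta> + 2 * \<tau>" if g: "g \<in> ?S" for g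
  proof -
    have "(1 - P g) * T g = \<alpha> g ((1 - p) * d) - (1 - P g) * (\<alpha> g d - T g)"
      by (simp add: P_def star_automorphism_simps[OF A(1)[OF g]] algebra_simps)
    also have "norm \<dots> \<le> (1 - \<delta> + \<eta>) + 1 * (2 * \<tau>)"
      by (rule norm_diff_mono[OF order_trans[OF star_automorphism_norm_le[OF A(1)[OF g]] tp(3)] norm_mult_le])
        (use Td[OF g] proj_norm[OF proj_one_minus[OF Pp[OF g]]] in auto)
    finally show ?thesis by simp
  qed
  have l0: "0 < 1 - \<delta> + \<eta> + 2 * \<tau>" using del eta tau by simp
  have "norm (P g * P h) \<le> \<delta>o" if "g \<in> ?S" "h \<in> ?S" "g \<noteq> h" for g h
    using almost_orthogonal_projs(3)[where S = ?S and P = P and T = T and U = U, OF Pp T1 T2 T3 U1 U2 that] th(2) by linarith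
  then have "(\<forall>i\<in>?S. proj (P i)) \<and> (\<forall>i\<in>?S. \<forall>j\<in>?S. i \<noteq> j \<longrightarrow> norm (P i * P j) \<le> \<delta>o)" using Pp by simp
  from orth[THEN spec, THEN mp, OF this] obtain q where
    "(\<forall>i\<in>?S. proj (q i)) \<and> (\<forall>i\<in>?S. \<forall>j\<in>?S. i \<noteq> j \<longrightarrow> q i * q j = 0) \<and> (\<forall>i\<in>?S. norm (q i - P i) \<le> \<nu>)" by (rule exE)
  then have q: "\<And>g. g \<in> ?S \<Longrightarrow> proj (q g)" "\<And>g h. g \<in> ?S \<Longrightarrow> h \<in> ?S \<Longrightarrow> g \<noteq> h \<Longrightarrow> q g * q h = 0"
    "\<And>g. g \<in> ?S \<Longrightarrow> norm (q g - P g) \<le> \<nu>" by simp_all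

  have "1 - sum q ?S \<preceq> 1 - sum T ?S"
  proof (rule complement_cb[where P = P and T = T and U = U and q = q, OF fin Pp T1 T2 T3 U1 U2 l1 l0 q])
    show "1 - \<delta> + \<eta> + 2 * \<tau> + real (card ?S) ^ 3 * (\<nu> + \<theta>) < 1"
      using N3s eta(2) tau(2) del(1) unfolding N_def[symmetric] by linarith
  qed (use nu(1) th(1) in auto)
  moreover have "1 - sum T ?S \<preceq> x" unfolding T_def
  proof (rule tower_remainder_cb[where f = "f n" and y = y, OF fin t(1-3) x(1) y(1,3,4)])
    show "1 - sum (f n) ?S \<preceq> y None * y None" by (rule cb_trans[OF t(6) w(4)])
    fix g assume g: "g \<in> ?S"
    have "\<alpha> g (1 - c) \<preceq> \<alpha> g (z * adj z)" by (rule star_automorphism_cb[OF A(1)[OF g] Bc(8)])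
    from cb_trans[OF this zz[OF g]] show "1 - \<alpha> g c \<preceq> y (Some g) * y (Some g)"
      by (simp add: star_automorphism_simps[OF A(1)[OF g]])
  qed
  ultimately have q4: "1 - (\<Sum>g\<in>?S. q g) \<preceq> x" by (rule cb_trans)

  have "P \<one> = p" unfolding P_def by (rule A(3))
  \<comment> \<open>\<open>q \<one>\<close> is within \<open>\<nu> < 1\<close> of \<open>p\<close>,
    a nonzero projection and hence of norm one.\<close>
  then have q5: "q \<one> \<noteq> 0" using q(3)[OF one_closed] nu(4) proj_norm_nonzero[OF p p0] by auto
  have q6: "norm (q g * a - a * q g) < \<epsilon>" if g: "g \<in> ?S" and a: "a \<in> F" for g a
  proof -
    define a' where "a' = \<alpha> (inv g) a"
    have a': "a' \<in> F0" using g a unfolding a'_def F0_def by blast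
    have na': "norm a' \<le> K"
      using star_automorphism_norm_le[OF A(1)[OF inv_closed[OF g]], of a] K(2)[OF a] by (simp add: a'_def)
    \<comment> \<open>The cutoff, the errors of \<open>c\<close> on \<open>a'\<close> and the
      commutator of \<open>p\<close> with \<open>B\<close> contribute \<open>\<epsilon> / 8\<close>
      each; replacing \<open>P g\<close> by \<open>q g\<close> adds at most
      \<open>\<epsilon> / 4\<close>.\<close>
    have "norm (p * a' - a' * p) \<le> 2 * (2 * sqrt (\<delta> + \<eta>)) * norm a' + 3 * (\<epsilon> / 24) + \<epsilon> / 8"
      by (rule commutator_via_cutoff[OF p pos_sa[OF Bc(3)] cp less_imp_le[OF Bc(6)[OF a']] less_imp_le[OF bb(2)[OF a']]])
        (unfold p_def, rule v(4)[rule_format, OF imageI[OF a']])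
    also have "2 * (2 * sqrt (\<delta> + \<eta>)) * norm a' \<le> 2 * (\<epsilon> / (16 * K)) * K"
      using sq na' eps K del(1) eta(1) by (intro mult_mono) auto
    also have "\<dots> = \<epsilon> / 8" using K by simp
    finally have pa: "norm (p * a' - a' * p) \<le> 3 * \<epsilon> / 8" by simp
    have "\<alpha> g (p * a' - a' * p) = P g * a - a * P g"
      unfolding P_def a'_def star_automorphism_simps[OF A(1)[OF g]] A(4)[OF g] ..
    then have Pa: "norm (P g * a - a * P g) \<le> 3 * \<epsilon> / 8" using star_automorphism_norm_le[OF A(1)[OF g], of "p * a' - a' * p"] pa by simp
    have nuK: "\<nu> * K \<le> \<epsilon> / 8" using nu(2) K by (simp add: field_simps)
    have "q g * a - a * q g = (P g * a - a * P g) + ((q g - P g) * a - a * (q g - P g))" by (simp add: algebra_simps)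
    also have "norm \<dots> \<le> 3 * \<epsilon> / 8 + (\<nu> * K + K * \<nu>)"
      by (rule norm_triangle_mono[OF Pa norm_diff_mono[OF norm_mult_le norm_mult_le]])
        (use q(3)[OF g] K(1) K(2)[OF a] nu(1) in auto)
    also have "\<dots> < \<epsilon>" using nuK eps by (simp add: mult.commute)
    finally show ?thesis .
  qed
  have q7: "norm (\<alpha> g (q h) - q (g \<otimes> h)) < \<epsilon>" if g: "g \<in> ?S" and h: "h \<in> ?S" for g h
  proof -
    have gh: "g \<otimes> h \<in> ?S" using g h by simp
    have "\<alpha> g (q h) - q (g \<otimes> h) = \<alpha> g (q h - P h) - (q (g \<otimes> h) - P (g \<otimes> h))"
      by (simp add: star_automorphism_simps[OF A(1)[OF g]] P_def A(2)[OF g h])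
    also have "norm \<dots> \<le> \<nu> + \<nu>"
      by (rule norm_diff_mono[OF order_trans[OF star_automorphism_norm_le[OF A(1)[OF g]] q(3)[OF h]] q(3)[OF gh]])
    also have "\<dots> < \<epsilon>"
    proof -
      have "\<epsilon> / (8 * K) \<le> \<epsilon> / 8" using eps K by (simp add: field_simps)
      then show ?thesis using nu(2) eps by linarith
    qed
    finally show ?thesis .
  qed
  show ?thesis by (intro exI[of _ q] conjI ballI impI q(1,2) q4 q5 q6 q7)
qed

text \<open>For (d) it is enough that the sum of the projections is nonzero and almost commutes with
  a finite set depending on \<open>x\<close> and \<epsilon> only. This set is added to
  \<open>F\<close> before the projections are constructed.\<close>

lemma tracial_of_weak_tracial:
  fixes G :: "('g, 'm) monoid_scheme" (structure)
  assumes grp: "group G" and fin: "finite (carrier G)" and act: "group_action sc adj G \<alpha>"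
    and u: "free_ultrafilter \<omega>" and simple: "simple_algebra sc TYPE('a)" and inf: "infinite_dimensional sc TYPE('a)"
    and hyp: "\<forall>F \<epsilon> x. finite F \<and> \<epsilon> > 0 \<and> pos x \<and> x \<noteq> 0 \<longrightarrow>
          (\<exists>B c. cstar_subalgebra sc adj B \<and> separable_set B \<and>
             pos c \<and> norm c = 1 \<and> (\<forall>b\<in>B. c * b = b * c) \<and>
             (\<forall>a\<in>F. norm (c * a - a * c) < \<epsilon>) \<and>
             (\<forall>a\<in>F. \<exists>b\<in>B. norm (c * a - b) < \<epsilon>) \<and>
             1 - c \<preceq> x \<and> rel_comm_real_rank_zero \<omega> adj B)"
    and weak: "weak_tracial_rokhlin sc adj G \<alpha>"
  shows "tracial_rokhlin sc adj G \<alpha>"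
  unfolding rokhlin_prop_def
proof (intro allI impI)
  interpret group G by fact
  fix F :: "'a set" and \<epsilon> :: real and x :: 'a
  assume H: "finite F \<and> 0 < \<epsilon> \<and> pos x \<and> norm x = 1"
  then have x: "pos x" "norm x = 1" "x \<noteq> 0" and eps: "0 < \<epsilon>" and F: "finite F" by auto
  obtain F' \<tau> where F': "finite F'" "\<tau> > 0"
    "\<And>q. proj q \<Longrightarrow> q \<noteq> 0 \<Longrightarrow> (\<forall>a\<in>F'. norm (q * a - a * q) \<le> \<tau>) \<Longrightarrow> norm (q * x * q) > 1 - \<epsilon>"
    using almost_central_proj_norm[OF simple x(1,2) eps] by blast
  define N where "N = real (card (carrier G)) + 1"
  have N: "N > 0" by (simp add: N_def add_nonneg_pos)
  \<comment> \<open>The commutators of the summands add up over the group, hence the division by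
    \<open>N\<close>.\<close>
  define e where "e = min \<epsilon> (\<tau> / N)"
  have e: "e > 0" "e \<le> \<epsilon>" "e \<le> \<tau> / N" using eps F'(2) N by (auto simp: e_def)
  have "finite (F \<union> F')" using F F'(1) by simp
  from tower_projections[OF grp fin act u simple inf hyp weak this e(1) x(1,3)]
  obtain q where q: "\<forall>g\<in>carrier G. proj (q g)" "\<forall>g\<in>carrier G. \<forall>h\<in>carrier G. g \<noteq> h \<longrightarrow> q g * q h = 0"
    "\<forall>g\<in>carrier G. \<forall>a\<in>F \<union> F'. norm (q g * a - a * q g) < e"
    "\<forall>g\<in>carrier G. \<forall>h\<in>carrier G. norm (\<alpha> g (q h) - q (g \<otimes> h)) < e"
    "1 - (\<Sum>g\<in>carrier G. q g) \<preceq> x" "q \<one> \<noteq> 0"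
    by (elim exE conjE) (rule that)
  let ?Q = "\<Sum>g\<in>carrier G. q g"
  have Q: "proj ?Q" "?Q * q \<one> = q \<one>"
    using proj_sum[where S = "carrier G" and q = q, OF fin] q(1,2) by auto
  then have "?Q \<noteq> 0" using q(6) by auto
  have "norm (?Q * x * ?Q) > 1 - \<epsilon>"
  proof (rule F'(3)[OF Q(1) \<open>?Q \<noteq> 0\<close>], intro ballI)
    fix a assume a: "a \<in> F'"
    have "?Q * a - a * ?Q = (\<Sum>g\<in>carrier G. q g * a - a * q g)"
      by (simp add: sum_distrib_left sum_distrib_right sum_subtractf)
    also have "norm \<dots> \<le> (\<Sum>g\<in>carrier G. e)"
      by (intro order_trans[OF norm_sum] sum_mono less_imp_le) (use q(3) a in blast)
    also have "\<dots> \<le> N * e" using e by (simp add: N_def distrib_right)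
    also have "\<dots> \<le> \<tau>" using e(3) N by (simp add: field_simps)
    finally show "norm (?Q * a - a * ?Q) \<le> \<tau>" .
  qed
  moreover have "pos_contraction sc adj (q g)" if "g \<in> carrier G" for g
    using q(1) that proj_pos proj_norm unfolding pos_contraction_def by blast
  moreover have "norm (q g * a - a * q g) < \<epsilon>" if "g \<in> carrier G" "a \<in> F" for g a
    using q(3) that e(2) by (meson UnI1 less_le_trans)
  moreover have "norm (\<alpha> g (q h) - q (g \<otimes> h)) < \<epsilon>" if "g \<in> carrier G" "h \<in> carrier G" for g h
    using q(4) that e(2) by (meson less_le_trans)
  ultimately show "\<exists>f. (\<forall>g\<in>carrier G. pos_contraction sc adj (f g) \<and> (True \<longrightarrow> proj (f g))) \<and>
         (\<forall>g\<in>carrier G. \<forall>h\<in>carrier G. g \<noteq> h \<longrightarrow> f g * f h = 0) \<and>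
         (\<forall>g\<in>carrier G. \<forall>a\<in>F. norm (f g * a - a * f g) < \<epsilon>) \<and>
         (\<forall>g\<in>carrier G. \<forall>h\<in>carrier G. norm (\<alpha> g (f h) - f (g \<otimes> h)) < \<epsilon>) \<and>
         1 - (\<Sum>g\<in>carrier G. f g) \<preceq> x \<and>
         norm ((\<Sum>g\<in>carrier G. f g) * x * (\<Sum>g\<in>carrier G. f g)) > 1 - \<epsilon>"
    using q(1,2,5) by (intro exI[of _ q] conjI ballI impI) auto
qed

end

theorem theorem1p2:
  fixes sc :: "complex \<Rightarrow> 'a::{real_normed_algebra_1, banach} \<Rightarrow> 'a"
    and adj :: "'a \<Rightarrow> 'a"
    and G :: "('g, 'm) monoid_scheme"
    and \<alpha> :: "'g \<Rightarrow> 'a \<Rightarrow> 'a"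
    and \<omega> :: "nat filter"
  assumes "unital_cstar_algebra sc adj"
    and "simple_algebra sc TYPE('a)"
    and "infinite_dimensional sc TYPE('a)"
    and "group G" and "finite (carrier G)"
    and "group_action sc adj G \<alpha>"
    and "free_ultrafilter \<omega>"
    and "\<forall>F \<epsilon> x. finite F \<and> \<epsilon> > 0 \<and> positive_el sc adj x \<and> x \<noteq> 0 \<longrightarrow>
          (\<exists>B c. cstar_subalgebra sc adj B \<and> separable_set B \<and>
             positive_el sc adj c \<and> norm c = 1 \<and> (\<forall>b\<in>B. c * b = b * c) \<and>
             (\<forall>a\<in>F. norm (c * a - a * c) < \<epsilon>) \<and>
             (\<forall>a\<in>F. \<exists>b\<in>B. norm (c * a - b) < \<epsilon>) \<and>
             cuntz_below adj (1 - c) x \<and>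
             rel_comm_real_rank_zero \<omega> adj B)"
  shows "tracial_rokhlin sc adj G \<alpha> \<longleftrightarrow> weak_tracial_rokhlin sc adj G \<alpha>"
proof
  assume "tracial_rokhlin sc adj G \<alpha>"
  then show "weak_tracial_rokhlin sc adj G \<alpha>"
    unfolding rokhlin_prop_def by (elim all_forward imp_forward ex_forward conj_forward) simp_all
next
  interpret unital_cstar_algebra sc adj by fact
  assume "weak_tracial_rokhlin sc adj G \<alpha>"
  then show "tracial_rokhlin sc adj G \<alpha>"
    by (rule tracial_of_weak_tracial[OF assms(4-7,2,3,8)])
qed

end
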